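(* Fix $R>0$. There exist a constant $C<\infty$ depending only on $R$ and an absolute constant $\bar C>0$ such that the following holds. Let $n,d$ be positive integers with $1\le d\le n^{100}$, let $z\in\mathbb C$ with $|z|\le R$, and let $S_n^d=\sum_{\ell=1}^d P_n^\ell$ where $P_n^1,\dots,P_n^d$ are the permutation matrices ($P_n^\ell(i,j)=\mathbf 1(\pi_n^\ell(i)=j)$) of independent uniformly random permutations $\pi_n^1,\dots,\pi_n^d$ of $[n]$. Then $$\mathbb P\Big\{ s_n\Big(\tfrac{1}{\sqrt d}S_n^d-zI_n\Big)\le n^{-\bar C\log_{d\wedge n} n}\Big\}\le C\,\frac{\log^4 n}{\sqrt{d\wedge n}},$$ where $s_n(\cdot)$ denotes the smallest singular value and $d\wedge n=\min(d,n)$.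
   Formalization: The formal theorem assumes n ≥ 2: for n = 1 (so d = 1) the logarithm to base 1 is undefined and the right side is 0 while the event can be certain (z = min(R,1)). For d = 1 and n ≥ 2 the undefined log_1 n is read as 0. *)

theory Defs
  imports "HOL-Analysis.Analysis" "HOL-Combinatorics.Permutations"
begin

text \<open>Square complex matrices of size n are represented as functions
  nat \<Rightarrow> nat \<Rightarrow> complex, only entries with indices < n are relevant;
  vectors in C^n as nat \<Rightarrow> complex (coordinates < n).\<close>

definition vnorm :: "nat \<Rightarrow> (nat \<Rightarrow> complex) \<Rightarrow> real" where
  "vnorm n x = sqrt (\<Sum>i<n. (cmod (x i))\<^sup>2)"

definition mat_vec :: "nat \<Rightarrow> (nat \<Rightarrow> nat \<Rightarrow> complex) \<Rightarrow> (nat \<Rightarrow> complex) \<Rightarrow> (nat \<Rightarrow> complex)" where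
  "mat_vec n A x = (\<lambda>i. \<Sum>j<n. A i j * x j)"

definition smallest_sv :: "nat \<Rightarrow> (nat \<Rightarrow> nat \<Rightarrow> complex) \<Rightarrow> real" where
  "smallest_sv n A = Inf {vnorm n (mat_vec n A x) | x. vnorm n x = 1}"

text \<open>Sample space: d-tuples of permutations of [n] = {0..<n}
  (entries at positions \<ge> d are fixed to id, so the uniform measure on this
  finite set is the law of d independent uniform permutations).\<close>
definition perm_tuples :: "nat \<Rightarrow> nat \<Rightarrow> (nat \<Rightarrow> nat \<Rightarrow> nat) set" where
  "perm_tuples n d = {ps. (\<forall>l<d. ps l permutes {..<n}) \<and> (\<forall>l. d \<le> l \<longrightarrow> ps l = id)}"

definition perm_sum_matrix :: "nat \<Rightarrow> (nat \<Rightarrow> nat \<Rightarrow> nat) \<Rightarrow> nat \<Rightarrow> nat \<Rightarrow> complex" where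
  "perm_sum_matrix d ps i j = of_nat (\<Sum>l<d. if ps l i = j then 1 else 0)"

definition unif_prob :: "'a set \<Rightarrow> ('a \<Rightarrow> bool) \<Rightarrow> real" where
  "unif_prob \<Omega> E = real (card {w\<in>\<Omega>. E w}) / real (card \<Omega>)"

end

theory Submission
  imports Defs "Jordan_Normal_Form.Determinant"
begin

text \<open>
  Write M for the sum of the permutation matrices minus \<zeta> I, where \<zeta> = z \<surd>d. The bound is trivial
  unless m = min d n exceeds a large multiple of ln n ^ 8, so assume this.

  A vector is called spread if, for every a, many of its coordinates are far from its a-th coordinate.
  An approximate null vector of M is not nearly constant, because all row sums of M equal d - \<zeta>.
  Suppose it has at least k coordinates far from a given one, but all except k' coordinates very close
  to it. Subtracting that value and rounding gives a vector y in a net of size exp (O(k' ln n ^ 2)), and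
  M y is close to a constant vector. For fixed y this has probability at most exp (- c min (d k) n):
  pair up the rows; exchanging the images of a pair of rows in one permutation moves one row entry, so
  every pair that is separated by some permutation costs an independent factor 1/2, and typically about
  min (d k) n pairs are separated. Hence k may be improved to k' of order min (d k) n / ln n ^ 2, and
  O(log n / log m) such steps, each costing a fixed power of n in the precision, show that approximate
  null vectors have of order n / ln n ^ 2 coordinates far from any given one. The same holds for M
  transposed, whose law is that of the inverse permutations.

  If the smallest singular value is tiny there are a right and a left approximate null vector x and u.
  For many rows i the coordinates u 0 and u i differ, and a net argument shows that for most i many
  permutations separate 0 and i with respect to x. Exchanging rows 0 and i in the individual
  permutations then leaves d independent signs, and a vector v chosen independently of the
  signs is almost orthogonal to the difference of the two rows. The Littlewood-Offord inequality bounds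
  the probability of this, and averaging over i concludes.
\<close>

section \<open>Averages over the sample space\<close>

text \<open>Exchanging rows does not see a vector shifted by a constant, so smallness and sparsity
  are always measured between coordinates and never from 0.

  In the final step both approximate null vectors depend on the signs. This is circumvented by the
  order of quantifiers: the left vector serves only to show that every v subject to conditions
  preserved by the exchanges has a small row difference, and the right vector only that such a v
  exists. Hence v can be fixed before the signs are drawn.

  The threshold ln n ^ 8 comes from the claim: below it ln n ^ 4 / sqrt m is bounded away from 0.
  Above it m absorbs the logarithms in the net sizes: ln n ^ 4 in the spreading steps, where the
  growth per step is taken as sqrt m instead of m / ln n ^ 2, and ln n ^ 6 in the separation of
  rows. The latter needs a net over all n coordinates, of log size n ln n ^ 2, against a gain of
  order d n / ln n ^ 4.

  The exponent 700 reflects at most 3 log n / log m steps, each costing n ^ 102 and entering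
  squared: 612, plus bounded polynomial losses.\<close>

definition avg :: "'a set \<Rightarrow> ('a \<Rightarrow> real) \<Rightarrow> real" where
  "avg \<Omega> f = (\<Sum>w\<in>\<Omega>. f w) / real (card \<Omega>)"

lemma avg_mono: "(\<And>w. w \<in> \<Omega> \<Longrightarrow> f w \<le> g w) \<Longrightarrow> avg \<Omega> f \<le> avg \<Omega> g"
  unfolding avg_def by (intro divide_right_mono sum_mono) auto

lemma avg_cong: "(\<And>w. w \<in> \<Omega> \<Longrightarrow> f w = g w) \<Longrightarrow> avg \<Omega> f = avg \<Omega> g"
  unfolding avg_def by simp

lemma avg_nonneg: "(\<And>w. w \<in> \<Omega> \<Longrightarrow> 0 \<le> f w) \<Longrightarrow> 0 \<le> avg \<Omega> f"
  unfolding avg_def by (intro divide_nonneg_nonneg sum_nonneg) auto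

lemma avg_cmult: "avg \<Omega> (\<lambda>w. c * f w) = c * avg \<Omega> f"
  unfolding avg_def by (simp add: sum_distrib_left)

lemma avg_multc: "avg \<Omega> (\<lambda>w. f w * c) = avg \<Omega> f * c"
  unfolding avg_def by (simp add: sum_distrib_right)

lemma avg_add: "avg \<Omega> (\<lambda>w. f w + g w) = avg \<Omega> f + avg \<Omega> g"
  unfolding avg_def by (simp add: sum.distrib add_divide_distrib)

lemma avg_sum: "avg \<Omega> (\<lambda>w. \<Sum>i\<in>I. f i w) = (\<Sum>i\<in>I. avg \<Omega> (f i))"
  unfolding avg_def by (subst sum.swap) (simp add: sum_divide_distrib)

lemma avg_const: "finite \<Omega> \<Longrightarrow> \<Omega> \<noteq> {} \<Longrightarrow> avg \<Omega> (\<lambda>w. c) = c"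
  unfolding avg_def by simp

lemma avg_reindex: "bij_betw \<phi> \<Omega> \<Omega> \<Longrightarrow> avg \<Omega> (\<lambda>w. f (\<phi> w)) = avg \<Omega> f"
  unfolding avg_def using sum.reindex_bij_betw[of \<phi> \<Omega> \<Omega> f] by simp

lemma avg_commute: "avg A (\<lambda>a. avg B (\<lambda>b. f a b)) = avg B (\<lambda>b. avg A (\<lambda>a. f a b))"
proof -
  have "(\<Sum>a\<in>A. \<Sum>b\<in>B. f a b) = (\<Sum>b\<in>B. \<Sum>a\<in>A. f a b)" by (rule sum.swap)
  then show ?thesis unfolding avg_def
    by (simp add: sum_divide_distrib[symmetric] field_simps)
qed

lemma unif_prob_eq_avg: "finite \<Omega> \<Longrightarrow> unif_prob \<Omega> E = avg \<Omega> (\<lambda>w. of_bool (E w))"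
  unfolding unif_prob_def avg_def
  by (simp add: Int_def)

lemma unif_prob_mono:
  "finite \<Omega> \<Longrightarrow> (\<And>w. w \<in> \<Omega> \<Longrightarrow> E w \<Longrightarrow> F w) \<Longrightarrow> unif_prob \<Omega> E \<le> unif_prob \<Omega> F"
  unfolding unif_prob_eq_avg by (rule avg_mono) auto

lemma unif_prob_le_1: "finite \<Omega> \<Longrightarrow> unif_prob \<Omega> E \<le> 1"
  unfolding unif_prob_def by (auto intro!: divide_le_eq_1[THEN iffD2] card_mono)

lemma unif_prob_disj:
  "finite \<Omega> \<Longrightarrow> unif_prob \<Omega> (\<lambda>w. E w \<or> F w) \<le> unif_prob \<Omega> E + unif_prob \<Omega> F"
  unfolding unif_prob_eq_avg avg_add[symmetric] by (rule avg_mono) auto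

lemma unif_prob_Bex_le:
  assumes "finite \<Omega>" "finite I"
  shows "unif_prob \<Omega> (\<lambda>w. \<exists>i\<in>I. E i w) \<le> (\<Sum>i\<in>I. unif_prob \<Omega> (E i))"
  unfolding unif_prob_eq_avg[OF assms(1)] avg_sum[symmetric]
proof (rule avg_mono)
  fix w
  show "of_bool (\<exists>i\<in>I. E i w) \<le> (\<Sum>i\<in>I. of_bool (E i w) :: real)"
  proof (cases "\<exists>i\<in>I. E i w")
    case True
    then obtain i where "i \<in> I" "E i w" by auto
    then show ?thesis
      using member_le_sum[of i I "\<lambda>i. of_bool (E i w) :: real"] assms(2) by auto
  qed (simp add: sum_nonneg)
qed

lemma unif_prob_Bex_le_card:
  assumes "finite \<Omega>" "finite I" "\<And>i. i \<in> I \<Longrightarrow> unif_prob \<Omega> (E i) \<le> q"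
  shows "unif_prob \<Omega> (\<lambda>w. \<exists>i\<in>I. E i w) \<le> real (card I) * q"
  using unif_prob_Bex_le[OF assms(1,2), of E] sum_bounded_above[of I "\<lambda>i. unif_prob \<Omega> (E i)" q]
    assms(3) by fastforce

lemma unif_prob_reindex:
  assumes "finite \<Omega>" "bij_betw \<phi> \<Omega> \<Omega>"
  shows "unif_prob \<Omega> (\<lambda>w. E (\<phi> w)) = unif_prob \<Omega> E"
  using avg_reindex[OF assms(2), of "\<lambda>w. of_bool (E w)"] assms(1)
  by (simp add: unif_prob_eq_avg)

section \<open>The sample space as a product of independent uniform permutations\<close>

lemma perm_tuples_Suc:
  "perm_tuples n (Suc d) = (\<lambda>(ps, \<pi>). ps(d := \<pi>)) ` (perm_tuples n d \<times> {\<pi>. \<pi> permutes {..<n}})"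
  (is "?L = ?R")
proof
  show "?L \<subseteq> ?R"
  proof
    fix ps assume "ps \<in> ?L"
    then have "ps(d := id) \<in> perm_tuples n d" "ps d permutes {..<n}"
      by (auto simp: perm_tuples_def)
    then have "(\<lambda>(ps, \<pi>). ps(d := \<pi>)) (ps(d := id), ps d) \<in> ?R" by blast
    then show "ps \<in> ?R" by simp
  qed
  show "?R \<subseteq> ?L" by (auto simp: perm_tuples_def less_Suc_eq)
qed

lemma inj_on_perm_tuples_Suc:
  "inj_on (\<lambda>(ps, \<pi>). ps(d := \<pi>)) (perm_tuples n d \<times> {\<pi>. \<pi> permutes {..<n}})"
proof (rule inj_onI, clarsimp)
  fix ps \<pi> ps' \<pi>'
  assume *: "ps \<in> perm_tuples n d" "ps' \<in> perm_tuples n d" "ps(d := \<pi>) = ps'(d := \<pi>')"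
  then have "ps l = ps' l" for l
    using fun_cong[OF *(3), of l] *(1,2) by (cases "l = d") (simp add: perm_tuples_def, metis fun_upd_other)
  then show "ps = ps' \<and> \<pi> = \<pi>'" using fun_cong[OF *(3), of d] by auto
qed

lemma finite_perm_tuples [simp]: "finite (perm_tuples n d)"
proof (induction d)
  case 0
  have "perm_tuples n 0 = {\<lambda>l. id}" by (auto simp: perm_tuples_def)
  then show ?case by simp
next
  case (Suc d)
  then show ?case by (simp add: perm_tuples_Suc finite_permutations)
qed

lemma perm_tuples_nonempty [simp]: "perm_tuples n d \<noteq> {}"
  by (auto simp: perm_tuples_def intro!: exI[of _ "\<lambda>l. id"] permutes_id)

lemma perm_tuplesD: "ps \<in> perm_tuples n d \<Longrightarrow> l < d \<Longrightarrow> ps l permutes {..<n}"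
  by (simp add: perm_tuples_def)

lemma avg_perm_tuples_Suc:
  "avg (perm_tuples n (Suc d)) f
   = avg (perm_tuples n d) (\<lambda>ps. avg {\<pi>. \<pi> permutes {..<n}} (\<lambda>\<pi>. f (ps(d := \<pi>))))"
proof -
  let ?S = "{\<pi>. \<pi> permutes {..<n}}"
  have "sum f (perm_tuples n (Suc d)) = (\<Sum>ps\<in>perm_tuples n d. \<Sum>\<pi>\<in>?S. f (ps(d := \<pi>)))"
    unfolding perm_tuples_Suc
    by (subst sum.reindex[OF inj_on_perm_tuples_Suc])
       (simp add: sum.cartesian_product case_prod_unfold)
  moreover have "card (perm_tuples n (Suc d)) = card (perm_tuples n d) * card ?S"
    unfolding perm_tuples_Suc
    by (subst card_image[OF inj_on_perm_tuples_Suc]) (simp add: card_cartesian_product)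
  ultimately show ?thesis
    unfolding avg_def by (simp add: sum_divide_distrib[symmetric] field_simps)
qed

lemma avg_perm_tuples_prod:
  "avg (perm_tuples n d) (\<lambda>ps. \<Prod>l<d. f l (ps l))
   = (\<Prod>l<d. avg {\<pi>. \<pi> permutes {..<n}} (f l))"
proof (induction d)
  case 0
  show ?case by (simp add: avg_const)
next
  case (Suc d)
  let ?S = "{\<pi>. \<pi> permutes {..<n}}"
  have "avg (perm_tuples n (Suc d)) (\<lambda>ps. \<Prod>l<Suc d. f l (ps l))
     = avg (perm_tuples n d) (\<lambda>ps. avg ?S (\<lambda>\<pi>. (\<Prod>l<d. f l (ps l)) * f d \<pi>))"
    by (simp add: avg_perm_tuples_Suc)
  also have "\<dots> = avg (perm_tuples n d) (\<lambda>ps. avg ?S (f d) * (\<Prod>l<d. f l (ps l)))"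
    by (rule avg_cong) (simp add: avg_cmult)
  also have "\<dots> = (\<Prod>l<Suc d. avg ?S (f l))"
    unfolding avg_cmult Suc by simp
  finally show ?case .
qed

lemma bij_betw_permutes_comp:
  assumes "\<rho> permutes U"
  shows "bij_betw (\<lambda>\<pi>. \<pi> \<circ> \<rho>) {\<pi>. \<pi> permutes U} {\<pi>. \<pi> permutes U}"
proof (rule bij_betwI[where g = "\<lambda>\<pi>. \<pi> \<circ> Hilbert_Choice.inv \<rho>"])
  show "(\<lambda>\<pi>. \<pi> \<circ> \<rho>) \<in> {\<pi>. \<pi> permutes U} \<rightarrow> {\<pi>. \<pi> permutes U}"
    using assms permutes_compose by auto
  show "(\<lambda>\<pi>. \<pi> \<circ> Hilbert_Choice.inv \<rho>) \<in> {\<pi>. \<pi> permutes U} \<rightarrow> {\<pi>. \<pi> permutes U}"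
    using permutes_inv[OF assms] permutes_compose by auto
qed (use permutes_inv_o[OF assms] in \<open>auto simp: comp_assoc\<close>)

lemma avg_permutes_inv:
  "avg {\<pi>. \<pi> permutes U} (\<lambda>\<pi>. f (Hilbert_Choice.inv \<pi>)) = avg {\<pi>. \<pi> permutes U} f"
  unfolding avg_def using sum_permutations_inverse[of f U] by simp

lemma perm_tuples_inv: "ps \<in> perm_tuples n d \<Longrightarrow> (\<lambda>l. Hilbert_Choice.inv (ps l)) \<in> perm_tuples n d"
  by (simp add: perm_tuples_def permutes_inv)

lemma perm_tuples_inv_inv:
  assumes "ps \<in> perm_tuples n d" shows "(\<lambda>l. Hilbert_Choice.inv (Hilbert_Choice.inv (ps l))) = ps"
proof
  fix l show "Hilbert_Choice.inv (Hilbert_Choice.inv (ps l)) = ps l"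
    using assms permutes_inv_inv by (cases "l < d") (auto simp: perm_tuples_def)
qed

lemma bij_betw_perm_tuples_inv:
  "bij_betw (\<lambda>ps l. Hilbert_Choice.inv (ps l)) (perm_tuples n d) (perm_tuples n d)"
  by (rule bij_betwI[where g = "\<lambda>ps l. Hilbert_Choice.inv (ps l)"])
     (simp_all add: perm_tuples_inv perm_tuples_inv_inv)

text \<open>Averaging \<pi> \<circ> (b b') over the points b' of W outside B replaces the condition on \<pi> b
  by the proportion of such b' that \<pi> maps into D \<pi>.\<close>

lemma avg_permutes_power_le:
  fixes D :: "('a \<Rightarrow> 'a) \<Rightarrow> 'a set" and q \<theta> :: real
  assumes U: "finite U" "W \<subseteq> U" "B \<subseteq> W"
    and inv: "\<And>\<pi> b b'. \<pi> permutes U \<Longrightarrow> b \<in> W \<Longrightarrow> b' \<in> W \<Longrightarrow> D (\<pi> \<circ> Transposition.transpose b b') = D \<pi>"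
    and many: "\<And>\<pi>. \<pi> permutes U \<Longrightarrow> real (card B) + \<theta> * card W \<le> card {b\<in>W. \<pi> b \<in> D \<pi>}"
    and q: "0 \<le> q" "q \<le> 1" and th: "0 \<le> \<theta>" "\<theta> \<le> 1"
  shows "avg {\<pi>. \<pi> permutes U} (\<lambda>\<pi>. q ^ card {b\<in>B. \<pi> b \<in> D \<pi>}) \<le> (1 - (1 - q) * \<theta>) ^ card B"
proof -
  let ?S = "{\<pi>. \<pi> permutes U}"
  have finS: "finite ?S" "?S \<noteq> {}"
    using U(1) by (auto simp: finite_permutations intro!: exI[of _ id] permutes_id)
  have finW: "finite W" using finite_subset[OF U(2,1)] .
  have finB: "finite B" using finite_subset[OF U(3) finW] .
  \<comment> \<open>The points of \<open>B\<close> are added one at a time; the surplus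
    \<open>card B\<close> in \<open>many\<close> pays at every stage for the points already
    used.\<close>
  have "avg ?S (\<lambda>\<pi>. q ^ card {b\<in>C. \<pi> b \<in> D \<pi>}) \<le> (1 - (1 - q) * \<theta>) ^ card C"
    if "finite C" "C \<subseteq> B" for C
    using that
  proof (induction C rule: finite_induct)
    case empty
    then show ?case using finS by (simp add: avg_const)
  next
    case (insert c C)
    define F where "F = (\<lambda>\<pi>. q ^ card {b\<in>C. \<pi> b \<in> D \<pi>})"
    define R where "R = W - C"
    have cR: "c \<in> R" using insert U R_def by auto
    have finR: "finite R" using finW R_def by simp
    have F0: "F \<pi> \<ge> 0" for \<pi> unfolding F_def using q by simp
    \<comment> \<open>Exchanging \<open>c\<close> with another point of \<open>R\<close> preserves
      the law of \<open>\<pi>\<close>, the set \<open>D \<pi>\<close> and the images of all points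
      of \<open>C\<close>, so the weight \<open>F\<close> stays the same and the points of
      \<open>R\<close> are interchangeable.\<close>
    have same: "avg ?S (\<lambda>\<pi>. F \<pi> * of_bool (\<pi> b \<in> D \<pi>)) = avg ?S (\<lambda>\<pi>. F \<pi> * of_bool (\<pi> c \<in> D \<pi>))"
      if b: "b \<in> R" for b
    proof -
      let ?t = "Transposition.transpose c b"
      have t: "?t permutes U" using b cR U R_def by (intro permutes_swap_id) auto
      have "avg ?S (\<lambda>\<pi>. F \<pi> * of_bool (\<pi> c \<in> D \<pi>))
          = avg ?S (\<lambda>\<pi>. F (\<pi> \<circ> ?t) * of_bool ((\<pi> \<circ> ?t) c \<in> D (\<pi> \<circ> ?t)))"
        using avg_reindex[OF bij_betw_permutes_comp[OF t], of "\<lambda>\<pi>. F \<pi> * of_bool (\<pi> c \<in> D \<pi>)"] by simp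
      also have "\<dots> = avg ?S (\<lambda>\<pi>. F \<pi> * of_bool (\<pi> b \<in> D \<pi>))"
      proof (rule avg_cong)
        fix \<pi> assume "\<pi> \<in> ?S"
        then have Dt: "D (\<pi> \<circ> ?t) = D \<pi>" using inv b cR R_def by auto
        have "{x\<in>C. (\<pi> \<circ> ?t) x \<in> D \<pi>} = {x\<in>C. \<pi> x \<in> D \<pi>}"
          using b cR R_def by (auto simp: Transposition.transpose_def)
        then show "F (\<pi> \<circ> ?t) * of_bool ((\<pi> \<circ> ?t) c \<in> D (\<pi> \<circ> ?t)) = F \<pi> * of_bool (\<pi> b \<in> D \<pi>)"
          unfolding F_def Dt by simp
      qed
      finally show ?thesis by simp
    qed
    have "real (card R) * avg ?S (\<lambda>\<pi>. F \<pi> * of_bool (\<pi> c \<in> D \<pi>))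
        = (\<Sum>b\<in>R. avg ?S (\<lambda>\<pi>. F \<pi> * of_bool (\<pi> b \<in> D \<pi>)))"
      using same by simp
    also have "\<dots> = avg ?S (\<lambda>\<pi>. F \<pi> * card {b\<in>R. \<pi> b \<in> D \<pi>})"
      unfolding avg_sum[symmetric] sum_distrib_left[symmetric]
      using finR by (simp add: Int_def)
    also have "\<dots> \<ge> avg ?S (\<lambda>\<pi>. F \<pi> * (\<theta> * card R))"
    proof (intro avg_mono mult_left_mono F0)
      fix \<pi> assume p: "\<pi> \<in> ?S"
      have "card {b\<in>W. \<pi> b \<in> D \<pi>} \<le> card ({b\<in>R. \<pi> b \<in> D \<pi>} \<union> C)"
        using finR insert R_def by (intro card_mono) auto
      also have "\<dots> \<le> card {b\<in>R. \<pi> b \<in> D \<pi>} + card C" by (rule card_Un_le)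
      also have "card C \<le> card B" using insert finB by (intro card_mono) auto
      finally have "card {b\<in>W. \<pi> b \<in> D \<pi>} \<le> card {b\<in>R. \<pi> b \<in> D \<pi>} + card B" by simp
      moreover have "\<theta> * card R \<le> \<theta> * card W"
        using th finW R_def by (intro mult_left_mono) (auto intro: card_mono)
      ultimately show "\<theta> * card R \<le> card {b\<in>R. \<pi> b \<in> D \<pi>}" using many[of \<pi>] p by fastforce
    qed
    finally have "real (card R) * avg ?S (\<lambda>\<pi>. F \<pi> * of_bool (\<pi> c \<in> D \<pi>)) \<ge> real (card R) * (\<theta> * avg ?S F)"
      unfolding avg_multc by (simp add: mult_ac)
    moreover have "card R > 0" using cR finR card_gt_0_iff by blast
    ultimately have hit: "avg ?S (\<lambda>\<pi>. F \<pi> * of_bool (\<pi> c \<in> D \<pi>)) \<ge> \<theta> * avg ?S F"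
      by (simp add: mult_le_cancel_left)
    \<comment> \<open>The power is affine in the indicator of a hit at \<open>c\<close>, with a
      nonpositive coefficient, which turns the lower bound \<open>hit\<close> into an upper
      bound.\<close>
    have "q ^ card {b\<in>insert c C. \<pi> b \<in> D \<pi>} = F \<pi> + (- (1 - q)) * (F \<pi> * of_bool (\<pi> c \<in> D \<pi>))" for \<pi>
    proof (cases "\<pi> c \<in> D \<pi>")
      case True
      then have "{b\<in>insert c C. \<pi> b \<in> D \<pi>} = insert c {b\<in>C. \<pi> b \<in> D \<pi>}" by auto
      then show ?thesis using True insert by (simp add: F_def algebra_simps)
    next
      case False
      then have "{b\<in>insert c C. \<pi> b \<in> D \<pi>} = {b\<in>C. \<pi> b \<in> D \<pi>}" by auto
      then show ?thesis using False by (simp add: F_def)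
    qed
    then have "avg ?S (\<lambda>\<pi>. q ^ card {b\<in>insert c C. \<pi> b \<in> D \<pi>})
      = avg ?S F + (- (1 - q)) * avg ?S (\<lambda>\<pi>. F \<pi> * of_bool (\<pi> c \<in> D \<pi>))"
      by (simp only: avg_add avg_cmult)
    also have "\<dots> \<le> avg ?S F + (- (1 - q)) * (\<theta> * avg ?S F)"
      using hit q by (intro add_left_mono mult_left_mono_neg) auto
    also have "\<dots> = (1 - (1 - q) * \<theta>) * avg ?S F" by (simp add: algebra_simps)
    also have "\<dots> \<le> (1 - (1 - q) * \<theta>) * (1 - (1 - q) * \<theta>) ^ card C"
      using insert q th mult_le_one[of "1-q" \<theta>] unfolding F_def by (intro mult_left_mono) auto
    finally show ?case using insert by simp
  qed
  then show ?thesis using finB by blast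
qed

section \<open>Small ball probabilities for sparse vectors\<close>

text \<open>Exchanging the two images within one of these pairs moves the sum in row 2p by at least
  \<open>\<rho>\<close>; this is the randomness behind the small ball bound. For odd n the last row
  stays unpaired.\<close>

definition pair_hits :: "nat \<Rightarrow> real \<Rightarrow> (nat \<Rightarrow> complex) \<Rightarrow> (nat \<Rightarrow> nat) \<Rightarrow> nat set" where
  "pair_hits n \<rho> y \<pi> = {p. p < n div 2 \<and> \<rho> \<le> cmod (y (\<pi> (2 * p)) - y (\<pi> (2 * p + 1)))}"

lemma finite_pair_hits [simp]: "finite (pair_hits n \<rho> y \<pi>)"
  unfolding pair_hits_def by simp

text \<open>The permutation is composed with an independent permutation of the odd positions, so that the
  positions of J and the values at the partner positions are handled by two separate averages.\<close>

lemma avg_pair_hits_le: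
  fixes y :: "nat \<Rightarrow> complex"
  assumes J: "J \<subseteq> {..<n}" "card J = k" "\<And>j. j \<in> J \<Longrightarrow> \<rho> \<le> cmod (y j)"
    and Z: "8 * card {j. j < n \<and> y j \<noteq> 0} \<le> n"
    and H: "H \<subseteq> {..<n div 2}" "2 * card H \<le> n div 2"
    and k: "64 * k \<le> n" "64 \<le> n"
  shows "avg {\<pi>. \<pi> permutes {..<n}} (\<lambda>\<pi>. (1/2) ^ card (pair_hits n \<rho> y \<pi> - H)) \<le> (79/80) ^ k"
proof -
  define P where "P = n div 2"
  define Od where "Od = (\<lambda>p. 2 * p + 1) ` {..<P}"
  let ?S = "{\<pi>. \<pi> permutes {..<n}}"
  let ?R = "{\<rho>. \<rho> permutes Od}"
  have finOd: "finite Od" and OdU: "Od \<subseteq> {..<n}" unfolding Od_def P_def by auto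
  have cardOd: "card Od = P" unfolding Od_def by (subst card_image) (auto simp: inj_on_def)
  have P: "2 * P \<le> n" "n \<le> 2 * P + 1" unfolding P_def by auto
  have finJ: "finite J" using J finite_subset by blast
  have finR: "finite ?R" "?R \<noteq> {}"
    using finOd by (auto simp: finite_permutations intro!: exI[of _ id] permutes_id)
  \<comment> \<open>Such a pair is separated as soon as its odd member lands on a zero of
    \<open>y\<close>.\<close>
  define E where "E = (\<lambda>\<pi>. {p. p < P \<and> p \<notin> H \<and> \<pi> (2 * p) \<in> J})"
  have perm_odd: "avg ?R (\<lambda>r. (1/2) ^ card (pair_hits n \<rho> y (\<pi> \<circ> r) - H)) \<le> (7/8) ^ card (E \<pi>)"
    if p: "\<pi> permutes {..<n}" for \<pi>
  proof -
    define B where "B = (\<lambda>p. 2 * p + 1) ` E \<pi>"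
    define D where "D = {o'. \<pi> o' < n \<and> y (\<pi> o') = 0}"
    have BOd: "B \<subseteq> Od" unfolding B_def Od_def E_def by auto
    have cardB: "card B = card (E \<pi>)" unfolding B_def by (subst card_image) (auto simp: inj_on_def)
    have "card (E \<pi>) \<le> card J"
    proof (rule card_inj_on_le[of "\<lambda>p. \<pi> (2 * p)"])
      show "inj_on (\<lambda>p. \<pi> (2 * p)) (E \<pi>)"
        using inj_eq[OF permutes_inj[OF p]] by (auto simp: inj_on_def)
    qed (use finJ E_def in auto)
    then have Bk: "card B \<le> k" using J cardB by simp
    \<comment> \<open>At most n/8 odd positions carry a nonzero value, so about 3n/8 carry a zero;
      this covers the reserve k \<le> n/64 and a quarter of the n/2 odd positions.\<close>
    have many: "real (card B) + (1/4) * card Od \<le> card {b\<in>Od. r b \<in> D}" if r: "r permutes Od" for r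
    proof -
      have "card {b\<in>Od. r b \<notin> D} \<le> card {j. j < n \<and> y j \<noteq> 0}"
      proof (rule card_inj_on_le[of "\<lambda>b. \<pi> (r b)"])
        show "inj_on (\<lambda>b. \<pi> (r b)) {b\<in>Od. r b \<notin> D}"
          using inj_eq[OF permutes_inj[OF p]] inj_eq[OF permutes_inj[OF r]] by (simp add: inj_on_def)
        have "\<pi> (r b) < n" if "b \<in> Od" for b
          using that OdU permutes_in_image[OF p, of "r b"] permutes_in_image[OF r, of b] by auto
        then show "(\<lambda>b. \<pi> (r b)) ` {b\<in>Od. r b \<notin> D} \<subseteq> {j. j < n \<and> y j \<noteq> 0}"
          unfolding D_def by auto
      qed simp
      moreover have "card Od = card {b\<in>Od. r b \<in> D} + card {b\<in>Od. r b \<notin> D}"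
        using finOd by (subst card_Un_disjoint[symmetric]) (auto intro!: arg_cong[of _ _ card])
      ultimately have "8 * P \<le> 8 * card {b\<in>Od. r b \<in> D} + n" using Z cardOd by linarith
      then show ?thesis using Bk k P cardOd by simp
    qed
    have "avg ?R (\<lambda>r. (1/2) ^ card (pair_hits n \<rho> y (\<pi> \<circ> r) - H)) \<le> avg ?R (\<lambda>r. (1/2) ^ card {b\<in>B. r b \<in> D})"
    proof (rule avg_mono)
      fix r assume "r \<in> ?R"
      then have r: "r permutes Od" by simp
      have "card {b\<in>B. r b \<in> D} \<le> card (pair_hits n \<rho> y (\<pi> \<circ> r) - H)"
      proof (rule card_inj_on_le[of "\<lambda>b. b div 2"])
        show "inj_on (\<lambda>b. b div 2) {b\<in>B. r b \<in> D}" unfolding B_def inj_on_def by auto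
        show "(\<lambda>b. b div 2) ` {b\<in>B. r b \<in> D} \<subseteq> pair_hits n \<rho> y (\<pi> \<circ> r) - H"
        proof clarsimp
          fix b assume "b \<in> B" and rb: "r b \<in> D"
          then obtain p where p: "p \<in> E \<pi>" "b = 2 * p + 1" unfolding B_def by auto
          have "2 * p \<notin> Od" unfolding Od_def by (auto; presburger)
          then have "r (2 * p) = 2 * p" using r permutes_not_in by metis
          then have "p \<in> pair_hits n \<rho> y (\<pi> \<circ> r)"
            using p rb J(3) unfolding pair_hits_def E_def D_def P_def by simp
          then show "b div 2 \<in> pair_hits n \<rho> y (\<pi> \<circ> r) \<and> b div 2 \<notin> H"
            using p unfolding E_def by simp
        qed
      qed simp
      then show "(1/2 :: real) ^ card (pair_hits n \<rho> y (\<pi> \<circ> r) - H) \<le> (1/2) ^ card {b\<in>B. r b \<in> D}"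
        by (intro power_decreasing) auto
    qed
    also have "\<dots> \<le> (1 - (1 - 1/2) * (1/4)) ^ card B"
      by (rule avg_permutes_power_le[where W = Od]) (use finOd BOd many in auto)
    finally show ?thesis using cardB by simp
  qed
  have "avg ?S (\<lambda>\<pi>. (1/2) ^ card (pair_hits n \<rho> y \<pi> - H))
      = avg ?R (\<lambda>r. avg ?S (\<lambda>\<pi>. (1/2) ^ card (pair_hits n \<rho> y (\<pi> \<circ> r) - H)))"
  proof -
    have "avg ?S (\<lambda>\<pi>. (1/2) ^ card (pair_hits n \<rho> y (\<pi> \<circ> r) - H))
        = avg ?S (\<lambda>\<pi>. (1/2) ^ card (pair_hits n \<rho> y \<pi> - H))" if "r \<in> ?R" for r
      using that permutes_subset[OF _ OdU, of r]
      by (intro avg_reindex bij_betw_permutes_comp) auto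
    then have "avg ?R (\<lambda>r. avg ?S (\<lambda>\<pi>. (1/2) ^ card (pair_hits n \<rho> y (\<pi> \<circ> r) - H)))
        = avg ?R (\<lambda>r. avg ?S (\<lambda>\<pi>. (1/2) ^ card (pair_hits n \<rho> y \<pi> - H)))"
      by (rule avg_cong)
    then show ?thesis using avg_const[OF finR] by simp
  qed
  also have "\<dots> = avg ?S (\<lambda>\<pi>. avg ?R (\<lambda>r. (1/2) ^ card (pair_hits n \<rho> y (\<pi> \<circ> r) - H)))"
    by (rule avg_commute)
  also have "\<dots> \<le> avg ?S (\<lambda>\<pi>. (7/8) ^ card (E \<pi>))"
    using perm_odd by (intro avg_mono) auto
  \<comment> \<open>Inversion turns a count of positions whose image lies in \<open>J\<close> into a
    count over the fixed set \<open>J\<close>, the form that \<open>avg_permutes_power_le\<close>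
    handles.\<close>
  also have "\<dots> = avg ?S (\<lambda>\<pi>. (7/8) ^ card (E (Hilbert_Choice.inv \<pi>)))"
    by (rule avg_permutes_inv[symmetric])
  also have "\<dots> = avg ?S (\<lambda>\<pi>. (7/8) ^ card {j\<in>J. \<pi> j \<in> (\<lambda>p. 2 * p) ` ({..<P} - H)})"
  proof (rule avg_cong)
    fix \<pi> assume "\<pi> \<in> ?S"
    then have p: "\<pi> permutes {..<n}" by simp
    have "bij_betw (\<lambda>p. Hilbert_Choice.inv \<pi> (2 * p)) (E (Hilbert_Choice.inv \<pi>)) {j\<in>J. \<pi> j \<in> (\<lambda>p. 2 * p) ` ({..<P} - H)}"
    proof (rule bij_betw_imageI)
      show "inj_on (\<lambda>p. Hilbert_Choice.inv \<pi> (2 * p)) (E (Hilbert_Choice.inv \<pi>))"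
        using inj_eq[OF permutes_inj[OF permutes_inv[OF p]]] by (simp add: inj_on_def)
      have [simp]: "\<pi> (Hilbert_Choice.inv \<pi> x) = x" "Hilbert_Choice.inv \<pi> (\<pi> x) = x" for x
        using permutes_inverses[OF p] by auto
      show "(\<lambda>p. Hilbert_Choice.inv \<pi> (2 * p)) ` E (Hilbert_Choice.inv \<pi>) = {j\<in>J. \<pi> j \<in> (\<lambda>p. 2 * p) ` ({..<P} - H)}"
      proof (intro equalityI subsetI)
        fix j assume "j \<in> {j\<in>J. \<pi> j \<in> (\<lambda>p. 2 * p) ` ({..<P} - H)}"
        then obtain p where p: "p \<in> {..<P} - H" "\<pi> j = 2 * p" "j \<in> J" by auto
        then have "j = Hilbert_Choice.inv \<pi> (2 * p)" by (metis \<open>Hilbert_Choice.inv \<pi> (\<pi> j) = j\<close>)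
        then show "j \<in> (\<lambda>p. Hilbert_Choice.inv \<pi> (2 * p)) ` E (Hilbert_Choice.inv \<pi>)" using p unfolding E_def by auto
      qed (auto simp: E_def)
    qed
    then have "card (E (Hilbert_Choice.inv \<pi>)) = card {j\<in>J. \<pi> j \<in> (\<lambda>p. 2 * p) ` ({..<P} - H)}"
      by (rule bij_betw_same_card)
    then show "(7/8::real) ^ card (E (Hilbert_Choice.inv \<pi>)) = (7/8) ^ card {j\<in>J. \<pi> j \<in> (\<lambda>p. 2 * p) ` ({..<P} - H)}"
      by simp
  qed
  \<comment> \<open>At least half of the pairs avoid \<open>H\<close>, leaving about n/4 even
    targets, enough for k plus n/10. The result is 1 - (1/8)(1/10) = 79/80 per point of
    \<open>J\<close>.\<close>
  also have "\<dots> \<le> (1 - (1 - 7/8) * (1/10)) ^ card J"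
  proof (rule avg_permutes_power_le[where W = "{..<n}"])
    fix \<pi> assume p: "\<pi> permutes {..<n}"
    have "bij_betw \<pi> {b\<in>{..<n}. \<pi> b \<in> (\<lambda>p. 2 * p) ` ({..<P} - H)} ((\<lambda>p. 2 * p) ` ({..<P} - H))"
    proof (rule bij_betw_imageI)
      show "inj_on \<pi> {b\<in>{..<n}. \<pi> b \<in> (\<lambda>p. 2 * p) ` ({..<P} - H)}"
        using permutes_inj[OF p] inj_on_subset by blast
      have sub: "(\<lambda>p. 2 * p) ` ({..<P} - H) \<subseteq> \<pi> ` {..<n}"
        using permutes_image[OF p] P by auto
      have im: "\<pi> ` {b\<in>{..<n}. \<pi> b \<in> E'} = E'" if "E' \<subseteq> \<pi> ` {..<n}" for E'
        using that by blast
      show "\<pi> ` {b\<in>{..<n}. \<pi> b \<in> (\<lambda>p. 2 * p) ` ({..<P} - H)} = (\<lambda>p. 2 * p) ` ({..<P} - H)"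
        by (rule im[OF sub])
    qed
    then have "card {b\<in>{..<n}. \<pi> b \<in> (\<lambda>p. 2 * p) ` ({..<P} - H)} = card ((\<lambda>p. 2 * p) ` ({..<P} - H))"
      by (rule bij_betw_same_card)
    also have "\<dots> = card ({..<P} - H)" by (subst card_image) (auto simp: inj_on_def)
    also have "\<dots> = P - card H" using H P_def by (subst card_Diff_subset) (auto intro: finite_subset)
    finally show "real (card J) + (1/10) * card {..<n} \<le> card {b\<in>{..<n}. \<pi> b \<in> (\<lambda>p. 2 * p) ` ({..<P} - H)}"
      using J(2) k P H(2) P_def by simp
  qed (use J in auto)
  finally show ?thesis using J by simp
qed

text \<open>While at most half of the pairs are separated, one more permutation gains the factor
  (79/80)^k, with the separated pairs as \<open>H\<close>; afterwards the weight is already below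
  (1/2)^(n div 4). The coefficient 80 is the fixed point of this recursion: 79/80 * 80 + 1 =
  80.\<close>

lemma avg_Union_pair_hits_le:
  fixes y :: "nat \<Rightarrow> complex"
  assumes J: "J \<subseteq> {..<n}" "card J = k" "\<And>j. j \<in> J \<Longrightarrow> \<rho> \<le> cmod (y j)"
    and Z: "8 * card {j. j < n \<and> y j \<noteq> 0} \<le> n"
    and k: "1 \<le> k" "64 * k \<le> n"
  shows "avg (perm_tuples n d) (\<lambda>ps. (1/2) ^ card (\<Union>l<d. pair_hits n \<rho> y (ps l)))
         \<le> (79/80) ^ (k * d) + 80 * (1/2) ^ (n div 4)"
proof (induction d)
  case 0
  show ?case by (simp add: avg_const)
next
  case (Suc d)
  let ?S = "{\<pi>. \<pi> permutes {..<n}}"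
  define U where "U = (\<lambda>ps. \<Union>l<d. pair_hits n \<rho> y (ps l))"
  have finU: "finite (U ps)" for ps unfolding U_def by auto
  have finS: "finite ?S" "?S \<noteq> {}"
    by (auto simp: finite_permutations intro!: exI[of _ id] permutes_id)
  define b where "b = (1/2 :: real) ^ (n div 4)"
  define a where "a = (79/80 :: real) ^ k"
  have b0: "0 \<le> b" "0 \<le> a" unfolding a_def b_def by auto
  have a1: "a \<le> 79/80" unfolding a_def using k power_decreasing[of 1 k "79/80::real"] by simp
  have step: "avg ?S (\<lambda>\<pi>. (1/2) ^ card (U ps \<union> pair_hits n \<rho> y \<pi>)) \<le> a * (1/2) ^ card (U ps) + b" for ps
  proof (cases "2 * card (U ps) \<le> n div 2")
    case True
    have "avg ?S (\<lambda>\<pi>. (1/2) ^ card (U ps \<union> pair_hits n \<rho> y \<pi>))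
        = avg ?S (\<lambda>\<pi>. (1/2) ^ card (U ps) * (1/2) ^ card (pair_hits n \<rho> y \<pi> - U ps))"
      using finU by (simp add: power_add[symmetric] card_Un_disjoint[symmetric] Un_Diff_cancel)
    also have "\<dots> = (1/2) ^ card (U ps) * avg ?S (\<lambda>\<pi>. (1/2) ^ card (pair_hits n \<rho> y \<pi> - U ps))"
      by (rule avg_cmult)
    also have "\<dots> \<le> (1/2) ^ card (U ps) * a"
      unfolding a_def using True k
      by (intro mult_left_mono avg_pair_hits_le[OF J Z]) (auto simp: U_def pair_hits_def)
    finally show ?thesis using b0 by (simp add: mult.commute)
  next
    case False
    have "avg ?S (\<lambda>\<pi>. (1/2) ^ card (U ps \<union> pair_hits n \<rho> y \<pi>)) \<le> avg ?S (\<lambda>\<pi>. b)"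
    proof (rule avg_mono)
      fix \<pi>
      have "card (U ps) \<le> card (U ps \<union> pair_hits n \<rho> y \<pi>)" using finU by (intro card_mono) auto
      then have "n div 4 \<le> card (U ps \<union> pair_hits n \<rho> y \<pi>)" using False by linarith
      then show "(1/2) ^ card (U ps \<union> pair_hits n \<rho> y \<pi>) \<le> b"
        unfolding b_def by (intro power_decreasing) auto
    qed
    also have "\<dots> = b" using finS by (rule avg_const)
    finally show ?thesis using b0 by (simp add: add_increasing)
  qed
  have "avg (perm_tuples n (Suc d)) (\<lambda>ps. (1/2) ^ card (\<Union>l<Suc d. pair_hits n \<rho> y (ps l)))
      = avg (perm_tuples n d) (\<lambda>ps. avg ?S (\<lambda>\<pi>. (1/2) ^ card (U ps \<union> pair_hits n \<rho> y \<pi>)))"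
    unfolding avg_perm_tuples_Suc U_def by (simp add: lessThan_Suc Un_commute)
  also have "\<dots> \<le> avg (perm_tuples n d) (\<lambda>ps. a * (1/2) ^ card (U ps) + b)"
    using step by (intro avg_mono) auto
  also have "\<dots> = a * avg (perm_tuples n d) (\<lambda>ps. (1/2) ^ card (U ps)) + b"
    by (simp add: avg_add avg_cmult avg_const)
  also have "\<dots> \<le> a * ((79/80) ^ (k * d) + 80 * b) + b"
    using Suc b0 unfolding U_def b_def by (intro add_right_mono mult_left_mono) auto
  also have "\<dots> \<le> (79/80) ^ (k * Suc d) + 80 * b"
  proof -
    have "a * (79/80) ^ (k * d) = (79/80) ^ (k * Suc d)" by (simp add: a_def power_add)
    moreover have "a * (80 * b) \<le> 79/80 * (80 * b)" using a1 b0 by (intro mult_right_mono) auto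
    ultimately show ?thesis by (simp add: distrib_left)
  qed
  finally show ?case unfolding b_def .
qed

text \<open>The exchange is thus invisible to the choice of the first separating permutation, so
  performing it twice restores the tuple.\<close>

lemma pair_hits_comp_transpose:
  "pair_hits n \<rho> y (\<pi> \<circ> Transposition.transpose (2 * q) (2 * q + 1)) = pair_hits n \<rho> y \<pi>"
proof -
  have "cmod (y (\<pi> (Transposition.transpose (2 * q) (2 * q + 1) (2 * p)))
          - y (\<pi> (Transposition.transpose (2 * q) (2 * q + 1) (2 * p + 1))))
      = cmod (y (\<pi> (2 * p)) - y (\<pi> (2 * p + 1)))" for p
  proof (cases "p = q")
    case True
    then show ?thesis by (simp add: norm_minus_commute)
  next
    case False
    then have "2 * p \<noteq> 2 * q + 1" "2 * p + 1 \<noteq> 2 * q" by presburger+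
    then show ?thesis using False by (simp add: Transposition.transpose_def)
  qed
  then show ?thesis unfolding pair_hits_def by simp
qed

text \<open>Exchanging the values at 2q and 2q+1 in the first permutation that separates the pair q is an
  involution of the sample space which changes row 2q by at least \<rho> and leaves all other even rows
  unchanged, so each separated pair costs a factor 1/2.\<close>

lemma unif_prob_rows_le_avg_pair_hits:
  fixes y v :: "nat \<Rightarrow> complex"
  shows "unif_prob (perm_tuples n d) (\<lambda>ps. \<forall>i<n. cmod ((\<Sum>l<d. y (ps l i)) - v i) < \<rho> / 2)
    \<le> avg (perm_tuples n d) (\<lambda>ps. (1/2) ^ card (\<Union>l<d. pair_hits n \<rho> y (ps l)))"
proof -
  define P where "P = n div 2"
  define \<Omega> where "\<Omega> = perm_tuples n d"
  define hit where "hit = (\<lambda>ps p. \<exists>l<d. p \<in> pair_hits n \<rho> y (ps l))"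
  define ok where "ok = (\<lambda>ps p. cmod ((\<Sum>l<d. y (ps l (2 * p))) - v (2 * p)) < \<rho> / 2)"
  \<comment> \<open>Interpolates between the indicator that all even rows are good (q = 0) and the
    weight of the separated pairs (q = P), trading one row condition at a time.\<close>
  define F where "F = (\<lambda>q ps. (\<Prod>p<q. if hit ps p then 1/2 else 1 :: real) * (\<Prod>p=q..<P. of_bool (ok ps p)))"
  have step: "avg \<Omega> (F q) \<le> avg \<Omega> (F (Suc q))" if q: "q < P" for q
  proof -
    define \<tau> where "\<tau> = Transposition.transpose (2 * q) (2 * q + 1)"
    have \<tau>: "\<tau> permutes {..<n}" unfolding \<tau>_def using q P_def by (intro permutes_swap_id) auto
    have \<tau>\<tau>: "\<pi> \<circ> \<tau> \<circ> \<tau> = \<pi>" for \<pi> :: "nat \<Rightarrow> nat" unfolding \<tau>_def by (simp add: comp_assoc)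
    define f where "f = (\<lambda>ps. LEAST l. l < d \<and> q \<in> pair_hits n \<rho> y (ps l))"
    define \<Phi> where "\<Phi> = (\<lambda>ps. if hit ps q then ps(f ps := ps (f ps) \<circ> \<tau>) else ps)"
    have f: "f ps < d" "q \<in> pair_hits n \<rho> y (ps (f ps))" if "hit ps q" for ps
      using that LeastI_ex[of "\<lambda>l. l < d \<and> q \<in> pair_hits n \<rho> y (ps l)"] unfolding f_def hit_def by auto
    have hits: "pair_hits n \<rho> y (\<Phi> ps l) = pair_hits n \<rho> y (ps l)" for ps l
      unfolding \<Phi>_def \<tau>_def using pair_hits_comp_transpose by auto
    have hit\<Phi>: "hit (\<Phi> ps) = hit ps" for ps unfolding hit_def hits ..
    have f\<Phi>: "f (\<Phi> ps) = f ps" for ps unfolding f_def hits ..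
    have in\<Omega>: "\<Phi> ps \<in> \<Omega>" if "ps \<in> \<Omega>" for ps
      using that f[of ps] \<tau> unfolding \<Phi>_def \<Omega>_def perm_tuples_def by (auto intro: permutes_compose)
    have \<Phi>_hit: "\<Phi> ps = ps(f ps := ps (f ps) \<circ> \<tau>)" if "hit ps q" for ps
      using that by (simp add: \<Phi>_def)
    have \<Phi>\<Phi>: "\<Phi> (\<Phi> ps) = ps" for ps
    proof (cases "hit ps q")
      case True
      then have "\<Phi> (\<Phi> ps) = (\<Phi> ps)(f ps := \<Phi> ps (f ps) \<circ> \<tau>)" 
        using \<Phi>_hit[of "\<Phi> ps"] hit\<Phi> f\<Phi> by simp
      also have "\<dots> = ps" using True \<tau>\<tau> by (simp add: \<Phi>_def)
      finally show ?thesis .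
    qed (simp add: \<Phi>_def)
    have bij: "bij_betw \<Phi> \<Omega> \<Omega>" by (rule bij_betwI[where g = \<Phi>]) (auto simp: in\<Omega> \<Phi>\<Phi>)
    have ok_other: "ok (\<Phi> ps) p = ok ps p" if "p \<noteq> q" for ps p
    proof -
      have "\<tau> (2 * p) = 2 * p"
        unfolding \<tau>_def using that by (intro transpose_apply_other) presburger+
      then have "\<Phi> ps l (2 * p) = ps l (2 * p)" for l unfolding \<Phi>_def by auto
      then show ?thesis unfolding ok_def by simp
    qed
    \<comment> \<open>The two values of row 2q are at least \<open>\<rho>\<close> apart and cannot
      both lie within \<open>\<rho> / 2\<close> of the same target.\<close>
    have one: "\<not> (ok ps q \<and> ok (\<Phi> ps) q)" if h: "hit ps q" for ps
    proof
      assume oks: "ok ps q \<and> ok (\<Phi> ps) q"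
      let ?a = "\<Sum>l<d. y (ps l (2 * q))" and ?b = "\<Sum>l<d. y (\<Phi> ps l (2 * q))"
      have "?a - ?b = (\<Sum>l<d. y (ps l (2 * q)) - y (\<Phi> ps l (2 * q)))" by (simp add: sum_subtractf)
      also have "\<dots> = (\<Sum>l\<in>{f ps}. y (ps l (2 * q)) - y (\<Phi> ps l (2 * q)))"
        using f[OF h] h by (intro sum.mono_neutral_right) (auto simp: \<Phi>_def)
      also have "\<dots> = y (ps (f ps) (2 * q)) - y (ps (f ps) (2 * q + 1))"
        using h by (simp add: \<Phi>_def \<tau>_def)
      finally have "\<rho> \<le> cmod (?a - ?b)" using f(2)[OF h] unfolding pair_hits_def by simp
      also have "\<dots> = cmod ((?a - v (2 * q)) - (?b - v (2 * q)))" by simp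
      also have "\<dots> \<le> cmod (?a - v (2 * q)) + cmod (?b - v (2 * q))" by (rule norm_triangle_ineq4)
      also have "\<dots> < \<rho>" using oks unfolding ok_def by simp
      finally show False by simp
    qed
    define G where "G = (\<lambda>ps. (\<Prod>p<q. if hit ps p then 1/2 else 1 :: real) * (\<Prod>p=Suc q..<P. of_bool (ok ps p)))"
    have G0: "G ps \<ge> 0" for ps unfolding G_def by (auto intro!: mult_nonneg_nonneg prod_nonneg)
    have Fq: "F q ps = G ps * of_bool (ok ps q)" for ps
      unfolding F_def G_def using q by (simp add: prod.atLeast_Suc_lessThan mult_ac)
    have FSq: "F (Suc q) ps = G ps * (if hit ps q then 1/2 else 1)" for ps
      unfolding F_def G_def by (simp add: mult_ac)
    have G\<Phi>: "G (\<Phi> ps) = G ps" for ps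
      unfolding G_def hit\<Phi> by (intro arg_cong2[where f = "(*)"] refl prod.cong) (auto simp: ok_other)
    have "2 * avg \<Omega> (F q) = avg \<Omega> (F q) + avg \<Omega> (\<lambda>ps. F q (\<Phi> ps))"
      using avg_reindex[OF bij, of "F q"] by simp
    also have "\<dots> = avg \<Omega> (\<lambda>ps. G ps * (of_bool (ok ps q) + of_bool (ok (\<Phi> ps) q)))"
      unfolding avg_add[symmetric] Fq G\<Phi> by (simp add: distrib_left)
    also have "\<dots> \<le> avg \<Omega> (\<lambda>ps. 2 * F (Suc q) ps)"
    proof (rule avg_mono)
      fix ps
      have "(of_bool (ok ps q) + of_bool (ok (\<Phi> ps) q) :: real) \<le> 2 * (if hit ps q then 1/2 else 1)"
        using one[of ps] by auto
      then show "G ps * (of_bool (ok ps q) + of_bool (ok (\<Phi> ps) q)) \<le> 2 * F (Suc q) ps"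
        unfolding FSq using G0[of ps] mult_left_mono by fastforce
    qed
    finally show ?thesis by (simp add: avg_cmult)
  qed
  have chain: "avg \<Omega> (F 0) \<le> avg \<Omega> (F q)" if "q \<le> P" for q
    using that
  proof (induction q)
    case (Suc q)
    then show ?case using step[of q] by simp
  qed simp
  have "unif_prob \<Omega> (\<lambda>ps. \<forall>i<n. cmod ((\<Sum>l<d. y (ps l i)) - v i) < \<rho> / 2) \<le> avg \<Omega> (F 0)"
    unfolding \<Omega>_def unif_prob_eq_avg[OF finite_perm_tuples]
  proof (rule avg_mono)
    fix ps
    have "ok ps p" if "\<forall>i<n. cmod ((\<Sum>l<d. y (ps l i)) - v i) < \<rho> / 2" "p < P" for p
      using that unfolding ok_def P_def by auto
    then show "of_bool (\<forall>i<n. cmod ((\<Sum>l<d. y (ps l i)) - v i) < \<rho> / 2) \<le> F 0 ps"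
      unfolding F_def by (cases "\<forall>i<n. cmod ((\<Sum>l<d. y (ps l i)) - v i) < \<rho> / 2") (simp_all add: prod_nonneg)
  qed
  also have "\<dots> \<le> avg \<Omega> (F P)" using chain by simp
  also have "F P = (\<lambda>ps. (1/2) ^ card (\<Union>l<d. pair_hits n \<rho> y (ps l)))"
  proof
    fix ps
    have "(\<Union>l<d. pair_hits n \<rho> y (ps l)) = {p\<in>{..<P}. hit ps p}"
      unfolding hit_def pair_hits_def P_def by auto
    moreover have "(\<Prod>p<P. if hit ps p then 1/2 else 1 :: real) = (1/2) ^ card {p\<in>{..<P}. hit ps p}"
      by (simp add: prod.If_cases Int_def)
    ultimately show "F P ps = (1/2) ^ card (\<Union>l<d. pair_hits n \<rho> y (ps l))"
      unfolding F_def by simp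
  qed
  finally show ?thesis unfolding \<Omega>_def .
qed

text \<open>161 = 1 + 80 * 2, where the factor 2 absorbs the rounding in
  \<open>n div 4\<close>.\<close>

lemma unif_prob_rows_le:
  fixes y v :: "nat \<Rightarrow> complex"
  assumes J: "k \<le> card {j. j < n \<and> \<rho> \<le> cmod (y j)}"
    and Z: "8 * card {j. j < n \<and> y j \<noteq> 0} \<le> n"
    and k: "1 \<le> k" "64 * k \<le> n"
  shows "unif_prob (perm_tuples n d) (\<lambda>ps. \<forall>i<n. cmod ((\<Sum>l<d. y (ps l i)) - v i) < \<rho> / 2)
    \<le> 161 * exp (- min (real d * real k) (real n) / 80)"
proof -
  obtain J where J: "J \<subseteq> {j. j < n \<and> \<rho> \<le> cmod (y j)}" "card J = k"
    using obtain_subset_with_card_n[OF J] by blast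
  let ?m = "min (real d * real k) (real n)"
  have "unif_prob (perm_tuples n d) (\<lambda>ps. \<forall>i<n. cmod ((\<Sum>l<d. y (ps l i)) - v i) < \<rho> / 2)
      \<le> (79/80) ^ (k * d) + 80 * (1/2) ^ (n div 4)"
    using order_trans[OF unif_prob_rows_le_avg_pair_hits avg_Union_pair_hits_le[OF _ J(2) _ Z k]] J(1)
    by blast
  also have "(79/80 :: real) ^ (k * d) \<le> exp (- ?m / 80)"
  proof -
    have "(79/80 :: real) ^ (k * d) \<le> exp (-1/80) ^ (k * d)"
      using exp_ge_add_one_self[of "-1/80::real"] by (intro power_mono) auto
    also have "\<dots> = exp (- (real d * real k) / 80)" by (simp add: exp_of_nat_mult[symmetric] mult_ac)
    also have "\<dots> \<le> exp (- ?m / 80)" by simp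
    finally show ?thesis .
  qed
  also have "(1/2 :: real) ^ (n div 4) \<le> 2 * exp (- ?m / 80)"
  proof -
    have "exp (1/2 :: real) \<le> 2"
    proof -
      have "exp (1/2 :: real) ^ 2 = exp 1" by (simp add: exp_of_nat_mult[symmetric])
      also have "\<dots> \<le> 2 ^ 2" using exp_le by simp
      finally show ?thesis by (rule power2_le_imp_le) simp
    qed
    then have half: "(1/2 :: real) \<le> exp (- (1/2))"
      by (simp add: exp_minus field_simps)
    then have "(1/2 :: real) ^ (n div 4) \<le> exp (- (1/2)) ^ (n div 4)" by (intro power_mono) auto
    also have "\<dots> = exp (- (real (n div 4) / 2))" by (simp add: exp_of_nat_mult[symmetric])
    also have "\<dots> \<le> exp (1/2 + - ?m / 80)"
    proof -
      have "real n \<le> 4 * real (n div 4) + 3" by linarith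
      then show ?thesis by (simp add: min_def)
    qed
    also have "\<dots> = exp (1/2) * exp (- ?m / 80)" by (rule exp_add)
    also have "\<dots> \<le> 2 * exp (- ?m / 80)" using \<open>exp (1/2 :: real) \<le> 2\<close> by simp
    finally show ?thesis .
  qed
  finally show ?thesis by simp
qed

section \<open>Spreading of approximate null vectors\<close>

definition perm_op :: "nat \<Rightarrow> complex \<Rightarrow> (nat \<Rightarrow> nat \<Rightarrow> nat) \<Rightarrow> (nat \<Rightarrow> complex) \<Rightarrow> nat \<Rightarrow> complex" where
  "perm_op d \<zeta> ps x i = (\<Sum>l<d. x (ps l i)) - \<zeta> * x i"

text \<open>Every reference coordinate is allowed because the later comparisons are with row 0 and
  with the random image of 0, neither of which can be chosen favourably.\<close>

definition spread :: "nat \<Rightarrow> real \<Rightarrow> real \<Rightarrow> (nat \<Rightarrow> complex) \<Rightarrow> bool" where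
  "spread n \<eta> k x \<longleftrightarrow> (\<forall>a<n. k \<le> real (card {b. b < n \<and> \<eta> < cmod (x b - x a)}))"

text \<open>A square grid of mesh \<open>\<eta>\<close>. Radius 2 suffices for differences of
  coordinates of modulus at most 1 and for the normalised constant \<open>w\<close> in the next
  lemma.\<close>

lemma ex_complex_net:
  assumes \<eta>: "0 < \<eta>" "\<eta> \<le> 1"
  obtains G where "finite G" "real (card G) \<le> (7 / \<eta>)\<^sup>2"
    "\<And>w. cmod w \<le> 2 \<Longrightarrow> \<exists>g\<in>G. cmod (w - g) \<le> 2 * \<eta>"
proof
  define M where "M = \<lceil>2 / \<eta>\<rceil>"
  define G where "G = (\<lambda>(a, b). Complex (\<eta> * of_int a) (\<eta> * of_int b)) ` ({-M..M} \<times> {-M..M})"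
  show "finite G" unfolding G_def by simp
  have M0: "M \<ge> 0" unfolding M_def using ceiling_mono[of 0 "2 / \<eta>"] \<eta> by simp
  have "card G \<le> card ({-M..M} \<times> {-M..M})" unfolding G_def by (intro card_image_le) simp
  also have "\<dots> = nat (2 * M + 1) * nat (2 * M + 1)" by (simp add: card_cartesian_product)
  finally have "real (card G) \<le> real (nat (2 * M + 1) * nat (2 * M + 1))" by (rule of_nat_mono)
  also have "\<dots> = (2 * of_int M + 1) ^ 2" using M0 by (simp add: power2_eq_square)
  also have "\<dots> \<le> (7 / \<eta>)\<^sup>2"
  proof (rule power_mono)
    have "of_int M \<le> 2 / \<eta> + 1" unfolding M_def by linarith
    moreover have "3 \<le> 3 / \<eta>" using \<eta> by (simp add: field_simps)
    moreover have "7 / \<eta> = 2 * (2 / \<eta>) + 3 / \<eta>" by (simp add: field_simps)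
    ultimately show "2 * of_int M + 1 \<le> 7 / \<eta>" by linarith
  qed (use M0 in auto)
  finally show "real (card G) \<le> (7 / \<eta>)\<^sup>2" .
  fix w assume w: "cmod w \<le> 2"
  have fl: "\<lfloor>t / \<eta>\<rfloor> \<in> {-M..M}" "\<bar>t - \<eta> * of_int \<lfloor>t / \<eta>\<rfloor>\<bar> \<le> \<eta>" if "\<bar>t\<bar> \<le> 2" for t
  proof -
    have t: "t / \<eta> \<le> 2 / \<eta>" "- (2 / \<eta>) \<le> t / \<eta>"
      using that \<eta> by (auto simp: divide_right_mono abs_le_iff minus_divide_left simp del: minus_divide_left[symmetric])
    then show "\<lfloor>t / \<eta>\<rfloor> \<in> {-M..M}" unfolding M_def by (auto simp: le_floor_iff floor_le_iff) linarith+
    have "\<eta> * of_int \<lfloor>t / \<eta>\<rfloor> \<le> t" using \<eta> by (metis mult.commute of_int_floor_le pos_le_divide_eq)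
    moreover have "t / \<eta> \<le> of_int \<lfloor>t / \<eta>\<rfloor> + 1" by linarith
    then have "t \<le> \<eta> * of_int \<lfloor>t / \<eta>\<rfloor> + \<eta>" using \<eta> by (simp add: field_simps)
    ultimately show "\<bar>t - \<eta> * of_int \<lfloor>t / \<eta>\<rfloor>\<bar> \<le> \<eta>" by simp
  qed
  define g where "g = Complex (\<eta> * of_int \<lfloor>Re w / \<eta>\<rfloor>) (\<eta> * of_int \<lfloor>Im w / \<eta>\<rfloor>)"
  have R: "\<bar>Re w\<bar> \<le> 2" "\<bar>Im w\<bar> \<le> 2" using w abs_Re_le_cmod[of w] abs_Im_le_cmod[of w] by auto
  have "g \<in> G" unfolding G_def g_def using fl(1)[OF R(1)] fl(1)[OF R(2)] by force
  moreover have "cmod (w - g) \<le> 2 * \<eta>"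
    using cmod_le[of "w - g"] fl(2)[OF R(1)] fl(2)[OF R(2)] unfolding g_def by simp
  ultimately show "\<exists>g\<in>G. cmod (w - g) \<le> 2 * \<eta>" by blast
qed

text \<open>The exponent k' + 1 counts k' pairs of a position and a rounded value, and one more net
  point for the constant vector. Rounding costs at most 2 \<open>\<eta>'\<close> for each of the d
  row entries, for the term with \<open>\<zeta>\<close> weighted by at most d, and for the constant
  weighted by d: 6 d \<open>\<eta>'\<close> in all, within the room left by the factor 64.\<close>

lemma unif_prob_spread_step:
  assumes d: "1 \<le> d" "cmod \<zeta> \<le> d" and \<eta>': "0 < \<eta>'" "64 * d * \<eta>' \<le> \<eta>" "\<eta> \<le> 1" and \<epsilon>: "\<epsilon> \<le> \<eta>'"
    and k: "1 \<le> k" "64 * k \<le> n" and k': "\<kappa> \<le> real k'" "8 * k' \<le> n"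
  shows "unif_prob (perm_tuples n d) (\<lambda>ps. \<exists>x. (\<forall>i<n. cmod (x i) \<le> 1) \<and> (\<forall>i<n. cmod (perm_op d \<zeta> ps x i) \<le> \<epsilon>)
      \<and> spread n \<eta> (real k) x \<and> \<not> spread n \<eta>' \<kappa> x)
    \<le> (real n * (7 / \<eta>')\<^sup>2) ^ (k' + 1) * (161 * exp (- min (real d * real k) (real n) / 80))"
proof -
  have d1: "1 \<le> real d" using d by simp
  have e1: "\<eta>' \<le> real d * \<eta>'" using d1 \<eta>' by simp
  have e2: "64 * (real d * \<eta>') \<le> \<eta>" using \<eta>' by simp
  have "\<eta>' \<le> 1" using e1 e2 \<eta>' by linarith
  then obtain G where G: "finite G" "real (card G) \<le> (7 / \<eta>')\<^sup>2"
    and net: "\<And>w. cmod w \<le> 2 \<Longrightarrow> \<exists>g\<in>G. cmod (w - g) \<le> 2 * \<eta>'"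
    using ex_complex_net[of \<eta>'] \<eta>' by blast
  define r where "r = (\<lambda>w. SOME g. g \<in> G \<and> cmod (w - g) \<le> 2 * \<eta>')"
  have r: "r w \<in> G" "cmod (w - r w) \<le> 2 * \<eta>'" if "cmod w \<le> 2" for w
    using someI_ex[of "\<lambda>g. g \<in> G \<and> cmod (w - g) \<le> 2 * \<eta>'"] net[OF that] unfolding r_def by blast+
  \<comment> \<open>A sparse vector is encoded by a list of entries, with value 0 off the list, so
    that counting lists bounds the net.\<close>
  define Y :: "(nat \<times> complex) list \<Rightarrow> nat \<Rightarrow> complex"
    where "Y = (\<lambda>xs i. case map_of xs i of Some w \<Rightarrow> w | None \<Rightarrow> 0)"
  define LS where "LS = {xs. set xs \<subseteq> {..<n} \<times> G \<and> length xs = k'}"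
  define q where "q = 161 * exp (- min (real d * real k) (real n) / 80)"
  define E where "E = (\<lambda>(xs, g) ps. k \<le> card {j. j < n \<and> \<eta> / 2 \<le> cmod (Y xs j)} \<and> 8 * card {j. j < n \<and> Y xs j \<noteq> 0} \<le> n
     \<and> (\<forall>i<n. cmod ((\<Sum>l<d. Y xs (ps l i)) - (\<zeta> * Y xs i + of_nat d * g)) < \<eta> / 2 / 2))"
  have finLS: "finite LS" unfolding LS_def using G finite_lists_length_eq[of "{..<n} \<times> G" k'] by simp
  have cardLS: "card LS = (n * card G) ^ k'"
    unfolding LS_def using card_lists_length_eq[of "{..<n} \<times> G" k'] G by (simp add: card_cartesian_product)
  have q0: "0 \<le> q" unfolding q_def by simp
  have small: "unif_prob (perm_tuples n d) (E i) \<le> q" for i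
  proof (cases i)
    case (Pair xs g)
    show ?thesis
    proof (cases "k \<le> card {j. j < n \<and> \<eta> / 2 \<le> cmod (Y xs j)} \<and> 8 * card {j. j < n \<and> Y xs j \<noteq> 0} \<le> n")
      case True
      have "unif_prob (perm_tuples n d) (E i) \<le> unif_prob (perm_tuples n d)
          (\<lambda>ps. \<forall>i<n. cmod ((\<Sum>l<d. Y xs (ps l i)) - (\<zeta> * Y xs i + of_nat d * g)) < \<eta> / 2 / 2)"
        by (rule unif_prob_mono) (simp_all add: E_def Pair)
      also have "\<dots> \<le> q" unfolding q_def using True k by (intro unif_prob_rows_le) auto
      finally show ?thesis .
    next
      case False
      then have "unif_prob (perm_tuples n d) (E i) = 0" unfolding E_def Pair unif_prob_def by auto
      then show ?thesis using q0 by simp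
    qed
  qed
  have "unif_prob (perm_tuples n d) (\<lambda>ps. \<exists>x. (\<forall>i<n. cmod (x i) \<le> 1) \<and> (\<forall>i<n. cmod (perm_op d \<zeta> ps x i) \<le> \<epsilon>)
      \<and> spread n \<eta> (real k) x \<and> \<not> spread n \<eta>' \<kappa> x)
    \<le> unif_prob (perm_tuples n d) (\<lambda>ps. \<exists>i\<in>LS \<times> G. E i ps)"
  proof (rule unif_prob_mono)
    fix ps assume ps: "ps \<in> perm_tuples n d"
    assume "\<exists>x. (\<forall>i<n. cmod (x i) \<le> 1) \<and> (\<forall>i<n. cmod (perm_op d \<zeta> ps x i) \<le> \<epsilon>)
      \<and> spread n \<eta> (real k) x \<and> \<not> spread n \<eta>' \<kappa> x"
    then obtain x where x: "\<And>i. i < n \<Longrightarrow> cmod (x i) \<le> 1" and px: "\<And>i. i < n \<Longrightarrow> cmod (perm_op d \<zeta> ps x i) \<le> \<epsilon>"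
      and sp: "spread n \<eta> (real k) x" "\<not> spread n \<eta>' \<kappa> x" by blast
    then obtain a where a: "a < n" and T: "real (card {b. b < n \<and> \<eta>' < cmod (x b - x a)}) < \<kappa>"
      unfolding spread_def by (auto simp: not_le)
    have kJ: "k \<le> card {b. b < n \<and> \<eta> < cmod (x b - x a)}" using sp a unfolding spread_def by simp
    let ?T = "{b. b < n \<and> \<eta>' < cmod (x b - x a)}"
    have "card ?T \<le> k'" using T k' by linarith
    \<comment> \<open>Padding the support to exactly k' positions gives all lists the same
      length.\<close>
    then obtain T' where T': "?T \<subseteq> T'" "T' \<subseteq> {..<n}" "card T' = k'"
      using exists_subset_between[of ?T k' "{..<n}"] k' by auto
    have finT': "finite T'" using T' finite_subset by blast
    define y where "y = (\<lambda>i. if i \<in> T' then r (x i - x a) else 0)"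
    have le2: "cmod (x i - x a) \<le> 2" if "i < n" for i
      using norm_triangle_ineq4[of "x i" "x a"] x[OF that] x[OF a] by linarith
    have close: "cmod (x i - x a - y i) \<le> 2 * \<eta>'" if i: "i < n" for i
      using r(2)[OF le2[OF i]] T'(1) i \<eta>' unfolding y_def by (cases "i \<in> T'") (auto simp: not_less)
    define xs where "xs = map (\<lambda>i. (i, y i)) (sorted_list_of_set T')"
    have "map_of xs = (Some \<circ> y) |` T'"
      unfolding xs_def using finT' by (simp add: map_of_map_restrict)
    then have Y: "Y xs = y" unfolding Y_def y_def by (auto simp: restrict_map_def)
    have xsLS: "xs \<in> LS"
      unfolding LS_def xs_def using T' finT' r(1)[OF le2] by (auto simp: y_def)
    \<comment> \<open>As the row sums are d - \<open>\<zeta>\<close>, subtracting x a from x changes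
      its image by the constant (\<open>\<zeta>\<close> - d) x a = d w. Division by d brings the
      constant into the disc of radius 2, so the same net serves.\<close>
    define w where "w = (\<zeta> - of_nat d) * x a / of_nat d"
    have "cmod w \<le> 2"
    proof -
      have "cmod ((\<zeta> - of_nat d) * x a) \<le> (2 * real d) * 1"
        unfolding norm_mult using norm_triangle_ineq4[of \<zeta> "of_nat d"] d x[OF a] by (intro mult_mono) auto
      then show ?thesis unfolding w_def norm_divide using d by (simp add: divide_simps)
    qed
    note g = r[OF this]
    have "E (xs, r w) ps"
    proof -
      have "{b. b < n \<and> \<eta> < cmod (x b - x a)} \<subseteq> {j. j < n \<and> \<eta> / 2 \<le> cmod (y j)}"
      proof safe
        fix b assume b: "b < n" "\<eta> < cmod (x b - x a)"
        have "cmod (x b - x a) \<le> cmod (y b) + cmod (x b - x a - y b)"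
          using norm_triangle_ineq[of "y b" "x b - x a - y b"] by simp
        then show "\<eta> / 2 \<le> cmod (y b)" using b close[OF b(1)] e1 e2 \<eta>'(1) by linarith
      qed
      then have 1: "k \<le> card {j. j < n \<and> \<eta> / 2 \<le> cmod (y j)}"
        using kJ card_mono[of "{j. j < n \<and> \<eta> / 2 \<le> cmod (y j)}" "{b. b < n \<and> \<eta> < cmod (x b - x a)}"] by simp
      have "card {j. j < n \<and> y j \<noteq> 0} \<le> card T'"
        using finT' by (intro card_mono) (auto simp: y_def)
      then have 2: "8 * card {j. j < n \<and> y j \<noteq> 0} \<le> n" using T' k' by linarith
      have 3: "cmod ((\<Sum>l<d. y (ps l i)) - (\<zeta> * y i + of_nat d * r w)) < \<eta> / 2 / 2" if i: "i < n" for i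
      proof -
        define e where "e = (\<lambda>i. x i - x a - y i)"
        have psi: "ps l i < n" if "l < d" for l
          using permutes_in_image[OF perm_tuplesD[OF ps that], of i] i by simp
        have S: "cmod (\<Sum>l<d. e (ps l i)) \<le> of_nat d * (2 * \<eta>')"
          using sum_norm_bound[of "{..<d}" "\<lambda>l. e (ps l i)" "2 * \<eta>'"] close psi unfolding e_def by auto
        have Z: "cmod (\<zeta> * e i) \<le> d * (2 * \<eta>')"
          unfolding norm_mult e_def using d close[OF i] by (intro mult_mono) auto
        have Wg: "cmod (of_nat d * (w - r w)) \<le> d * (2 * \<eta>')"
          unfolding norm_mult using g by (simp add: mult_left_mono)
        have dw: "of_nat d * w = (\<zeta> - of_nat d) * x a" unfolding w_def using d by simp
        have "(\<Sum>l<d. y (ps l i)) = (\<Sum>l<d. x (ps l i)) - of_nat d * x a - (\<Sum>l<d. e (ps l i))"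
          unfolding e_def by (simp add: sum_subtractf)
        then have "(\<Sum>l<d. y (ps l i)) - (\<zeta> * y i + of_nat d * r w)
          = perm_op d \<zeta> ps x i - (\<Sum>l<d. e (ps l i)) + \<zeta> * e i + of_nat d * (w - r w)"
          unfolding right_diff_distrib dw perm_op_def e_def by (simp add: algebra_simps)
        also have "cmod \<dots> \<le> cmod (perm_op d \<zeta> ps x i) + cmod (\<Sum>l<d. e (ps l i)) + cmod (\<zeta> * e i)
            + cmod (of_nat d * (w - r w))"
          by (intro norm_triangle_le add_right_mono norm_triangle_ineq4 order_refl)
        also have "\<dots> \<le> \<epsilon> + 6 * (d * \<eta>')" using px[OF i] S Z Wg by simp
        also have "\<dots> < \<eta> / 2 / 2" using \<epsilon> e1 e2 \<eta>'(1) by linarith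
        finally show ?thesis .
      qed
      show ?thesis unfolding E_def prod.case Y using 1 2 3 by simp
    qed
    then show "\<exists>i\<in>LS \<times> G. E i ps" using xsLS g by blast
  qed simp
  also have "\<dots> \<le> real (card (LS \<times> G)) * q"
    by (rule unif_prob_Bex_le_card) (use finLS G small in auto)
  also have "\<dots> \<le> (real n * (7 / \<eta>')\<^sup>2) ^ (k' + 1) * q"
  proof (rule mult_right_mono[OF _ q0])
    have n1: "1 \<le> real n" using k by simp
    have "real (card (LS \<times> G)) = (real n * card G) ^ k' * card G"
      by (simp add: card_cartesian_product cardLS)
    also have "\<dots> \<le> (real n * (7 / \<eta>')\<^sup>2) ^ k' * (real n * (7 / \<eta>')\<^sup>2)"
      using G n1 mult_mono[of 1 "real n" "real (card G)" "(7 / \<eta>')\<^sup>2"] by (intro mult_mono power_mono) auto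
    finally show "real (card (LS \<times> G)) \<le> (real n * (7 / \<eta>')\<^sup>2) ^ (k' + 1)" by (simp only: power_add power_one_right)
  qed
  finally show ?thesis unfolding q_def .
qed

section \<open>The Littlewood-Offord inequality\<close>

text \<open>The members avoiding a point x form an antichain in A - {x}. Summing the induction
  hypothesis over x counts a member s exactly N - |s| times, and (N - |s|) / binom(N-1, |s|) = N /
  binom(N, |s|). An antichain containing A itself is just {A}.\<close>

lemma lym_inequality:
  assumes "finite A" "F \<subseteq> Pow A" "\<And>s t. s \<in> F \<Longrightarrow> t \<in> F \<Longrightarrow> s \<subseteq> t \<Longrightarrow> s = t"
  shows "(\<Sum>s\<in>F. 1 / real (card A choose card s)) \<le> 1"
  using assms
proof (induction "card A" arbitrary: A F rule: less_induct)
  case less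
  define N where "N = card A"
  have finF: "finite F" using less.prems finite_subset[of F "Pow A"] by simp
  have fins: "finite s" "s \<subseteq> A" if "s \<in> F" for s
    using that less.prems finite_subset[of s A] by auto
  show ?case
  proof (cases "A \<in> F")
    case True
    then have "F = {A}" using less.prems by blast
    then show ?thesis by simp
  next
    case notin: False
    show ?thesis
    proof (cases "A = {}")
      case True
      then have "F = {}" using notin less.prems by auto
      then show ?thesis by simp
    next
      case False
      then have N: "N > 0" using less.prems by (simp add: N_def card_gt_0_iff)
      have IH: "(\<Sum>s\<in>{s\<in>F. x \<notin> s}. 1 / real (N - 1 choose card s)) \<le> 1" if x: "x \<in> A" for x
      proof -
        have "card (A - {x}) < card A" using x less.prems by (metis card_Diff1_less)
        moreover have "card (A - {x}) = N - 1" using x by (simp add: N_def)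
        ultimately show ?thesis
          using less.hyps[of "A - {x}" "{s\<in>F. x \<notin> s}"] less.prems by auto
      qed
      have eq: "(\<Sum>x\<in>A. if x \<notin> s then 1 / real (N - 1 choose card s) else 0) = N * (1 / real (N choose card s))"
        if s: "s \<in> F" for s
      proof -
        have "s \<noteq> A" using s notin by auto
        then have lt: "card s < N" unfolding N_def using s less.prems fins by (intro psubset_card_mono) auto
        have "A \<inter> {x. x \<notin> s} = A - s" by auto
        then have "(\<Sum>x\<in>A. if x \<notin> s then 1 / real (N - 1 choose card s) else 0)
            = real (card (A - s)) * (1 / real (N - 1 choose card s))"
          using less.prems by (simp add: sum.If_cases)
        also have "card (A - s) = N - card s"
          unfolding N_def using fins[OF s] by (simp add: card_Diff_subset)
        also have "real (N - card s) * (1 / real (N - 1 choose card s)) = N * (1 / real (N choose card s))"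
        proof -
          have "(N - card s) * (N choose card s) = N * (N - 1 choose card s)" by (rule binomial_absorb_comp)
          then have "real (N - card s) * real (N choose card s) = real N * real (N - 1 choose card s)"
            by (metis of_nat_mult)
          moreover have "(N choose card s) > 0" "(N - 1 choose card s) > 0" using lt by auto
          ultimately show ?thesis by (simp add: field_simps)
        qed
        finally show ?thesis .
      qed
      have "real N * (\<Sum>s\<in>F. 1 / real (N choose card s))
          = (\<Sum>s\<in>F. \<Sum>x\<in>A. if x \<notin> s then 1 / real (N - 1 choose card s) else 0)"
        unfolding sum_distrib_left by (rule sum.cong) (simp_all only: eq)
      also have "\<dots> = (\<Sum>x\<in>A. \<Sum>s\<in>F. if x \<notin> s then 1 / real (N - 1 choose card s) else 0)"
        by (rule sum.swap)
      also have "\<dots> = (\<Sum>x\<in>A. \<Sum>s\<in>{s\<in>F. x \<notin> s}. 1 / real (N - 1 choose card s))"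
        using finF by (intro sum.cong[OF refl] sum.mono_neutral_cong_right) auto
      also have "\<dots> \<le> (\<Sum>x\<in>A. 1)" by (intro sum_mono IH)
      also have "\<dots> = N" by (simp add: N_def)
      finally show ?thesis using N unfolding N_def by simp
    qed
  qed
qed

lemma sperner_bound:
  assumes "finite A" "F \<subseteq> Pow A" "\<And>s t. s \<in> F \<Longrightarrow> t \<in> F \<Longrightarrow> s \<subseteq> t \<Longrightarrow> s = t"
  shows "card F \<le> card A choose (card A div 2)"
proof -
  let ?c = "card A choose (card A div 2)"
  have c0: "?c > 0" by simp
  have "real (card F) * (1 / ?c) = (\<Sum>s\<in>F. 1 / real ?c)" by simp
  also have "\<dots> \<le> (\<Sum>s\<in>F. 1 / real (card A choose card s))"
  proof (intro sum_mono divide_left_mono)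
    fix s assume "s \<in> F"
    then have "card s \<le> card A" using assms(1,2) card_mono by blast
    then have "(card A choose card s) > 0" by simp
    then show "0 < real ?c * real (card A choose card s)" using c0 by simp
  qed (auto simp: binomial_maximum)
  also have "\<dots> \<le> 1" by (rule lym_inequality[OF assms])
  finally show ?thesis using c0 by (simp add: field_simps)
qed

text \<open>Consecutive central coefficients have ratio 2(2m+1)/(m+1), so the induction step reduces
  to (2m+1)(2m+3) \<le> 4(m+1)^2.\<close>

lemma central_binomial_square_le: "(real (2 * m choose m))\<^sup>2 * (2 * real m + 1) \<le> 16 ^ m"
proof (induction m)
  case (Suc m)
  have rec: "real (2 * Suc m choose Suc m) * (real m + 1) = 2 * (2 * real m + 1) * real (2 * m choose m)"
  proof -
    have c: "real (2 * k choose k) = fact (2 * k) / (fact k * fact k)" for k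
      using binomial_fact[of k "2 * k", where 'a = real] by simp
    have f1: "fact (2 * Suc m) = (2 * real m + 2) * (2 * real m + 1) * fact (2 * m)"
      by (simp add: algebra_simps)
    have f2: "fact (Suc m) = (real m + 1) * fact m" by (simp add: algebra_simps)
    have "fact m \<noteq> (0::real)" "real m + 1 \<noteq> 0" by auto
    then show ?thesis unfolding c f1 f2 by (simp add: divide_simps) (simp add: algebra_simps)
  qed
  define x y where xy: "x = real (2 * Suc m choose Suc m)" "y = real (2 * m choose m)"
  note rec = rec[folded xy] and IH = Suc[folded xy]
  have "(x\<^sup>2 * (2 * real (Suc m) + 1)) * (real m + 1)\<^sup>2 = (x * (real m + 1))\<^sup>2 * (2 * real m + 3)"
    by (simp add: power_mult_distrib)
  also have "\<dots> = (y\<^sup>2 * (2 * real m + 1)) * (4 * ((2 * real m + 1) * (2 * real m + 3)))"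
    unfolding rec by (simp add: power2_eq_square algebra_simps)
  also have "\<dots> \<le> 16 ^ m * (4 * ((2 * real m + 1) * (2 * real m + 3)))"
    by (intro mult_right_mono IH) auto
  also have "\<dots> \<le> 16 ^ m * (16 * (real m + 1)\<^sup>2)"
    by (intro mult_left_mono) (auto simp: power2_eq_square algebra_simps)
  also have "\<dots> = 16 ^ Suc m * (real m + 1)\<^sup>2" by simp
  finally show ?case unfolding xy by (rule mult_right_le_imp_le) auto
qed simp

text \<open>The odd case follows from the even one because twice binom(2m+1, m) is the central
  coefficient of 2m+2.\<close>

lemma binomial_half_le: "real (N choose (N div 2)) * sqrt N \<le> 2 ^ N"
proof -
  have even: "real (2 * m choose m) * sqrt (2 * real m + 1) \<le> 4 ^ m" for m
  proof -
    have "(real (2 * m choose m) * sqrt (2 * real m + 1))\<^sup>2 = (real (2 * m choose m))\<^sup>2 * (2 * real m + 1)"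
      by (simp add: power_mult_distrib)
    also have "\<dots> \<le> 16 ^ m" by (rule central_binomial_square_le)
    also have "\<dots> = (4 ^ m)\<^sup>2" by (simp add: power_mult[symmetric] mult.commute[of m] power_mult[of 4 2])
    finally show ?thesis by (rule power2_le_imp_le) simp
  qed
  show ?thesis
  proof (cases "even N")
    case True
    then obtain m where N: "N = 2 * m" by blast
    have "real (N choose (N div 2)) * sqrt N \<le> real (2 * m choose m) * sqrt (2 * real m + 1)"
      unfolding N by (intro mult_mono) auto
    also have "\<dots> \<le> 4 ^ m" by (rule even)
    also have "\<dots> = 2 ^ N" unfolding N by (simp add: power_mult)
    finally show ?thesis .
  next
    case False
    then obtain m where N: "N = 2 * m + 1" by (auto elim: oddE)
    have "2 * (2 * m + 1 choose m) = (2 * Suc m choose Suc m)"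
      using central_binomial_odd[of "2 * m + 1"] by simp
    moreover have "N div 2 = m" unfolding N by simp
    ultimately have "2 * real (N choose (N div 2)) = real (2 * Suc m choose Suc m)"
      unfolding N by (metis of_nat_mult of_nat_numeral)
    moreover have "real N = 2 * real m + 1" unfolding N by simp
    ultimately have "2 * (real (N choose (N div 2)) * sqrt N) = real (2 * Suc m choose Suc m) * sqrt (2 * real m + 1)"
      by (simp only: mult.assoc[symmetric])
    also have "\<dots> \<le> real (2 * Suc m choose Suc m) * sqrt (2 * real (Suc m) + 1)"
      by (intro mult_left_mono) auto
    also have "\<dots> \<le> 4 ^ Suc m" by (rule even)
    also have "\<dots> = 2 * 2 ^ N" unfolding N by (simp add: power_mult)
    finally show ?thesis by simp
  qed
qed

text \<open>Encoding a sign vector by its set of negative signs makes the sign vectors to be counted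
  a set family, to which Sperner's theorem applies.\<close>

definition signed_sum :: "'a set \<Rightarrow> ('a \<Rightarrow> 'b::ab_group_add) \<Rightarrow> 'a set \<Rightarrow> 'b" where
  "signed_sum A b s = (\<Sum>i\<in>A. if i \<in> s then - b i else b i)"

text \<open>Erdos's argument: \<open>\<phi> s\<close> records the indices whose signed term is
  positive. Enlarging this set raises the sum by at least 2 \<open>\<beta>\<close>, so the patterns
  with sum in a half-open interval of that length form an antichain.\<close>

lemma littlewood_offord_full:
  fixes b :: "'a \<Rightarrow> real"
  assumes A: "finite A" and b: "\<And>i. i \<in> A \<Longrightarrow> \<beta> \<le> \<bar>b i\<bar>" and "\<beta> > 0"
  shows "card {s\<in>Pow A. c \<le> signed_sum A b s \<and> signed_sum A b s < c + 2 * \<beta>}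
         \<le> card A choose (card A div 2)"
proof -
  define X where "X = {s\<in>Pow A. c \<le> signed_sum A b s \<and> signed_sum A b s < c + 2 * \<beta>}"
  define \<phi> where "\<phi> = (\<lambda>s. {i\<in>A. i \<in> s \<longleftrightarrow> b i < 0})"
  have inj: "inj_on \<phi> X" unfolding \<phi>_def X_def inj_on_def by auto
  have val: "signed_sum A b s = (\<Sum>i\<in>A. if i \<in> \<phi> s then \<bar>b i\<bar> else - \<bar>b i\<bar>)" for s
    unfolding signed_sum_def \<phi>_def by (intro sum.cong) auto
  have anti: "\<phi> s = \<phi> t" if s: "s \<in> X" and t: "t \<in> X" and sub: "\<phi> s \<subseteq> \<phi> t" for s t
  proof (rule ccontr)
    assume "\<phi> s \<noteq> \<phi> t"
    then obtain j where j: "j \<in> \<phi> t" "j \<notin> \<phi> s" using sub by auto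
    have jA: "j \<in> A" using j unfolding \<phi>_def by auto
    have "signed_sum A b t - signed_sum A b s
       = (\<Sum>i\<in>A. (if i \<in> \<phi> t then \<bar>b i\<bar> else - \<bar>b i\<bar>) - (if i \<in> \<phi> s then \<bar>b i\<bar> else - \<bar>b i\<bar>))"
      unfolding val by (simp add: sum_subtractf)
    also have "\<dots> \<ge> (if j \<in> \<phi> t then \<bar>b j\<bar> else - \<bar>b j\<bar>) - (if j \<in> \<phi> s then \<bar>b j\<bar> else - \<bar>b j\<bar>)"
      using sub jA A by (intro member_le_sum) auto
    finally have "2 * \<beta> \<le> signed_sum A b t - signed_sum A b s" using j b[OF jA] by simp
    then show False using s t unfolding X_def by simp
  qed
  have "card X = card (\<phi> ` X)" using inj by (simp add: card_image)
  also have "\<dots> \<le> card A choose (card A div 2)"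
    by (rule sperner_bound[OF A]) (use anti in \<open>auto simp: \<phi>_def\<close>)
  finally show ?thesis unfolding X_def .
qed

text \<open>With the signs outside \<open>G\<close> fixed, the interval is merely shifted and
  \<open>littlewood_offord_full\<close> applies to each fibre.\<close>

lemma littlewood_offord_real:
  fixes b :: "'a \<Rightarrow> real"
  assumes A: "finite A" and G: "G \<subseteq> A" "G \<noteq> {}" and b: "\<And>i. i \<in> G \<Longrightarrow> \<beta> \<le> \<bar>b i\<bar>" and \<beta>: "\<beta> > 0"
  shows "card {s\<in>Pow A. c \<le> signed_sum A b s \<and> signed_sum A b s < c + 2 * \<beta>} \<le> 2 ^ card A / sqrt (card G)"
proof -
  define X where "X = {s\<in>Pow A. c \<le> signed_sum A b s \<and> signed_sum A b s < c + 2 * \<beta>}"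
  define Y where "Y = (\<lambda>t. {r\<in>Pow G. c - signed_sum (A - G) b t \<le> signed_sum G b r
      \<and> signed_sum G b r < c - signed_sum (A - G) b t + 2 * \<beta>})"
  have finG: "finite G" using finite_subset[OF G(1) A] .
  have split: "signed_sum A b s = signed_sum G b (s \<inter> G) + signed_sum (A - G) b (s - G)" for s
  proof -
    have "signed_sum A b s = signed_sum G b s + signed_sum (A - G) b s"
      unfolding signed_sum_def using sum.subset_diff[OF G(1) A] by (simp add: add.commute)
    moreover have "signed_sum G b s = signed_sum G b (s \<inter> G)" unfolding signed_sum_def by (intro sum.cong) auto
    moreover have "signed_sum (A - G) b s = signed_sum (A - G) b (s - G)"
      unfolding signed_sum_def by (intro sum.cong) auto
    ultimately show ?thesis by simp
  qed
  have finS: "finite (Sigma (Pow (A - G)) Y)" using A finG by (intro finite_SigmaI) (auto simp: Y_def)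
  have "card X \<le> card (Sigma (Pow (A - G)) Y)"
  proof (rule card_inj_on_le[of "\<lambda>s. (s - G, s \<inter> G)"])
    show "inj_on (\<lambda>s. (s - G, s \<inter> G)) X" by (rule inj_onI) blast
    show "(\<lambda>s. (s - G, s \<inter> G)) ` X \<subseteq> Sigma (Pow (A - G)) Y"
      unfolding X_def Y_def using split by auto
  qed (rule finS)
  also have "\<dots> = (\<Sum>t\<in>Pow (A - G). card (Y t))"
    using A finG by (subst card_SigmaI) (auto simp: Y_def)
  also have "\<dots> \<le> (\<Sum>t\<in>Pow (A - G). card G choose (card G div 2))"
    unfolding Y_def by (intro sum_mono littlewood_offord_full finG b \<beta>)
  also have "\<dots> = 2 ^ card (A - G) * (card G choose (card G div 2))" using A by (simp add: card_Pow)
  finally have "real (card X) \<le> 2 ^ card (A - G) * real (card G choose (card G div 2))"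
    by (metis of_nat_le_iff of_nat_mult of_nat_numeral of_nat_power)
  moreover have "sqrt (card G) > 0" using finG G by (simp add: card_gt_0_iff)
  ultimately have "real (card X) * sqrt (card G) \<le> 2 ^ card (A - G) * (real (card G choose (card G div 2)) * sqrt (card G))"
    by (simp add: mult.assoc[symmetric])
  also have "\<dots> \<le> 2 ^ card (A - G) * 2 ^ card G" by (intro mult_left_mono binomial_half_le) auto
  also have "\<dots> = 2 ^ card A"
    using G(1) A finG card_mono[OF A G(1)] by (simp add: power_add[symmetric] card_Diff_subset)
  finally show ?thesis using \<open>sqrt (card G) > 0\<close> unfolding X_def by (simp add: field_simps)
qed

text \<open>A coefficient of modulus at least \<open>\<eta>\<close> has a real or imaginary part of
  size at least \<open>\<eta> / 2\<close>, so one of the two projections has at least N/2 large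
  coefficients. The strict bound on \<open>\<epsilon>\<close> fits a closed interval of length 2
  \<open>\<epsilon>\<close> into a half-open one of length \<open>\<eta>\<close>.\<close>

lemma littlewood_offord_complex:
  fixes a :: "'a \<Rightarrow> complex"
  assumes A: "finite A" and \<eta>: "\<eta> > 0" "\<epsilon> < \<eta> / 2"
    and N: "0 < N" "N \<le> real (card {i\<in>A. \<eta> \<le> cmod (a i)})"
  shows "card {s\<in>Pow A. cmod (signed_sum A a s - w) \<le> \<epsilon>} \<le> 2 ^ card A * sqrt (2 / N)"
proof -
  define G1 where "G1 = {i\<in>A. \<eta> / 2 \<le> \<bar>Re (a i)\<bar>}"
  define G2 where "G2 = {i\<in>A. \<eta> / 2 \<le> \<bar>Im (a i)\<bar>}"
  define X where "X = {s\<in>Pow A. cmod (signed_sum A a s - w) \<le> \<epsilon>}"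
  have Re: "Re (signed_sum A a s) = signed_sum A (\<lambda>i. Re (a i)) s"
    and Im: "Im (signed_sum A a s) = signed_sum A (\<lambda>i. Im (a i)) s" for s
    unfolding signed_sum_def by (auto intro!: sum.cong)
  have "{i\<in>A. \<eta> \<le> cmod (a i)} \<subseteq> G1 \<union> G2"
    unfolding G1_def G2_def using cmod_le[of "a _"] by (auto simp: not_le) (smt (verit) cmod_le field_sum_of_halves)
  then have "card {i\<in>A. \<eta> \<le> cmod (a i)} \<le> card (G1 \<union> G2)"
    using A by (intro card_mono) (auto simp: G1_def G2_def)
  also have "\<dots> \<le> card G1 + card G2" by (rule card_Un_le)
  finally have big: "N \<le> real (card G1) + real (card G2)" using N by linarith
  have bound: "real (card X) \<le> 2 ^ card A * sqrt (2 / N)" if "real (card X) \<le> 2 ^ card A / sqrt (card G)" "N / 2 \<le> card G" for G :: "'a set"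
  proof -
    have "sqrt (2 / N) = 1 / sqrt (N / 2)" using N by (simp add: real_sqrt_divide)
    moreover have "1 / sqrt (card G) \<le> 1 / sqrt (N / 2)" using that N by (intro divide_left_mono) auto
    ultimately have "2 ^ card A / sqrt (card G) \<le> 2 ^ card A * sqrt (2 / N)"
      using mult_left_mono[of "1 / sqrt (card G)" "sqrt (2 / N)" "2 ^ card A"] by simp
    then show ?thesis using that by simp
  qed
  consider "N / 2 \<le> card G1" | "N / 2 \<le> card G2" using big by linarith
  then have "real (card X) \<le> 2 ^ card A * sqrt (2 / N)"
  proof cases
    case 1
    then have ne: "G1 \<noteq> {}" using N by auto
    have "card X \<le> card {s\<in>Pow A. Re w - \<epsilon> \<le> signed_sum A (\<lambda>i. Re (a i)) s
        \<and> signed_sum A (\<lambda>i. Re (a i)) s < Re w - \<epsilon> + 2 * (\<eta> / 2)}"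
    proof (rule card_mono)
      show "X \<subseteq> {s\<in>Pow A. Re w - \<epsilon> \<le> signed_sum A (\<lambda>i. Re (a i)) s
        \<and> signed_sum A (\<lambda>i. Re (a i)) s < Re w - \<epsilon> + 2 * (\<eta> / 2)}"
      proof
        fix s assume s: "s \<in> X"
        have "\<bar>Re (signed_sum A a s - w)\<bar> \<le> \<epsilon>"
          using s abs_Re_le_cmod[of "signed_sum A a s - w"] unfolding X_def by simp
        then show "s \<in> {s\<in>Pow A. Re w - \<epsilon> \<le> signed_sum A (\<lambda>i. Re (a i)) s
        \<and> signed_sum A (\<lambda>i. Re (a i)) s < Re w - \<epsilon> + 2 * (\<eta> / 2)}"
          using s \<eta> unfolding X_def by (simp add: Re abs_le_iff)
      qed
    qed (use A in auto)
    moreover have "card {s\<in>Pow A. Re w - \<epsilon> \<le> signed_sum A (\<lambda>i. Re (a i)) s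
        \<and> signed_sum A (\<lambda>i. Re (a i)) s < Re w - \<epsilon> + 2 * (\<eta> / 2)} \<le> 2 ^ card A / sqrt (card G1)"
      by (rule littlewood_offord_real[OF A]) (use ne \<eta> in \<open>auto simp: G1_def\<close>)
    ultimately have "real (card X) \<le> 2 ^ card A / sqrt (card G1)" by linarith
    then show ?thesis using bound 1 by blast
  next
    case 2
    then have ne: "G2 \<noteq> {}" using N by auto
    have "card X \<le> card {s\<in>Pow A. Im w - \<epsilon> \<le> signed_sum A (\<lambda>i. Im (a i)) s
        \<and> signed_sum A (\<lambda>i. Im (a i)) s < Im w - \<epsilon> + 2 * (\<eta> / 2)}"
    proof (rule card_mono)
      show "X \<subseteq> {s\<in>Pow A. Im w - \<epsilon> \<le> signed_sum A (\<lambda>i. Im (a i)) s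
        \<and> signed_sum A (\<lambda>i. Im (a i)) s < Im w - \<epsilon> + 2 * (\<eta> / 2)}"
      proof
        fix s assume s: "s \<in> X"
        have "\<bar>Im (signed_sum A a s - w)\<bar> \<le> \<epsilon>"
          using s abs_Im_le_cmod[of "signed_sum A a s - w"] unfolding X_def by simp
        then show "s \<in> {s\<in>Pow A. Im w - \<epsilon> \<le> signed_sum A (\<lambda>i. Im (a i)) s
        \<and> signed_sum A (\<lambda>i. Im (a i)) s < Im w - \<epsilon> + 2 * (\<eta> / 2)}"
          using s \<eta> unfolding X_def by (simp add: Im abs_le_iff)
      qed
    qed (use A in auto)
    moreover have "card {s\<in>Pow A. Im w - \<epsilon> \<le> signed_sum A (\<lambda>i. Im (a i)) s
        \<and> signed_sum A (\<lambda>i. Im (a i)) s < Im w - \<epsilon> + 2 * (\<eta> / 2)} \<le> 2 ^ card A / sqrt (card G2)"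
      by (rule littlewood_offord_real[OF A]) (use ne \<eta> in \<open>auto simp: G2_def\<close>)
    ultimately have "real (card X) \<le> 2 ^ card A / sqrt (card G2)" by linarith
    then show ?thesis using bound 2 by blast
  qed
  then show ?thesis unfolding X_def .
qed

section \<open>Separated rows\<close>

definition sep_count :: "nat \<Rightarrow> real \<Rightarrow> (nat \<Rightarrow> nat \<Rightarrow> nat) \<Rightarrow> (nat \<Rightarrow> complex) \<Rightarrow> nat \<Rightarrow> nat" where
  "sep_count d \<eta> ps x i = card {l. l < d \<and> \<eta> < cmod (x (ps l 0) - x (ps l i))}"

text \<open>Exponential Markov inequality. Under one permutation, given the image of 0, each point
  of \<open>B\<close> in turn lands far from it with probability at least \<open>\<theta>\<close>,
  so (1/2)^count has mean at most exp(-\<open>\<theta>\<close> b / 2). The d independent factors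
  give exp(-2s) with s = \<open>\<theta>\<close> b d / 4, and the threshold s costs exp(s).\<close>

lemma unif_prob_few_separated:
  fixes w :: "nat \<Rightarrow> complex"
  assumes n: "0 < n" and B: "B \<subseteq> {1..<n}" "card B = b" and K: "2 * b \<le> K" "K \<le> n"
    and w: "\<And>a. a < n \<Longrightarrow> K \<le> card {c. c < n \<and> t < cmod (w c - w a)}" and t: "0 \<le> t"
    and th: "\<theta> = K / (2 * n)"
  shows "unif_prob (perm_tuples n d)
      (\<lambda>ps. real (\<Sum>l<d. card {i\<in>B. t < cmod (w (ps l i) - w (ps l 0))}) \<le> \<theta> * b * d / 4)
    \<le> exp (- (\<theta> * b * d / 4))"
proof -
  define s where "s = \<theta> * b * d / 4"
  have th01: "0 \<le> \<theta>" "\<theta> \<le> 1" using K n by (auto simp: th divide_simps)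
  have s0: "0 \<le> s" unfolding s_def using th01 by simp
  define c where "c = (\<lambda>\<pi>. card {i\<in>B. t < cmod (w (\<pi> i) - w (\<pi> 0))})"
  let ?S = "{\<pi>. \<pi> permutes {..<n}}"
  have one: "avg ?S (\<lambda>\<pi>. (1/2) ^ c \<pi>) \<le> exp (- (\<theta> * b / 2))"
  proof -
    define D where "D = (\<lambda>\<pi>::nat \<Rightarrow> nat. {e. e < n \<and> t < cmod (w e - w (\<pi> 0))})"
    have "avg ?S (\<lambda>\<pi>. (1/2) ^ c \<pi>) = avg ?S (\<lambda>\<pi>. (1/2) ^ card {i\<in>B. \<pi> i \<in> D \<pi>})"
    proof (rule avg_cong)
      fix \<pi> assume "\<pi> \<in> ?S"
      then have "\<pi> i < n" if "i \<in> B" for i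
        using permutes_in_image[of \<pi> "{..<n}" i] that B by auto
      then have "{i\<in>B. t < cmod (w (\<pi> i) - w (\<pi> 0))} = {i\<in>B. \<pi> i \<in> D \<pi>}" unfolding D_def by auto
      then show "(1/2::real) ^ c \<pi> = (1/2) ^ card {i\<in>B. \<pi> i \<in> D \<pi>}" unfolding c_def by simp
    qed
    also have "\<dots> \<le> (1 - (1 - 1/2) * \<theta>) ^ card B"
    \<comment> \<open>\<open>D \<pi>\<close> depends on \<open>\<pi>\<close> only through the image
      of 0; leaving 0 out of \<open>W\<close> makes it invariant under the transpositions.\<close>
    proof (rule avg_permutes_power_le[where W = "{1..<n}"])
      fix \<pi> e e' assume "\<pi> permutes {..<n}" "e \<in> {1..<n}" "e' \<in> {1..<n}"
      then have "(\<pi> \<circ> Transposition.transpose e e') 0 = \<pi> 0" by (simp add: Transposition.transpose_def)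
      then show "D (\<pi> \<circ> Transposition.transpose e e') = D \<pi>" unfolding D_def by simp
    next
      fix \<pi> assume p: "\<pi> permutes {..<n}"
      have p0: "\<pi> 0 < n" using permutes_in_image[OF p, of 0] n by simp
      have "bij_betw \<pi> {e\<in>{1..<n}. \<pi> e \<in> D \<pi>} (D \<pi>)"
      proof (rule bij_betw_imageI)
        show "inj_on \<pi> {e\<in>{1..<n}. \<pi> e \<in> D \<pi>}" by (rule inj_on_subset[OF permutes_inj[OF p]]) simp
        show "\<pi> ` {e\<in>{1..<n}. \<pi> e \<in> D \<pi>} = D \<pi>"
        proof (intro equalityI subsetI)
          fix f assume f: "f \<in> D \<pi>"
          then obtain e where e: "e < n" "f = \<pi> e" using permutes_image[OF p] unfolding D_def by auto
          have "e \<noteq> 0"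
          proof
            assume "e = 0"
            then show False using f e t unfolding D_def by simp
          qed
          then show "f \<in> \<pi> ` {e\<in>{1..<n}. \<pi> e \<in> D \<pi>}" using e f by auto
        qed auto
      qed
      then have "card {e\<in>{1..<n}. \<pi> e \<in> D \<pi>} = card (D \<pi>)" by (rule bij_betw_same_card)
      then have "K \<le> card {e\<in>{1..<n}. \<pi> e \<in> D \<pi>}" using w[OF p0] unfolding D_def by simp
      \<comment> \<open>Half of the K far values is the reserve for the b \<le> K/2 points of
        \<open>B\<close>; the other half gives \<open>\<theta>\<close> = K/(2n).\<close>
      moreover have "real (card B) + \<theta> * card {1..<n} \<le> K"
      proof -
        have "\<theta> * card {1..<n} \<le> \<theta> * n" using th01 by (intro mult_left_mono) auto
        also have "\<dots> = K / 2" using n by (simp add: th)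
        finally show ?thesis using B K by simp
      qed
      ultimately show "real (card B) + \<theta> * card {1..<n} \<le> card {e\<in>{1..<n}. \<pi> e \<in> D \<pi>}" by linarith
    qed (use B th01 in auto)
    also have "\<dots> \<le> exp (- \<theta> / 2) ^ b"
      using exp_ge_add_one_self[of "- \<theta> / 2"] th01 B by (auto intro!: power_mono)
    also have "\<dots> = exp (- (\<theta> * b / 2))" by (simp add: exp_of_nat_mult[symmetric] mult_ac)
    finally show ?thesis .
  qed
  have "unif_prob (perm_tuples n d) (\<lambda>ps. real (\<Sum>l<d. c (ps l)) \<le> s)
      \<le> avg (perm_tuples n d) (\<lambda>ps. exp s * (\<Prod>l<d. (1/2) ^ c (ps l)))"
    unfolding unif_prob_eq_avg[OF finite_perm_tuples]
  proof (rule avg_mono)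
    fix ps
    show "of_bool (real (\<Sum>l<d. c (ps l)) \<le> s) \<le> exp s * (\<Prod>l<d. (1/2) ^ c (ps l))"
    proof (cases "real (\<Sum>l<d. c (ps l)) \<le> s")
      case True
      have "(2::real) ^ (\<Sum>l<d. c (ps l)) \<le> exp 1 ^ (\<Sum>l<d. c (ps l))"
        using exp_ge_add_one_self[of 1] by (intro power_mono) auto
      also have "\<dots> = exp (real (\<Sum>l<d. c (ps l)))" by (simp add: exp_of_nat_mult[symmetric] del: of_nat_sum)
      also have "\<dots> \<le> exp s" using True by simp
      finally have "2 ^ (\<Sum>l<d. c (ps l)) * (1/2) ^ (\<Sum>l<d. c (ps l)) \<le> exp s * (1/2) ^ (\<Sum>l<d. c (ps l))"
        by (intro mult_right_mono) auto
      then show ?thesis using True by (simp add: power_sum[symmetric] power_mult_distrib[symmetric])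
    qed (auto intro!: mult_nonneg_nonneg prod_nonneg)
  qed
  also have "\<dots> = exp s * (\<Prod>l<d. avg ?S (\<lambda>\<pi>. (1/2) ^ c \<pi>))"
    by (simp only: avg_cmult avg_perm_tuples_prod[of n d "\<lambda>l \<pi>. (1/2) ^ c \<pi>"])
  also have "\<dots> \<le> exp s * exp (- (\<theta> * b / 2)) ^ d"
    using one by (simp add: avg_nonneg power_mono)
  also have "\<dots> = exp (- s)"
    unfolding s_def by (simp add: exp_of_nat_mult[symmetric] exp_add[symmetric] mult_ac)
  finally show ?thesis unfolding s_def c_def .
qed

text \<open>A spread vector has no sparse approximation, so all n coordinates are rounded and the
  union bound also runs over the set of bad rows. Treating b bad rows jointly makes the gain
  exponential in b d, which can beat a net exponential in n. The constant 112 is 7 * 16, from the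
  mesh \<open>\<eta> / 16\<close>.\<close>

lemma unif_prob_discrepancy:
  assumes n: "0 < n" and \<eta>: "0 < \<eta>" "\<eta> \<le> 1" and K: "2 * b \<le> K" "K \<le> n" and \<kappa>: "real K \<le> \<kappa>"
    and th: "\<theta> = K / (2 * n)"
  shows "unif_prob (perm_tuples n d) (\<lambda>ps. \<exists>x. (\<forall>i<n. cmod (x i) \<le> 1) \<and> spread n \<eta> \<kappa> x
      \<and> b \<le> card {i. 0 < i \<and> i < n \<and> real (sep_count d (\<eta> / 2) ps x i) \<le> \<theta> * d / 4})
    \<le> (2 * (112 / \<eta>)\<^sup>2) ^ n * exp (- (\<theta> * b * d / 4))"
proof -
  obtain G where G: "finite G" "real (card G) \<le> (7 / (\<eta> / 16))\<^sup>2"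
    and net: "\<And>w. cmod w \<le> 2 \<Longrightarrow> \<exists>g\<in>G. cmod (w - g) \<le> 2 * (\<eta> / 16)"
    using ex_complex_net[of "\<eta> / 16"] \<eta> by auto
  define r where "r = (\<lambda>w. SOME g. g \<in> G \<and> cmod (w - g) \<le> 2 * (\<eta> / 16))"
  have r: "r w \<in> G" "cmod (w - r w) \<le> \<eta> / 8" if "cmod w \<le> 2" for w
    using someI_ex[of "\<lambda>g. g \<in> G \<and> cmod (w - g) \<le> 2 * (\<eta> / 16)"] net[OF that] unfolding r_def by auto
  \<comment> \<open>Rounding moves a coordinate by at most \<open>\<eta> / 8\<close> and a
    difference by at most \<open>\<eta> / 4\<close>, exactly the gaps between \<open>\<eta>\<close>,
    \<open>t\<close> and \<open>\<eta> / 2\<close>.\<close>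
  define t where "t = 3 * \<eta> / 4"
  define q where "q = exp (- (\<theta> * b * d / 4))"
  define I where "I = PiE {..<n} (\<lambda>_. G) \<times> {B\<in>Pow {1..<n}. card B = b}"
  define E where "E = (\<lambda>(w :: nat \<Rightarrow> complex, B :: nat set) ps. (\<forall>a<n. K \<le> card {c. c < n \<and> t < cmod (w c - w a)})
     \<and> real (\<Sum>l<d. card {i\<in>B. t < cmod (w (ps l i) - w (ps l 0))}) \<le> \<theta> * b * d / 4)"
  have finI: "finite I" unfolding I_def using G by (auto intro!: finite_PiE)
  have small: "unif_prob (perm_tuples n d) (E i) \<le> q" if i: "i \<in> I" for i
  proof -
    obtain w B where wB: "i = (w, B)" by (cases i)
    then have B: "B \<subseteq> {1..<n}" "card B = b" using i unfolding I_def by auto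
    show ?thesis
    proof (cases "\<forall>a<n. K \<le> card {c. c < n \<and> t < cmod (w c - w a)}")
      case True
      have "unif_prob (perm_tuples n d) (E i) \<le> unif_prob (perm_tuples n d)
        (\<lambda>ps. real (\<Sum>l<d. card {i\<in>B. t < cmod (w (ps l i) - w (ps l 0))}) \<le> \<theta> * b * d / 4)"
        by (rule unif_prob_mono) (simp_all add: E_def wB)
      also have "\<dots> \<le> q" unfolding q_def
        by (rule unif_prob_few_separated[OF n B K _ _ th]) (use True \<eta> in \<open>auto simp: t_def\<close>)
      finally show ?thesis .
    next
      case False
      then have "unif_prob (perm_tuples n d) (E i) = 0" unfolding E_def wB unif_prob_def by auto
      then show ?thesis unfolding q_def by simp
    qed
  qed
  have "unif_prob (perm_tuples n d) (\<lambda>ps. \<exists>x. (\<forall>i<n. cmod (x i) \<le> 1) \<and> spread n \<eta> \<kappa> x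
      \<and> b \<le> card {i. 0 < i \<and> i < n \<and> real (sep_count d (\<eta> / 2) ps x i) \<le> \<theta> * d / 4})
     \<le> unif_prob (perm_tuples n d) (\<lambda>ps. \<exists>i\<in>I. E i ps)"
  proof (rule unif_prob_mono)
    fix ps assume ps: "ps \<in> perm_tuples n d"
    assume "\<exists>x. (\<forall>i<n. cmod (x i) \<le> 1) \<and> spread n \<eta> \<kappa> x
      \<and> b \<le> card {i. 0 < i \<and> i < n \<and> real (sep_count d (\<eta> / 2) ps x i) \<le> \<theta> * d / 4}"
    then obtain x where x: "\<And>i. i < n \<Longrightarrow> cmod (x i) \<le> 1" and sp: "spread n \<eta> \<kappa> x"
      and bad: "b \<le> card {i. 0 < i \<and> i < n \<and> real (sep_count d (\<eta> / 2) ps x i) \<le> \<theta> * d / 4}" by blast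
    obtain B where B: "B \<subseteq> {i. 0 < i \<and> i < n \<and> real (sep_count d (\<eta> / 2) ps x i) \<le> \<theta> * d / 4}" "card B = b"
      using obtain_subset_with_card_n[OF bad] by blast
    have finB: "finite B" using B(1) by (rule finite_subset) simp
    define w where "w = restrict (\<lambda>i. r (x i)) {..<n}"
    have w: "cmod (x i - w i) \<le> \<eta> / 8" "w i \<in> G" if "i < n" for i
    proof -
      have "cmod (x i) \<le> 2" using x[OF that] by simp
      from r[OF this] show "cmod (x i - w i) \<le> \<eta> / 8" "w i \<in> G" using that unfolding w_def by auto
    qed
    have diff: "\<bar>cmod (x i - x j) - cmod (w i - w j)\<bar> \<le> \<eta> / 4" if ij: "i < n" "j < n" for i j
    proof -
      have "\<bar>cmod (x i - x j) - cmod (w i - w j)\<bar> \<le> cmod ((x i - x j) - (w i - w j))"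
        by (rule norm_triangle_ineq3)
      also have "\<dots> = cmod ((x i - w i) - (x j - w j))" by (simp add: algebra_simps)
      also have "\<dots> \<le> \<eta> / 4" using norm_triangle_ineq4[of "x i - w i" "x j - w j"] w[OF ij(1)] w[OF ij(2)] by linarith
      finally show ?thesis .
    qed
    have "E (w, B) ps"
    proof -
      have "K \<le> card {c. c < n \<and> t < cmod (w c - w a)}" if a: "a < n" for a
      proof -
        have "real K \<le> real (card {c. c < n \<and> \<eta> < cmod (x c - x a)})"
          using sp a \<kappa> unfolding spread_def by (meson order_trans)
        then have "K \<le> card {c. c < n \<and> \<eta> < cmod (x c - x a)}" by simp
        also have "\<dots> \<le> card {c. c < n \<and> t < cmod (w c - w a)}"
        proof (rule card_mono)
          show "{c. c < n \<and> \<eta> < cmod (x c - x a)} \<subseteq> {c. c < n \<and> t < cmod (w c - w a)}"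
          proof safe
            fix c assume c: "c < n" "\<eta> < cmod (x c - x a)"
            then show "t < cmod (w c - w a)" using diff[OF c(1) a] unfolding t_def by linarith
          qed
        qed simp
        finally show ?thesis .
      qed
      moreover have "real (\<Sum>l<d. card {i\<in>B. t < cmod (w (ps l i) - w (ps l 0))}) \<le> \<theta> * b * d / 4"
      proof -
        have "(\<Sum>l<d. card {i\<in>B. t < cmod (w (ps l i) - w (ps l 0))})
            = (\<Sum>l<d. \<Sum>i\<in>B. of_bool (t < cmod (w (ps l i) - w (ps l 0))))"
          using finB by (simp add: Int_def)
        also have "\<dots> = (\<Sum>i\<in>B. \<Sum>l<d. of_bool (t < cmod (w (ps l i) - w (ps l 0))))" by (rule sum.swap)
        also have "\<dots> \<le> (\<Sum>i\<in>B. sep_count d (\<eta> / 2) ps x i)"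
        proof (rule sum_mono)
          fix i assume "i \<in> B"
          then have i: "i < n" using B by auto
          have "(\<Sum>l<d. of_bool (t < cmod (w (ps l i) - w (ps l 0)))) = card {l\<in>{..<d}. t < cmod (w (ps l i) - w (ps l 0))}"
            by (simp add: Int_def)
          also have "\<dots> \<le> sep_count d (\<eta> / 2) ps x i"
            unfolding sep_count_def
          proof (rule card_mono)
            show "{l\<in>{..<d}. t < cmod (w (ps l i) - w (ps l 0))} \<subseteq> {l. l < d \<and> \<eta> / 2 < cmod (x (ps l 0) - x (ps l i))}"
            proof safe
              fix l assume l: "l < d" "t < cmod (w (ps l i) - w (ps l 0))"
              have "ps l i < n" "ps l 0 < n"
                using permutes_in_image[OF perm_tuplesD[OF ps l(1)]] i n by auto
              from diff[OF this] l(2) show "\<eta> / 2 < cmod (x (ps l 0) - x (ps l i))"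
                unfolding t_def using norm_minus_commute[of "x (ps l 0)" "x (ps l i)"] by linarith
            qed
          qed simp
          finally show "(\<Sum>l<d. of_bool (t < cmod (w (ps l i) - w (ps l 0)))) \<le> sep_count d (\<eta> / 2) ps x i" .
        qed
        finally have "real (\<Sum>l<d. card {i\<in>B. t < cmod (w (ps l i) - w (ps l 0))})
            \<le> real (\<Sum>i\<in>B. sep_count d (\<eta> / 2) ps x i)" by (rule of_nat_mono)
        also have "\<dots> \<le> real (card B) * (\<theta> * d / 4)"
          unfolding of_nat_sum using B(1) by (intro sum_bounded_above) auto
        finally show ?thesis using B by (simp add: mult_ac)
      qed
      ultimately show ?thesis unfolding E_def by simp
    qed
    moreover have "(w, B) \<in> I" unfolding I_def using B w(2) by (auto simp: w_def)
    ultimately show "\<exists>i\<in>I. E i ps" by blast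
  qed simp
  also have "\<dots> \<le> real (card I) * q" by (rule unif_prob_Bex_le_card) (use finI small in auto)
  also have "\<dots> \<le> (2 * (112 / \<eta>)\<^sup>2) ^ n * q"
  proof (rule mult_right_mono)
    have "card {B\<in>Pow {1..<n}. card B = b} \<le> card (Pow {..<n})" by (intro card_mono) auto
    then have "card I \<le> card G ^ n * 2 ^ n"
      unfolding I_def by (simp add: card_cartesian_product card_PiE card_Pow)
    then have "real (card I) \<le> real (card G ^ n * 2 ^ n)" by (rule of_nat_mono)
    also have "\<dots> = real (card G) ^ n * 2 ^ n" by simp
    also have "\<dots> \<le> ((112 / \<eta>)\<^sup>2) ^ n * 2 ^ n"
      using G by (intro mult_right_mono power_mono) auto
    also have "\<dots> = ((112 / \<eta>)\<^sup>2 * 2) ^ n" by (rule power_mult_distrib[symmetric])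
    finally show "real (card I) \<le> (2 * (112 / \<eta>)\<^sup>2) ^ n" unfolding mult.commute[of 2] .
  qed (simp add: q_def)
  finally show ?thesis unfolding q_def .
qed

section \<open>Exchanging two rows\<close>

definition swap_at :: "nat \<Rightarrow> nat \<Rightarrow> nat set \<Rightarrow> (nat \<Rightarrow> nat \<Rightarrow> nat) \<Rightarrow> nat \<Rightarrow> nat \<Rightarrow> nat" where
  "swap_at d i s ps l = (if l < d \<and> l \<in> s then ps l \<circ> Transposition.transpose 0 i else ps l)"

lemma bij_betw_swap_at:
  assumes "i < n"
  shows "bij_betw (swap_at d i s) (perm_tuples n d) (perm_tuples n d)"
proof -
  have t: "Transposition.transpose 0 i permutes {..<n}" using assms by (intro permutes_swap_id) auto
  have "swap_at d i s ps \<in> perm_tuples n d" if "ps \<in> perm_tuples n d" for ps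
    using that permutes_compose[OF t] unfolding perm_tuples_def swap_at_def by auto
  moreover have "swap_at d i s (swap_at d i s ps) = ps" for ps
    unfolding swap_at_def by (auto simp: fun_eq_iff)
  ultimately show ?thesis by (intro bij_betwI[where g = "swap_at d i s"]) auto
qed

text \<open>Approximate null vectors of the rows other than 0 and i and of the sum of these two rows: a
  condition that does not see the exchange of rows 0 and i in any of the permutations.\<close>

definition null_candidates ::
    "nat \<Rightarrow> nat \<Rightarrow> complex \<Rightarrow> real \<Rightarrow> real \<Rightarrow> real \<Rightarrow> nat \<Rightarrow> (nat \<Rightarrow> nat \<Rightarrow> nat) \<Rightarrow> (nat \<Rightarrow> complex) set" where
  "null_candidates n d \<zeta> \<epsilon> \<eta> N i ps = {v. (\<forall>j<n. cmod (v j) \<le> 1)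
     \<and> (\<forall>j<n. j \<noteq> 0 \<longrightarrow> j \<noteq> i \<longrightarrow> cmod (perm_op d \<zeta> ps v j) \<le> \<epsilon>)
     \<and> cmod (perm_op d \<zeta> ps v 0 + perm_op d \<zeta> ps v i) \<le> 2 * \<epsilon>
     \<and> N \<le> real (sep_count d \<eta> ps v i)}"

text \<open>An exchange within one permutation preserves the sum of the two entries and the modulus
  of their difference, and leaves all other rows alone.\<close>

lemma null_candidates_swap_at:
  "null_candidates n d \<zeta> \<epsilon> \<eta> N i (swap_at d i s ps) = null_candidates n d \<zeta> \<epsilon> \<eta> N i ps"
proof -
  have other: "perm_op d \<zeta> (swap_at d i s ps) v j = perm_op d \<zeta> ps v j" if "j \<noteq> 0" "j \<noteq> i" for v j
    using that unfolding perm_op_def swap_at_def by (auto intro!: sum.cong)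
  have both: "perm_op d \<zeta> (swap_at d i s ps) v 0 + perm_op d \<zeta> (swap_at d i s ps) v i
      = perm_op d \<zeta> ps v 0 + perm_op d \<zeta> ps v i" for v
  proof -
    have "(\<Sum>l<d. v (swap_at d i s ps l 0)) + (\<Sum>l<d. v (swap_at d i s ps l i))
        = (\<Sum>l<d. v (ps l 0)) + (\<Sum>l<d. v (ps l i))"
      unfolding sum.distrib[symmetric] swap_at_def by (intro sum.cong) auto
    then show ?thesis unfolding perm_op_def by (simp add: algebra_simps)
  qed
  have "{l. l < d \<and> \<eta> < cmod (v (swap_at d i s ps l 0) - v (swap_at d i s ps l i))}
      = {l. l < d \<and> \<eta> < cmod (v (ps l 0) - v (ps l i))}" for v
    unfolding swap_at_def by (auto simp: norm_minus_commute)
  then have "sep_count d \<eta> (swap_at d i s ps) v i = sep_count d \<eta> ps v i" for v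
    unfolding sep_count_def by simp
  then show ?thesis unfolding null_candidates_def using other both by auto
qed

text \<open>Exchanging in permutation l negates its summand. The diagonal term stays, since v 0 and
  v i are coordinates of v and not images under a permutation.\<close>

lemma perm_op_swap_at_diff:
  "perm_op d \<zeta> (swap_at d i s ps) v 0 - perm_op d \<zeta> (swap_at d i s ps) v i
   = signed_sum {..<d} (\<lambda>l. v (ps l 0) - v (ps l i)) s - \<zeta> * (v 0 - v i)"
proof -
  have "(\<Sum>l<d. v (swap_at d i s ps l 0)) - (\<Sum>l<d. v (swap_at d i s ps l i))
      = signed_sum {..<d} (\<lambda>l. v (ps l 0) - v (ps l i)) s"
    unfolding sum_subtractf[symmetric] signed_sum_def swap_at_def by (intro sum.cong) auto
  then show ?thesis unfolding perm_op_def by (simp add: algebra_simps)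
qed

text \<open>Each \<open>swap_at\<close> preserves the uniform law, so one may also average over a
  uniformly random \<open>s\<close>. For fixed \<open>ps\<close> the candidate set is the same for
  all \<open>s\<close>; picking one member v in advance is legitimate because the event speaks of
  all candidates, and the Littlewood-Offord inequality then bounds the average over
  \<open>s\<close>.\<close>

lemma unif_prob_row_pair_le:
  assumes i: "i < n" and \<eta>: "0 < \<eta>" "\<epsilon>' < \<eta> / 2" and N: "0 < N"
  shows "unif_prob (perm_tuples n d) (\<lambda>ps. null_candidates n d \<zeta> \<epsilon> \<eta> N i ps \<noteq> {}
      \<and> (\<forall>v\<in>null_candidates n d \<zeta> \<epsilon> \<eta> N i ps. cmod (perm_op d \<zeta> ps v 0 - perm_op d \<zeta> ps v i) \<le> \<epsilon>'))
    \<le> sqrt (2 / N)"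
proof -
  let ?C = "null_candidates n d \<zeta> \<epsilon> \<eta> N i"
  define F where "F = (\<lambda>ps. ?C ps \<noteq> {}
      \<and> (\<forall>v\<in>?C ps. cmod (perm_op d \<zeta> ps v 0 - perm_op d \<zeta> ps v i) \<le> \<epsilon>'))"
  let ?\<Omega> = "perm_tuples n d"
  have inner: "avg (Pow {..<d}) (\<lambda>s. of_bool (F (swap_at d i s ps))) \<le> sqrt (2 / N)" for ps
  proof (cases "?C ps = {}")
    case True
    then have "\<not> F (swap_at d i s ps)" for s unfolding F_def null_candidates_swap_at by simp
    then show ?thesis using N by (simp add: avg_def)
  next
    case False
    then obtain v where v: "v \<in> ?C ps" by blast
    define a where "a = (\<lambda>l. v (ps l 0) - v (ps l i))"
    have "N \<le> real (card {l\<in>{..<d}. \<eta> < cmod (a l)})"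
      using v unfolding null_candidates_def sep_count_def a_def by simp
    also have "\<dots> \<le> real (card {l\<in>{..<d}. \<eta> \<le> cmod (a l)})"
      by (intro of_nat_mono card_mono) auto
    finally have Na: "N \<le> real (card {l\<in>{..<d}. \<eta> \<le> cmod (a l)})" .
    have "(\<Sum>s\<in>Pow {..<d}. of_bool (F (swap_at d i s ps)) :: real) = card {s\<in>Pow {..<d}. F (swap_at d i s ps)}"
      by (simp add: Int_def)
    also have "\<dots> \<le> card {s\<in>Pow {..<d}. cmod (signed_sum {..<d} a s - \<zeta> * (v 0 - v i)) \<le> \<epsilon>'}"
    proof (intro of_nat_mono card_mono)
      show "{s\<in>Pow {..<d}. F (swap_at d i s ps)} \<subseteq> {s\<in>Pow {..<d}. cmod (signed_sum {..<d} a s - \<zeta> * (v 0 - v i)) \<le> \<epsilon>'}"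
        unfolding F_def null_candidates_swap_at perm_op_swap_at_diff a_def using v by auto
    qed simp
    also have "\<dots> \<le> 2 ^ card {..<d} * sqrt (2 / N)"
      by (rule littlewood_offord_complex) (use \<eta> N Na in auto)
    finally show ?thesis unfolding avg_def by (simp add: card_Pow field_simps)
  qed
  have re: "unif_prob ?\<Omega> F = avg ?\<Omega> (\<lambda>ps. of_bool (F (swap_at d i s ps)))" for s
    unfolding unif_prob_eq_avg[OF finite_perm_tuples]
    by (rule avg_reindex[OF bij_betw_swap_at[OF i], symmetric])
  have "unif_prob ?\<Omega> F = avg (Pow {..<d}) (\<lambda>s. unif_prob ?\<Omega> F)" by (rule avg_const[symmetric]) auto
  also have "\<dots> = avg (Pow {..<d}) (\<lambda>s. avg ?\<Omega> (\<lambda>ps. of_bool (F (swap_at d i s ps))))"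
    by (rule avg_cong) (rule re)
  also have "\<dots> = avg ?\<Omega> (\<lambda>ps. avg (Pow {..<d}) (\<lambda>s. of_bool (F (swap_at d i s ps))))"
    by (rule avg_commute)
  also have "\<dots> \<le> avg ?\<Omega> (\<lambda>ps. sqrt (2 / N))" by (intro avg_mono inner)
  also have "\<dots> = sqrt (2 / N)" by (rule avg_const) auto
  finally show ?thesis unfolding F_def .
qed

text \<open>The transpose of a permutation matrix belongs to the inverse permutation. The pairing is
  bilinear, without conjugation, so the transposed operator keeps the same
  \<open>\<zeta>\<close>.\<close>

lemma sum_mult_perm_op:
  assumes ps: "ps \<in> perm_tuples n d"
  shows "(\<Sum>j<n. u j * perm_op d \<zeta> ps v j) = (\<Sum>j<n. perm_op d \<zeta> (\<lambda>l. Hilbert_Choice.inv (ps l)) u j * v j)"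
proof -
  have "(\<Sum>j<n. u j * v (ps l j)) = (\<Sum>j<n. u (Hilbert_Choice.inv (ps l) j) * v j)" if l: "l < d" for l
  proof -
    have p: "ps l permutes {..<n}" using perm_tuplesD[OF ps l] .
    have "(\<Sum>j<n. u (Hilbert_Choice.inv (ps l) j) * v j) = (\<Sum>j<n. u (Hilbert_Choice.inv (ps l) (ps l j)) * v (ps l j))"
      by (rule sum.reindex_bij_betw[OF permutes_imp_bij[OF p], symmetric])
    then show ?thesis using permutes_inverses(2)[OF p] by simp
  qed
  then have "(\<Sum>l<d. \<Sum>j<n. u j * v (ps l j)) = (\<Sum>l<d. \<Sum>j<n. u (Hilbert_Choice.inv (ps l) j) * v j)"
    by (rule sum.cong[OF refl]) simp
  also have "\<dots> = (\<Sum>j<n. \<Sum>l<d. u (Hilbert_Choice.inv (ps l) j) * v j)" by (rule sum.swap)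
  finally have "(\<Sum>j<n. \<Sum>l<d. u j * v (ps l j)) = (\<Sum>j<n. \<Sum>l<d. u (Hilbert_Choice.inv (ps l) j) * v j)"
    by (rule trans[OF sum.swap])
  then show ?thesis
    unfolding perm_op_def right_diff_distrib left_diff_distrib sum_subtractf sum_distrib_left sum_distrib_right
    by (simp add: mult_ac)
qed

text \<open>The pairing of u with the image of v is small because u is nearly a left null vector,
  and the rows other than 0 and i contribute little because v is a candidate. Hence rows 0 and i
  contribute little as well.\<close>

lemma row_pair_diff_le:
  assumes ps: "ps \<in> perm_tuples n d" and i: "0 < i" "i < n"
    and u: "\<And>j. j < n \<Longrightarrow> cmod (u j) \<le> 1" "\<And>j. j < n \<Longrightarrow> cmod (perm_op d \<zeta> (\<lambda>l. Hilbert_Choice.inv (ps l)) u j) \<le> \<epsilon>"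
    and \<eta>: "0 < \<eta>" "\<eta> < cmod (u 0 - u i)" and v: "v \<in> null_candidates n d \<zeta> \<epsilon> \<eta>' N i ps"
  shows "cmod (perm_op d \<zeta> ps v 0 - perm_op d \<zeta> ps v i) \<le> 8 * real n * \<epsilon> / \<eta>"
proof -
  define m where "m = perm_op d \<zeta> ps v"
  have v1: "\<And>j. j < n \<Longrightarrow> cmod (v j) \<le> 1" and mj: "\<And>j. j < n \<Longrightarrow> j \<noteq> 0 \<Longrightarrow> j \<noteq> i \<Longrightarrow> cmod (m j) \<le> \<epsilon>"
    and m0i: "cmod (m 0 + m i) \<le> 2 * \<epsilon>"
    using v unfolding null_candidates_def m_def by auto
  have \<epsilon>0: "0 \<le> \<epsilon>" using m0i norm_ge_zero[of "m 0 + m i"] by linarith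
  define R where "R = {..<n} - {0, i}"
  have total: "cmod (\<Sum>j<n. u j * m j) \<le> n * \<epsilon>"
  proof -
    have "cmod (\<Sum>j<n. perm_op d \<zeta> (\<lambda>l. Hilbert_Choice.inv (ps l)) u j * v j) \<le> real (card {..<n}) * \<epsilon>"
    proof (rule sum_norm_bound)
      fix j assume "j \<in> {..<n}"
      then show "cmod (perm_op d \<zeta> (\<lambda>l. Hilbert_Choice.inv (ps l)) u j * v j) \<le> \<epsilon>"
        using mult_mono[OF u(2)[of j] v1[of j]] \<epsilon>0 by (simp add: norm_mult)
    qed
    then show ?thesis unfolding m_def sum_mult_perm_op[OF ps] by simp
  qed
  have rest: "cmod (\<Sum>j\<in>R. u j * m j) \<le> n * \<epsilon>"
  proof -
    have "cmod (\<Sum>j\<in>R. u j * m j) \<le> real (card R) * \<epsilon>"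
    proof (rule sum_norm_bound)
      fix j assume "j \<in> R"
      then show "cmod (u j * m j) \<le> \<epsilon>"
        using mult_mono[OF u(1)[of j] mj[of j]] \<epsilon>0 unfolding R_def by (simp add: norm_mult)
    qed
    also have "\<dots> \<le> n * \<epsilon>"
      using \<epsilon>0 card_mono[of "{..<n}" R] unfolding R_def by (intro mult_right_mono) auto
    finally show ?thesis .
  qed
  have mid: "cmod ((u 0 + u i) / 2 * (m 0 + m i)) \<le> 2 * \<epsilon>"
  proof -
    have "cmod ((u 0 + u i) / 2) \<le> 1"
      using norm_triangle_ineq[of "u 0" "u i"] u(1)[of 0] u(1)[of i] i by (simp add: norm_divide)
    then show ?thesis using mult_mono[OF _ m0i, of "cmod ((u 0 + u i) / 2)" 1] by (simp only: norm_mult) simp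
  qed
  have "(\<Sum>j<n. u j * m j) = (\<Sum>j\<in>R. u j * m j) + (\<Sum>j\<in>{0, i}. u j * m j)"
    unfolding R_def using i by (intro sum.subset_diff) auto
  \<comment> \<open>Symmetrising isolates the row difference with coefficient (u 0 - u i)/2; the sum
    of the two rows is small for every candidate.\<close>
  also have "(\<Sum>j\<in>{0, i}. u j * m j) = (u 0 + u i) / 2 * (m 0 + m i) + (u 0 - u i) / 2 * (m 0 - m i)"
    using i by (simp add: field_simps)
  finally have "(u 0 - u i) / 2 * (m 0 - m i)
      = (\<Sum>j<n. u j * m j) - (\<Sum>j\<in>R. u j * m j) - (u 0 + u i) / 2 * (m 0 + m i)" by simp
  then have "cmod ((u 0 - u i) / 2 * (m 0 - m i))
      = cmod ((\<Sum>j<n. u j * m j) - (\<Sum>j\<in>R. u j * m j) - (u 0 + u i) / 2 * (m 0 + m i))" by (rule arg_cong)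
  also have "\<dots> \<le> cmod ((\<Sum>j<n. u j * m j) - (\<Sum>j\<in>R. u j * m j)) + cmod ((u 0 + u i) / 2 * (m 0 + m i))"
    by (rule norm_triangle_ineq4)
  also have "\<dots> \<le> n * \<epsilon> + n * \<epsilon> + 2 * \<epsilon>"
    using total rest mid norm_triangle_ineq4[of "\<Sum>j<n. u j * m j" "\<Sum>j\<in>R. u j * m j"] by linarith
  also have "\<dots> \<le> 4 * real n * \<epsilon>"
  proof -
    have "1 * \<epsilon> \<le> n * \<epsilon>" using i \<epsilon>0 by (intro mult_right_mono) auto
    then show ?thesis by linarith
  qed
  finally have "cmod (u 0 - u i) * cmod (m 0 - m i) \<le> 8 * real n * \<epsilon>" unfolding norm_mult norm_divide by simp
  moreover have "\<eta> * cmod (m 0 - m i) \<le> cmod (u 0 - u i) * cmod (m 0 - m i)"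
    using \<eta> by (intro mult_right_mono) auto
  ultimately show ?thesis using \<eta>(1) unfolding m_def by (simp add: pos_le_divide_eq mult.commute)
qed

section \<open>Left approximate null vectors\<close>

lemma ex_sup_normalised:
  fixes w :: "nat \<Rightarrow> complex"
  assumes "i0 < n" "w i0 \<noteq> 0"
  obtains c where "0 < c" "cmod (w i0) \<le> c" "\<And>i. i < n \<Longrightarrow> cmod (w i / of_real c) \<le> 1"
    "\<exists>i<n. cmod (w i / of_real c) = 1"
proof
  define c where "c = Max ((\<lambda>i. cmod (w i)) ` {..<n})"
  have le: "cmod (w i) \<le> c" if "i < n" for i unfolding c_def using that by (intro Max_ge) auto
  show "cmod (w i0) \<le> c" using le assms by simp
  then show c: "0 < c" using assms by (smt (verit) zero_less_norm_iff)
  show "cmod (w i / of_real c) \<le> 1" if "i < n" for i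
    using le[OF that] c by (simp add: norm_divide)
  have "c \<in> (\<lambda>i. cmod (w i)) ` {..<n}" unfolding c_def using assms by (intro Max_in) auto
  then obtain i where "i < n" "cmod (w i) = c" by auto
  then show "\<exists>i<n. cmod (w i / of_real c) = 1" using c by (intro exI[of _ i]) (simp add: norm_divide)
qed

text \<open>If A has inverse B, then x i0 is row i0 of B applied to A x, so this row has an entry of
  modulus at least 1/(n \<open>\<epsilon>\<close>). The row times A is a unit vector, so normalising
  the row leaves a residual of at most n \<open>\<epsilon>\<close>. If A is singular, a kernel
  vector of the transpose serves.\<close>

lemma ex_left_approx_null:
  fixes A :: "nat \<Rightarrow> nat \<Rightarrow> complex"
  assumes x: "\<And>i. i < n \<Longrightarrow> cmod (\<Sum>j<n. A i j * x j) \<le> \<epsilon>" and i0: "i0 < n" "cmod (x i0) = 1" and "0 < \<epsilon>"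
  shows "\<exists>u. (\<forall>i<n. cmod (u i) \<le> 1) \<and> (\<exists>i<n. cmod (u i) = 1) \<and> (\<forall>j<n. cmod (\<Sum>i<n. u i * A i j) \<le> n * \<epsilon>)"
proof -
  define M where "M = Matrix.mat n n (\<lambda>(i, j). A i j)"
  have M: "M \<in> carrier_mat n n" unfolding M_def by simp
  have normalise: ?thesis if i1: "i1 < n" "w i1 \<noteq> 0" and small: "\<And>j. j < n \<Longrightarrow> cmod (\<Sum>i<n. w i * A i j) \<le> n * \<epsilon> * cmod (w i1)"
    for w i1
  proof -
    obtain c where c: "0 < c" "cmod (w i1) \<le> c" "\<And>i. i < n \<Longrightarrow> cmod (w i / of_real c) \<le> 1"
      "\<exists>i<n. cmod (w i / of_real c) = 1" using ex_sup_normalised[of i1 n w] i1 by blast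
    have "cmod (\<Sum>i<n. w i / of_real c * A i j) \<le> n * \<epsilon>" if j: "j < n" for j
    proof -
      have "(\<Sum>i<n. w i / of_real c * A i j) = (\<Sum>i<n. w i * A i j) / of_real c"
        by (simp add: sum_divide_distrib)
      then have "cmod (\<Sum>i<n. w i / of_real c * A i j) = cmod (\<Sum>i<n. w i * A i j) / c"
        using c by (simp add: norm_divide)
      also have "\<dots> \<le> n * \<epsilon> * cmod (w i1) / c" using small[OF j] c by (intro divide_right_mono) auto
      also have "\<dots> \<le> n * \<epsilon> * c / c" using c \<open>0 < \<epsilon>\<close> by (intro divide_right_mono mult_left_mono) auto
      finally show ?thesis using c by simp
    qed
    then show ?thesis using c(3,4) by (intro exI[of _ "\<lambda>i. w i / of_real c"]) blast
  qed
  show ?thesis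
  proof (cases "det M = 0")
    case True
    then have "det (transpose_mat M) = 0" using det_transpose[OF M] by simp
    then obtain v where v: "v \<in> carrier_vec n" "v \<noteq> 0\<^sub>v n" "transpose_mat M *\<^sub>v v = 0\<^sub>v n"
      using det_0_iff_vec_prod_zero_field[of "transpose_mat M" n] M by auto
    obtain i1 where i1: "i1 < n" "v $ i1 \<noteq> 0" using v by (metis carrier_vecD eq_vecI index_zero_vec)
    have "(\<Sum>i<n. v $ i * A i j) = 0" if j: "j < n" for j
    proof -
      have "(transpose_mat M *\<^sub>v v) $ j = (\<Sum>i<n. v $ i * A i j)"
        using v(1) j unfolding M_def by (simp add: scalar_prod_def lessThan_atLeast0 mult.commute)
      then show ?thesis using v j by simp
    qed
    then show ?thesis using normalise[of i1 "\<lambda>i. v $ i"] i1 \<open>0 < \<epsilon>\<close> by simp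
  next
    case False
    then have "M \<in> Units (ring_mat TYPE(complex) n ())" by (rule det_non_zero_imp_unit[OF M])
    then obtain B where B: "B \<in> carrier_mat n n" "B * M = 1\<^sub>m n"
      unfolding Units_def ring_mat_def by auto
    have BM: "(\<Sum>i<n. B $$ (i0, i) * A i j) = (if i0 = j then 1 else 0)" if "j < n" for j
    proof -
      have "(B * M) $$ (i0, j) = (\<Sum>i<n. B $$ (i0, i) * A i j)"
        using B(1) that i0(1) unfolding M_def by (simp add: scalar_prod_def lessThan_atLeast0)
      then show ?thesis using B that i0 by simp
    qed
    have "\<exists>i1<n. 1 \<le> n * \<epsilon> * cmod (B $$ (i0, i1))"
    proof (rule ccontr)
      assume "\<not> ?thesis"
      then have lt: "n * \<epsilon> * cmod (B $$ (i0, i)) < 1" if "i < n" for i using that by auto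
      have "x i0 = (\<Sum>j<n. (\<Sum>i<n. B $$ (i0, i) * A i j) * x j)"
        using BM i0 by (simp add: if_distrib[of "\<lambda>t. t * _"] cong: if_cong)
      also have "\<dots> = (\<Sum>j<n. \<Sum>i<n. B $$ (i0, i) * (A i j * x j))"
        by (simp add: sum_distrib_right mult.assoc)
      also have "\<dots> = (\<Sum>i<n. B $$ (i0, i) * (\<Sum>j<n. A i j * x j))"
        unfolding sum_distrib_left by (rule sum.swap)
      finally have "1 = cmod (\<Sum>i<n. B $$ (i0, i) * (\<Sum>j<n. A i j * x j))" using i0(2) by simp
      also have "\<dots> \<le> (\<Sum>i<n. cmod (B $$ (i0, i) * (\<Sum>j<n. A i j * x j)))" by (rule norm_sum)
      also have "\<dots> < (\<Sum>i<n. 1 / n)"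
      proof (rule sum_strict_mono)
        fix i assume i: "i \<in> {..<n}"
        have "cmod (B $$ (i0, i) * (\<Sum>j<n. A i j * x j)) \<le> cmod (B $$ (i0, i)) * \<epsilon>"
          unfolding norm_mult using x[of i] i by (intro mult_left_mono) auto
        also have "\<dots> < 1 / n" using lt[of i] i i0 by (simp add: field_simps)
        finally show "cmod (B $$ (i0, i) * (\<Sum>j<n. A i j * x j)) < 1 / n" .
      qed (use i0 in auto)
      finally show False using i0 by simp
    qed
    then obtain i1 where i1: "i1 < n" "1 \<le> n * \<epsilon> * cmod (B $$ (i0, i1))" by blast
    show ?thesis
    proof (rule normalise[of i1 "\<lambda>i. B $$ (i0, i)"])
      show "B $$ (i0, i1) \<noteq> 0" using i1 by auto
      show "cmod (\<Sum>i<n. B $$ (i0, i) * A i j) \<le> n * \<epsilon> * cmod (B $$ (i0, i1))" if "j < n" for j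
        using BM[OF that] i1(2) by (cases "i0 = j") auto
    qed (rule i1)
  qed
qed

section \<open>The dense regime\<close>

lemma ln_ge_1_of_ge_3: "3 \<le> x \<Longrightarrow> 1 \<le> ln (x::real)"
  using exp_le ln_ge_iff[of x 1] by simp

text \<open>After t steps an approximate null vector has at least \<kappa> t coordinates at distance more than
  \<eta> t from any given one. With T = O(log n / log m) steps \<kappa> reaches the net-size limit \<delta> n, and the
  row exchange needs \<epsilon> much smaller than \<eta> T ^ 2 / n, whence the exponent of \<epsilon>. The constants 300000 and
  10 ^ 17 make the probability gain in each union bound twice the logarithm of the size of the net.\<close>

locale dense_regime =
  fixes n d :: nat and \<zeta> :: complex
  assumes d_le: "d \<le> n ^ 100" and \<zeta>_le: "2 * cmod \<zeta> \<le> d"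
    and m_ge: "64 \<le> min d n" and m_large: "10 ^ 17 * ln n ^ 8 \<le> real (min d n)"
begin

definition m :: real where "m = real (min d n)"
definition \<Lambda> :: real where "\<Lambda> = ln n"
definition \<delta> :: real where "\<delta> = 1 / (300000 * \<Lambda>\<^sup>2)"
definition L :: real where "L = log m n"
text \<open>Growth by sqrt m per step reaches n after 2 L steps, because m ^ L = n.\<close>

definition T :: nat where "T = nat \<lceil>2 * L\<rceil>"
text \<open>102 = 100 + 2: one step loses a factor 64 d, where d \<le> n ^ 100 and 64 \<le> n ^ 2.
  The extra 1 gives \<open>\<eta> 0\<close> \<le> 1/64, needed to start.\<close>

definition \<eta> :: "nat \<Rightarrow> real" where "\<eta> t = 1 / real n ^ (102 * t + 1)"
definition \<kappa> :: "nat \<Rightarrow> real" where "\<kappa> t = min (sqrt m ^ t) (\<delta> * n)"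
text \<open>204 T + 5 = 2 (102 T + 1) + 3, so this is the square of \<open>\<eta> T\<close> divided
  by n ^ 3.\<close>

definition \<epsilon> :: real where "\<epsilon> = 1 / real n ^ (204 * T + 5)"

section \<open>Size relations between the parameters\<close>

lemma m64: "64 \<le> m" and m_le_n: "m \<le> n" and m_le_d: "m \<le> d" and n64: "64 \<le> real n" and d64: "64 \<le> real d"
  using m_ge unfolding m_def by auto

lemma \<Lambda>1: "1 \<le> \<Lambda>" unfolding \<Lambda>_def using n64 by (intro ln_ge_1_of_ge_3) simp

lemma \<Lambda>_power_mono: "i \<le> j \<Longrightarrow> \<Lambda> ^ i \<le> \<Lambda> ^ j" by (rule power_increasing[OF _ \<Lambda>1])

lemma m_\<Lambda>: "10 ^ 17 * \<Lambda> ^ 8 \<le> m" using m_large unfolding m_def \<Lambda>_def .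

text \<open>Of the factor m available in each step, one sqrt m pays for the logarithms in the net
  size and the other is the growth of \<open>\<kappa>\<close>.\<close>

lemma sqrt_m: "300000 * \<Lambda>\<^sup>2 \<le> sqrt m"
proof (rule real_le_rsqrt)
  have "(300000 * \<Lambda>\<^sup>2)\<^sup>2 = 300000 ^ 2 * \<Lambda> ^ 4" by (simp add: power_mult_distrib power_mult[symmetric])
  also have "\<dots> \<le> 10 ^ 17 * \<Lambda> ^ 8" using \<Lambda>_power_mono[of 4 8] by (intro mult_mono) auto
  finally show "(300000 * \<Lambda>\<^sup>2)\<^sup>2 \<le> m" using m_\<Lambda> by simp
qed

lemma \<delta>0: "0 < \<delta>" and \<delta>_le: "\<delta> \<le> 1/300000"
proof -
  have "1 \<le> \<Lambda>\<^sup>2" using \<Lambda>1 by (simp add: one_le_power)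
  then show "0 < \<delta>" "\<delta> \<le> 1/300000" unfolding \<delta>_def by (auto simp: divide_simps)
qed

lemma \<delta>n: "2 \<le> \<delta> * n"
proof -
  have "2 * (300000 * \<Lambda>\<^sup>2) \<le> 10 ^ 17 * \<Lambda> ^ 8" 
    using \<Lambda>_power_mono[of 2 8] by (simp add: mult_mono)
  also have "\<dots> \<le> n" using m_\<Lambda> m_le_n by simp
  finally show ?thesis unfolding \<delta>_def using \<Lambda>1 by (simp add: field_simps)
qed

lemma ln_m1: "1 \<le> ln m" using m64 by (intro ln_ge_1_of_ge_3) simp

lemma L1: "1 \<le> L" and L_le: "L \<le> \<Lambda>"
proof -
  have "ln m \<le> \<Lambda>" unfolding \<Lambda>_def using m64 m_le_n by simp
  then show "1 \<le> L" unfolding L_def log_def \<Lambda>_def[symmetric] using ln_m1 by simp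
  have "\<Lambda> * 1 \<le> \<Lambda> * ln m" using ln_m1 \<Lambda>1 by (intro mult_left_mono) auto
  then show "L \<le> \<Lambda>" unfolding L_def log_def \<Lambda>_def[symmetric] using ln_m1 by (simp add: divide_simps)
qed

lemma T_le: "real T \<le> 3 * L"
proof -
  have "real T = of_int \<lceil>2 * L\<rceil>" unfolding T_def using L1 by simp
  also have "\<dots> \<le> 2 * L + 1" by linarith
  finally show ?thesis using L1 by linarith
qed

lemma \<kappa>_T: "\<kappa> T = \<delta> * n"
proof -
  have "real n = m powr L" unfolding L_def using m64 n64 by (subst powr_log_cancel) auto
  also have "\<dots> \<le> m powr (T / 2)"
  proof (rule powr_mono)
    have "2 * L \<le> T" unfolding T_def using L1 by (simp add: le_of_int_ceiling)
    then show "L \<le> T / 2" by simp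
  qed (use m64 in simp)
  also have "\<dots> = sqrt m ^ T"
    using m64 by (simp add: powr_half_sqrt[symmetric] powr_realpow[symmetric] powr_powr)
  finally have "n \<le> sqrt m ^ T" .
  moreover have "\<delta> * n \<le> 1 * real n" using \<delta>_le by (intro mult_right_mono) auto
  ultimately show ?thesis unfolding \<kappa>_def by simp
qed

lemma \<kappa>_ge_1: "1 \<le> \<kappa> t"
  unfolding \<kappa>_def using \<delta>n m64 by (auto intro: one_le_power)

lemma \<kappa>_le: "\<kappa> t \<le> \<delta> * n" unfolding \<kappa>_def by simp

lemma \<kappa>_Suc: "\<kappa> (Suc t) \<le> sqrt m * \<kappa> t"
proof -
  have "1 \<le> sqrt m" using m64 by simp
  then have "1 * (\<delta> * n) \<le> sqrt m * (\<delta> * n)" using \<delta>n by (intro mult_right_mono) auto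
  then have "min (sqrt m * sqrt m ^ t) (\<delta> * n) \<le> min (sqrt m * sqrt m ^ t) (sqrt m * (\<delta> * n))"
    by (intro min.mono) auto
  also have "\<dots> = sqrt m * min (sqrt m ^ t) (\<delta> * n)" using m64 by (simp add: min_mult_distrib_left)
  finally show ?thesis unfolding \<kappa>_def by simp
qed

lemma \<eta>0: "0 < \<eta> t" unfolding \<eta>_def using n64 by simp

lemma \<eta>_le_1: "\<eta> t \<le> 1"
  unfolding \<eta>_def using n64 one_le_power[of "real n" "102 * t + 1"] by (simp del: power_Suc)

lemma \<eta>_Suc: "64 * d * \<eta> (Suc t) \<le> \<eta> t"
proof -
  have "64 * real d \<le> real n ^ 2 * real n ^ 100"
  proof (rule mult_mono)
    show "64 \<le> real n ^ 2" using n64 power_mono[of 64 "real n" 2] by simp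
    show "real d \<le> real n ^ 100" using d_le by (metis of_nat_le_iff of_nat_power)
  qed auto
  also have "\<dots> = real n ^ 102" by (simp add: power_add[symmetric])
  finally have "64 * real d \<le> real n ^ 102" .
  moreover have "\<eta> t = real n ^ 102 * \<eta> (Suc t)"
  proof -
    have "real n ^ (102 * Suc t + 1) = real n ^ 102 * real n ^ (102 * t + 1)"
      unfolding power_add[symmetric] by (rule arg_cong[where f = "(^) (real n)"]) simp
    then show ?thesis unfolding \<eta>_def using n64 by simp
  qed
  ultimately show ?thesis using \<eta>0[of "Suc t"] by (simp add: mult_right_mono)
qed

lemma \<epsilon>0: "0 < \<epsilon>" unfolding \<epsilon>_def using n64 by simp

lemma \<epsilon>_le_\<eta>: "t \<le> T \<Longrightarrow> \<epsilon> \<le> \<eta> t"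
  unfolding \<epsilon>_def \<eta>_def using n64 by (intro divide_left_mono power_increasing) auto

lemma \<epsilon>_small: "8 * real n * \<epsilon> / \<eta> T < \<eta> T / 2 / 2"
proof -
  have "\<eta> T * \<eta> T = real n ^ 3 * \<epsilon>"
  proof -
    have "real n ^ (204 * T + 5) = real n ^ 3 * (real n ^ (102 * T + 1) * real n ^ (102 * T + 1))"
      unfolding power_add[symmetric] by (rule arg_cong[where f = "(^) (real n)"]) simp
    then show ?thesis unfolding \<eta>_def \<epsilon>_def using n64 by simp
  qed
  moreover have "32 * real n < real n ^ 3"
  proof -
    have "32 * real n < real n ^ 2 * real n" using n64 power_mono[of 64 "real n" 2] by (intro mult_strict_right_mono) auto
    then show ?thesis by (simp add: power3_eq_cube power2_eq_square)
  qed
  ultimately have "32 * n * \<epsilon> < \<eta> T * \<eta> T" using \<epsilon>0 by simp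
  then show ?thesis using \<eta>0[of T] by (simp add: field_simps)
qed

text \<open>T \<le> 3 L and L \<le> \<open>\<Lambda>\<close> give 204 * 3 + 5 = 617.\<close>

lemma exponent_le: "t \<le> T \<Longrightarrow> (204 * real t + 5) * \<Lambda> \<le> 617 * \<Lambda>\<^sup>2"
proof -
  assume "t \<le> T"
  then have "204 * real t + 5 \<le> 617 * \<Lambda>" using T_le L_le L1 \<Lambda>1 by linarith
  then have "(204 * real t + 5) * \<Lambda> \<le> (617 * \<Lambda>) * \<Lambda>" using \<Lambda>1 by (intro mult_right_mono) auto
  then show ?thesis by (simp add: power2_eq_square)
qed

lemma n_power_eq_exp: "real n ^ k = exp (k * \<Lambda>)"
  unfolding \<Lambda>_def using n64 by (simp add: exp_of_nat_mult)

text \<open>The log of the net size is at most 3 * 617 = 1851 times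
  \<open>\<Lambda>\<^sup>2 * \<kappa> (Suc t)\<close>, just below 300000/160 = 1875 times it. The
  denominator 160 is twice the 80 of the small ball bound, so half of the gain survives.\<close>

lemma net_size_step:
  assumes t: "Suc t \<le> T" and k': "k' = nat \<lceil>\<kappa> (Suc t)\<rceil>" and k: "k = nat \<lceil>\<kappa> t\<rceil>"
  shows "(real n * (7 / \<eta> (Suc t))\<^sup>2) ^ (k' + 1) \<le> exp (min (real d * real k) (real n) / 160)"
proof -
  define e where "e = 204 * Suc t + 5"
  have "real n * (7 / \<eta> (Suc t))\<^sup>2 = 7 ^ 2 * real n ^ (204 * Suc t + 3)"
    unfolding \<eta>_def by (simp add: power_mult_distrib power_mult[symmetric] power_add[symmetric] power_Suc[symmetric] del: power_Suc)
  also have "\<dots> \<le> real n ^ 2 * real n ^ (204 * Suc t + 3)"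
    using n64 by (intro mult_right_mono power_mono) auto
  also have "\<dots> = exp (e * \<Lambda>)" unfolding n_power_eq_exp[symmetric] e_def by (simp add: power_add[symmetric])
  finally have "(real n * (7 / \<eta> (Suc t))\<^sup>2) ^ (k' + 1) \<le> exp (e * \<Lambda>) ^ (k' + 1)"
    by (intro power_mono) auto
  also have "\<dots> = exp (real (k' + 1) * (e * \<Lambda>))" by (rule exp_of_nat_mult[symmetric])
  also have "\<dots> \<le> exp (min (real d * real k) (real n) / 160)"
  proof -
    have k'le: "real (k' + 1) \<le> 3 * \<kappa> (Suc t)" unfolding k' using \<kappa>_ge_1[of "Suc t"] by linarith
    have "e * \<Lambda> \<le> 617 * \<Lambda>\<^sup>2" using exponent_le[OF t] unfolding e_def by simp
    then have "real (k' + 1) * (e * \<Lambda>) \<le> (3 * \<kappa> (Suc t)) * (617 * \<Lambda>\<^sup>2)"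
      using \<Lambda>1 \<kappa>_ge_1[of "Suc t"] by (intro mult_mono[OF k'le]) auto
    also have "\<dots> \<le> (300000 / 160) * \<Lambda>\<^sup>2 * \<kappa> (Suc t)"
      using \<kappa>_ge_1[of "Suc t"] by (simp add: mult_right_mono)
    finally have le: "real (k' + 1) * (e * \<Lambda>) \<le> (300000 * \<Lambda>\<^sup>2) * \<kappa> (Suc t) / 160" by (simp add: mult_ac)
    have "(300000 * \<Lambda>\<^sup>2) * \<kappa> (Suc t) \<le> sqrt m * (sqrt m * \<kappa> t)"
      using sqrt_m \<kappa>_Suc \<kappa>_ge_1[of "Suc t"] m64 by (intro mult_mono) auto
    also have "\<dots> = m * \<kappa> t" using m64 by (simp add: mult.assoc[symmetric])
    also have "\<dots> \<le> real d * real k"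
      unfolding k using m_le_d \<kappa>_ge_1[of t] by (intro mult_mono) (auto simp: real_nat_ceiling_ge)
    finally have 1: "(300000 * \<Lambda>\<^sup>2) * \<kappa> (Suc t) \<le> real d * real k" .
    have "(300000 * \<Lambda>\<^sup>2) * \<kappa> (Suc t) \<le> (300000 * \<Lambda>\<^sup>2) * (\<delta> * n)"
      using \<kappa>_le by (intro mult_left_mono) auto
    also have "\<dots> = n" unfolding \<delta>_def using \<Lambda>1 by simp
    finally have "(300000 * \<Lambda>\<^sup>2) * \<kappa> (Suc t) \<le> min (real d * real k) (real n)" using 1 by simp
    then show ?thesis using le unfolding exp_le_cancel_iff by linarith
  qed
  finally show ?thesis .
qed

section \<open>Spreading through all scales\<close>

definition near_null :: "(nat \<Rightarrow> nat \<Rightarrow> nat) \<Rightarrow> (nat \<Rightarrow> complex) \<Rightarrow> bool" where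
  "near_null ps x \<longleftrightarrow> (\<forall>i<n. cmod (x i) \<le> 1) \<and> (\<exists>i<n. cmod (x i) = 1) \<and> (\<forall>i<n. cmod (perm_op d \<zeta> ps x i) \<le> \<epsilon>)"

text \<open>If all coordinates were within 1/64 of x a, then |x a| \<ge> 1/2, and the row sum of
  modulus at least d/2 would force a residual of at least d/4 - d/64 in row a.\<close>

lemma near_null_not_constant:
  assumes ps: "ps \<in> perm_tuples n d" and x: "near_null ps x"
  shows "spread n (\<eta> 0) 1 x"
proof (rule ccontr)
  assume "\<not> spread n (\<eta> 0) 1 x"
  then obtain a where a: "a < n" "\<not> 1 \<le> real (card {b. b < n \<and> \<eta> 0 < cmod (x b - x a)})"
    unfolding spread_def by blast
  then have "card {b. b < n \<and> \<eta> 0 < cmod (x b - x a)} = 0" by linarith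
  then have none: "{b. b < n \<and> \<eta> 0 < cmod (x b - x a)} = {}" by (simp only: card_eq_0_iff) simp
  have close: "cmod (x b - x a) \<le> \<eta> 0" if "b < n" for b
  proof (rule ccontr)
    assume "\<not> ?thesis"
    then have "b \<in> {b. b < n \<and> \<eta> 0 < cmod (x b - x a)}" using that by simp
    then show False unfolding none by simp
  qed
  have \<eta>64: "\<eta> 0 \<le> 1/64" unfolding \<eta>_def using n64 by (simp add: field_simps)
  obtain j where j: "j < n" "cmod (x j) = 1" using x unfolding near_null_def by blast
  have "cmod (x a) \<ge> 1 - \<eta> 0" using norm_triangle_ineq2[of "x j" "x a"] close[OF j(1)] j by linarith
  then have xa: "cmod (x a) \<ge> 1/2" using \<eta>64 by linarith
  have psa: "ps l a < n" if "l < d" for l using permutes_in_image[OF perm_tuplesD[OF ps that], of a] a by simp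
  have "perm_op d \<zeta> ps x a = (of_nat d - \<zeta>) * x a + (\<Sum>l<d. x (ps l a) - x a)"
    unfolding perm_op_def by (simp add: sum_subtractf algebra_simps)
  then have "(of_nat d - \<zeta>) * x a = perm_op d \<zeta> ps x a - (\<Sum>l<d. x (ps l a) - x a)" by simp
  then have "cmod (of_nat d - \<zeta>) * cmod (x a) \<le> cmod (perm_op d \<zeta> ps x a) + cmod (\<Sum>l<d. x (ps l a) - x a)"
    using norm_triangle_ineq4 by (metis norm_mult)
  also have "cmod (perm_op d \<zeta> ps x a) \<le> \<epsilon>" using x a unfolding near_null_def by blast
  also have "\<epsilon> \<le> 1" using \<epsilon>_le_\<eta>[of 0] \<eta>_le_1[of 0] by simp
  also have "cmod (\<Sum>l<d. x (ps l a) - x a) \<le> real (card {..<d}) * (1/64)"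
    using close psa \<eta>64 by (intro sum_norm_bound) (meson lessThan_iff order_trans)
  finally have "cmod (of_nat d - \<zeta>) * cmod (x a) \<le> 1 + d / 64" by simp
  moreover have "(d / 2) * (1 / 2) \<le> cmod (of_nat d - \<zeta>) * cmod (x a)"
    using norm_triangle_ineq2[of "of_nat d" \<zeta>] \<zeta>_le xa by (intro mult_mono) auto
  ultimately show False using d64 by linarith
qed

text \<open>The failure probabilities of the single steps add up; the start is deterministic because
  \<open>\<kappa> 0\<close> \<le> 1.\<close>

lemma unif_prob_not_spread:
  "t \<le> T \<Longrightarrow> unif_prob (perm_tuples n d) (\<lambda>ps. \<exists>x. near_null ps x \<and> \<not> spread n (\<eta> t) (\<kappa> t) x)
    \<le> t * (161 * exp (- m / 160))"
proof (induction t)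
  case 0
  have "\<kappa> 0 \<le> 1" unfolding \<kappa>_def by simp
  then have "spread n (\<eta> 0) (\<kappa> 0) x" if "ps \<in> perm_tuples n d" "near_null ps x" for ps x
    using near_null_not_constant[OF that] unfolding spread_def by (meson order_trans)
  then have "unif_prob (perm_tuples n d) (\<lambda>ps. \<exists>x. near_null ps x \<and> \<not> spread n (\<eta> 0) (\<kappa> 0) x) = 0"
    unfolding unif_prob_def by (auto simp: card_eq_0_iff)
  then show ?case by simp
next
  case (Suc t)
  define k where "k = nat \<lceil>\<kappa> t\<rceil>"
  define k' where "k' = nat \<lceil>\<kappa> (Suc t)\<rceil>"
  have kreal: "\<kappa> t \<le> k" "real k \<le> \<kappa> t + 1" "\<kappa> (Suc t) \<le> k'" "real k' \<le> \<kappa> (Suc t) + 1"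
    unfolding k_def k'_def using \<kappa>_ge_1[of t] \<kappa>_ge_1[of "Suc t"] by linarith+
  have dn: "\<delta> * n \<le> n / 300000" using \<delta>_le mult_right_mono[of \<delta> "1/300000" "real n"] by simp
  have k1: "1 \<le> k" using kreal \<kappa>_ge_1[of t] by linarith
  have "64 * real k \<le> n" "8 * real k' \<le> n"
    using kreal \<kappa>_le[of t] \<kappa>_le[of "Suc t"] \<delta>n dn by linarith+
  then have kn: "64 * k \<le> n" "8 * k' \<le> n" by linarith+
  define A where "A = (\<lambda>ps. \<exists>x. near_null ps x \<and> \<not> spread n (\<eta> t) (\<kappa> t) x)"
  define B where "B = (\<lambda>ps. \<exists>x. (\<forall>i<n. cmod (x i) \<le> 1) \<and> (\<forall>i<n. cmod (perm_op d \<zeta> ps x i) \<le> \<epsilon>)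
      \<and> spread n (\<eta> t) (real k) x \<and> \<not> spread n (\<eta> (Suc t)) (\<kappa> (Suc t)) x)"
  \<comment> \<open>A cardinality that is at least \<open>\<kappa> t\<close> is at least its
    ceiling.\<close>
  have upg: "spread n (\<eta> t) (real k) x" if "spread n (\<eta> t) (\<kappa> t) x" for x
    using that unfolding spread_def k_def by (auto simp: ceiling_le_iff nat_le_iff)
  have "unif_prob (perm_tuples n d) (\<lambda>ps. \<exists>x. near_null ps x \<and> \<not> spread n (\<eta> (Suc t)) (\<kappa> (Suc t)) x)
      \<le> unif_prob (perm_tuples n d) (\<lambda>ps. A ps \<or> B ps)"
    using upg unfolding A_def B_def near_null_def by (intro unif_prob_mono) (simp, blast)
  also have "\<dots> \<le> unif_prob (perm_tuples n d) A + unif_prob (perm_tuples n d) B"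
    by (rule unif_prob_disj) simp
  also have "unif_prob (perm_tuples n d) A \<le> t * (161 * exp (- m / 160))"
    using Suc unfolding A_def by simp
  also have "unif_prob (perm_tuples n d) B \<le> 161 * exp (- m / 160)"
  proof -
    let ?q = "min (real d * real k) (real n)"
    have "unif_prob (perm_tuples n d) B \<le> (real n * (7 / \<eta> (Suc t))\<^sup>2) ^ (k' + 1) * (161 * exp (- ?q / 80))"
      unfolding B_def
    proof (rule unif_prob_spread_step)
      show "1 \<le> d" using d64 by simp
      show "cmod \<zeta> \<le> d" using \<zeta>_le norm_ge_zero[of \<zeta>] by linarith
      show "\<epsilon> \<le> \<eta> (Suc t)" using \<epsilon>_le_\<eta> Suc.prems by blast
    qed (use \<eta>0 \<eta>_Suc \<eta>_le_1 k1 kn kreal in auto)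
    also have "\<dots> \<le> exp (?q / 160) * (161 * exp (- ?q / 80))"
      using net_size_step[OF Suc.prems k'_def k_def] by (intro mult_right_mono) auto
    also have "\<dots> = 161 * exp (- ?q / 160)" by (simp add: exp_add[symmetric])
    also have "\<dots> \<le> 161 * exp (- m / 160)"
    proof -
      have "m * 1 \<le> real d * real k" using m_le_d k1 m64 by (intro mult_mono) auto
      then have "m \<le> ?q" using m_le_n by simp
      then show ?thesis by simp
    qed
    finally show ?thesis .
  qed
  finally show ?case by (simp add: algebra_simps)
qed

end

text \<open>Matrix entries are written as values of the operator on basis vectors, which makes
  \<open>ex_left_approx_null\<close> applicable to it.\<close>

lemma perm_op_of_bool_sum:
  assumes ps: "ps \<in> perm_tuples n d" and i: "i < n"
  shows "(\<Sum>j<n. perm_op d \<zeta> ps (\<lambda>k. of_bool (k = j)) i * x j) = perm_op d \<zeta> ps x i"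
proof -
  have psi: "ps l i < n" if "l < d" for l
    using permutes_in_image[OF perm_tuplesD[OF ps that], of i] i by simp
  have "(\<Sum>j<n. (\<Sum>l<d. of_bool (ps l i = j)) * x j) = (\<Sum>j<n. \<Sum>l<d. of_bool (ps l i = j) * x j)"
    by (simp only: sum_distrib_right)
  also have "\<dots> = (\<Sum>l<d. \<Sum>j<n. of_bool (ps l i = j) * x j)" by (rule sum.swap)
  also have "\<dots> = (\<Sum>l<d. x (ps l i))"
  proof (rule sum.cong[OF refl])
    fix l assume "l \<in> {..<d}"
    then show "(\<Sum>j<n. of_bool (ps l i = j) * x j) = x (ps l i)"
      using psi[of l] by (simp add: of_bool_def if_distrib[of "\<lambda>t. t * _"] cong: if_cong)
  qed
  finally have 1: "(\<Sum>j<n. (\<Sum>l<d. of_bool (ps l i = j)) * x j) = (\<Sum>l<d. x (ps l i))" .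
  have 2: "(\<Sum>j<n. \<zeta> * of_bool (i = j) * x j) = \<zeta> * x i"
    using i by (simp add: of_bool_def if_distrib[of "\<lambda>t. t * _"] if_distrib[of "\<lambda>t. _ * t"] cong: if_cong)
  show ?thesis unfolding perm_op_def left_diff_distrib sum_subtractf 1 2 ..
qed

lemma ex_left_near_null:
  assumes ps: "ps \<in> perm_tuples n d" and e: "0 < e"
    and x: "\<exists>i<n. cmod (x i) = 1" "\<And>i. i < n \<Longrightarrow> cmod (perm_op d \<zeta> ps x i) \<le> e"
  shows "\<exists>u. (\<forall>i<n. cmod (u i) \<le> 1) \<and> (\<exists>i<n. cmod (u i) = 1)
    \<and> (\<forall>j<n. cmod (perm_op d \<zeta> (\<lambda>l. Hilbert_Choice.inv (ps l)) u j) \<le> n * e)"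
proof -
  let ?A = "\<lambda>i j. perm_op d \<zeta> ps (\<lambda>k. of_bool (k = j)) i"
  obtain i0 where i0: "i0 < n" "cmod (x i0) = 1" using x by blast
  have "cmod (\<Sum>j<n. ?A i j * x j) \<le> e" if "i < n" for i
    unfolding perm_op_of_bool_sum[OF ps that] using x that by blast
  from ex_left_approx_null[of n ?A x, OF this i0 e]
  obtain u where u: "\<forall>i<n. cmod (u i) \<le> 1" "\<exists>i<n. cmod (u i) = 1"
    "\<forall>j<n. cmod (\<Sum>i<n. u i * ?A i j) \<le> n * e" by blast
  have "(\<Sum>i<n. u i * ?A i j) = perm_op d \<zeta> (\<lambda>l. Hilbert_Choice.inv (ps l)) u j" if "j < n" for j
    unfolding sum_mult_perm_op[OF ps] using that
    by (simp add: of_bool_def if_distrib[of "\<lambda>t. _ * t"] cong: if_cong)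
  then show ?thesis using u by auto
qed

section \<open>The row exchange in the dense regime\<close>

context dense_regime
begin

definition K :: nat where "K = nat \<lfloor>\<delta> * n\<rfloor>"
text \<open>Half of \<open>K\<close>: small enough for the reserve in
  \<open>unif_prob_discrepancy\<close>, and discarding fewer than \<open>b\<close> of
  \<open>K\<close> rows keeps at least half of them.\<close>

definition b :: nat where "b = K div 2"
definition \<theta> :: real where "\<theta> = K / (2 * n)"

lemma K_bounds: "real K \<le> \<delta> * n" "\<delta> * n / 2 \<le> K" "2 \<le> K" "K \<le> n"
proof -
  show 1: "real K \<le> \<delta> * n" unfolding K_def using \<delta>n by linarith
  show "\<delta> * n / 2 \<le> K" unfolding K_def using \<delta>n by linarith
  have "\<delta> * n \<le> 1 * real n" using \<delta>_le by (intro mult_right_mono) auto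
  then show "K \<le> n" using 1 by linarith
  show "2 \<le> K" unfolding K_def using \<delta>n by linarith
qed

lemma \<theta>_ge: "\<delta> / 4 \<le> \<theta>"
  unfolding \<theta>_def using K_bounds(2) n64 by (simp add: field_simps)

lemma b_ge: "\<delta> * n / 8 \<le> b"
proof -
  have "K \<le> 4 * b" unfolding b_def using K_bounds(3) by linarith
  then show ?thesis using K_bounds(2) by linarith
qed

lemma unif_prob_discrepancy_le:
  "unif_prob (perm_tuples n d) (\<lambda>ps. \<exists>x. (\<forall>i<n. cmod (x i) \<le> 1) \<and> spread n (\<eta> T) (\<kappa> T) x
      \<and> b \<le> card {i. 0 < i \<and> i < n \<and> real (sep_count d (\<eta> T / 2) ps x i) \<le> \<theta> * d / 4})
    \<le> 1 / sqrt m"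
proof -
  have "unif_prob (perm_tuples n d) (\<lambda>ps. \<exists>x. (\<forall>i<n. cmod (x i) \<le> 1) \<and> spread n (\<eta> T) (\<kappa> T) x
      \<and> b \<le> card {i. 0 < i \<and> i < n \<and> real (sep_count d (\<eta> T / 2) ps x i) \<le> \<theta> * d / 4})
    \<le> (2 * (112 / \<eta> T)\<^sup>2) ^ n * exp (- (\<theta> * b * d / 4))"
  proof (rule unif_prob_discrepancy)
    show "0 < n" using n64 by simp
    show "2 * b \<le> K" unfolding b_def by simp
    show "real K \<le> \<kappa> T" unfolding \<kappa>_T by (rule K_bounds)
  qed (use \<eta>0 \<eta>_le_1 K_bounds \<theta>_def in auto)
  also have "(2 * (112 / \<eta> T)\<^sup>2) ^ n \<le> exp (617 * \<Lambda>\<^sup>2 * n)"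
  proof -
    have "2 * (112 / \<eta> T)\<^sup>2 = 25088 * (real n ^ (102 * T + 1))\<^sup>2"
      unfolding \<eta>_def by (simp add: power_mult_distrib del: power_Suc)
    also have "\<dots> \<le> real n ^ 3 * (real n ^ (102 * T + 1))\<^sup>2"
      using power_mono[OF n64, of 3] by (intro mult_right_mono) auto
    also have "\<dots> = real n ^ (204 * T + 5)"
      unfolding power_mult[symmetric] power_add[symmetric] by (rule arg_cong[where f = "(^) (real n)"]) simp
    also have "\<dots> = exp ((204 * T + 5) * \<Lambda>)" unfolding n_power_eq_exp by simp
    also have "\<dots> \<le> exp (617 * \<Lambda>\<^sup>2)" using exponent_le[of T] by simp
    finally have "(2 * (112 / \<eta> T)\<^sup>2) ^ n \<le> exp (617 * \<Lambda>\<^sup>2) ^ n" by (intro power_mono) auto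
    also have "\<dots> = exp (617 * \<Lambda>\<^sup>2 * n)" by (simp add: exp_of_nat_mult[symmetric] mult.commute)
    finally show ?thesis .
  qed
  also have "exp (617 * \<Lambda>\<^sup>2 * n) * exp (- (\<theta> * b * d / 4)) \<le> exp (- real n)"
  proof -
    \<comment> \<open>The gain is at least \<open>\<delta>\<close> squared times d n / 128. It is
      twice the net exponent once d \<ge> 1234 * 128 * 300000^2 times \<open>\<Lambda> ^ 6\<close>;
      this constant is about 1.4 * 10^16, whence 10^17.\<close>
    have "1234 * \<Lambda>\<^sup>2 * n \<le> \<theta> * b * d / 4"
    proof -
      have "1234 * 128 * (300000 * 300000) * \<Lambda> ^ 6 \<le> 10 ^ 17 * \<Lambda> ^ 8"
        using \<Lambda>_power_mono[of 6 8] \<Lambda>1 by (intro mult_mono) auto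
      also have "\<dots> \<le> d" using m_\<Lambda> m_le_d by simp
      finally have "1234 * 128 * (300000 * 300000) * \<Lambda> ^ 6 \<le> d" .
      then have "(1234 * 128 * (300000 * 300000) * \<Lambda> ^ 6) * (\<delta> * \<delta>) \<le> d * (\<delta> * \<delta>)"
        using \<delta>0 by (intro mult_right_mono) auto
      moreover have "(1234 * 128 * (300000 * 300000) * \<Lambda> ^ 6) * (\<delta> * \<delta>) = 1234 * 128 * \<Lambda>\<^sup>2"
      proof -
        define D where "D = \<Lambda>\<^sup>2"
        have "\<Lambda> ^ 6 = D * (D * D)" "D \<noteq> 0" unfolding D_def using \<Lambda>1 by (auto simp: power_add[symmetric])
        then show ?thesis unfolding \<delta>_def D_def[symmetric] by simp
      qed
      moreover have "(\<delta> / 4) * (\<delta> / 8) * d / 4 = d * (\<delta> * \<delta>) / 128" by simp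
      ultimately have "1234 * \<Lambda>\<^sup>2 \<le> (\<delta> / 4) * (\<delta> / 8) * d / 4" by linarith
      then have "1234 * \<Lambda>\<^sup>2 * n \<le> ((\<delta> / 4) * (\<delta> / 8) * d / 4) * n" by (intro mult_right_mono) auto
      also have "\<dots> = (\<delta> / 4) * (\<delta> * n / 8) * (d / 4)" by simp
      also have "\<dots> \<le> \<theta> * b * (d / 4)"
        using \<theta>_ge b_ge \<delta>0 by (intro mult_right_mono mult_mono) auto
      finally show ?thesis by simp
    qed
    moreover have "1 * real n \<le> 617 * \<Lambda>\<^sup>2 * n"
      using one_le_power[OF \<Lambda>1, of 2] by (intro mult_right_mono) auto
    ultimately show ?thesis unfolding exp_add[symmetric] by simp
  qed
  also have "\<dots> \<le> 1 / sqrt m"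
  proof -
    have "sqrt m \<le> sqrt (m * m)" using m64 by (intro real_sqrt_le_mono) simp
    then have "sqrt m \<le> m" using m64 by simp
    also have "\<dots> \<le> exp (real n)" using m_le_n exp_ge_add_one_self[of "real n"] by linarith
    finally show ?thesis using m64 by (simp add: exp_minus field_simps)
  qed
  finally show ?thesis by (simp add: mult_right_mono)
qed

definition row_pair_event :: "nat \<Rightarrow> (nat \<Rightarrow> nat \<Rightarrow> nat) \<Rightarrow> bool" where
  "row_pair_event i ps \<longleftrightarrow> null_candidates n d \<zeta> \<epsilon> (\<eta> T / 2) (\<theta> * d / 4) i ps \<noteq> {}
      \<and> (\<forall>v\<in>null_candidates n d \<zeta> \<epsilon> (\<eta> T / 2) (\<theta> * d / 4) i ps.
           cmod (perm_op d \<zeta> ps v 0 - perm_op d \<zeta> ps v i) \<le> 8 * real n * \<epsilon> / \<eta> T)"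

text \<open>At least \<open>K\<close> rows have u i far from u 0, and fewer than \<open>b\<close> of
  them lack separating permutations. For each remaining row, x shows that candidates exist and u
  controls all of them.\<close>

lemma many_row_pair_events:
  assumes ps: "ps \<in> perm_tuples n d" and x: "near_null ps x" and u: "near_null (\<lambda>l. Hilbert_Choice.inv (ps l)) u"
    and su: "spread n (\<eta> T) (\<kappa> T) u"
    and disc: "card {i. 0 < i \<and> i < n \<and> real (sep_count d (\<eta> T / 2) ps x i) \<le> \<theta> * d / 4} < b"
  shows "K \<le> 2 * card {i\<in>{1..<n}. row_pair_event i ps}"
proof -
  let ?B = "{i. 0 < i \<and> i < n \<and> real (sep_count d (\<eta> T / 2) ps x i) \<le> \<theta> * d / 4}"
  let ?U = "{i. i < n \<and> \<eta> T < cmod (u i - u 0)}"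
  have "real K \<le> real (card ?U)"
    using su K_bounds(1) n64 unfolding spread_def \<kappa>_T by fastforce
  then have KU: "K \<le> card ?U" by simp
  have "?U - ?B \<subseteq> {i\<in>{1..<n}. row_pair_event i ps}"
  proof
    fix i assume i: "i \<in> ?U - ?B"
    have "i \<noteq> 0"
    proof
      assume "i = 0"
      then show False using i \<eta>0[of T] by simp
    qed
    then have i0: "0 < i" "i < n" using i by auto
    have sep: "\<theta> * d / 4 < real (sep_count d (\<eta> T / 2) ps x i)" using i i0 by auto
    have e: "cmod (perm_op d \<zeta> ps x j) \<le> \<epsilon>" if "j < n" for j using x that unfolding near_null_def by blast
    have "cmod (perm_op d \<zeta> ps x 0 + perm_op d \<zeta> ps x i) \<le> 2 * \<epsilon>"
      using norm_triangle_ineq[of "perm_op d \<zeta> ps x 0" "perm_op d \<zeta> ps x i"] e[of 0] e[of i] i0 by simp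
    then have "x \<in> null_candidates n d \<zeta> \<epsilon> (\<eta> T / 2) (\<theta> * d / 4) i ps"
      using x sep e unfolding null_candidates_def near_null_def by simp
    moreover have "cmod (perm_op d \<zeta> ps v 0 - perm_op d \<zeta> ps v i) \<le> 8 * real n * \<epsilon> / \<eta> T"
      if "v \<in> null_candidates n d \<zeta> \<epsilon> (\<eta> T / 2) (\<theta> * d / 4) i ps" for v
    proof (rule row_pair_diff_le[OF ps i0 _ _ \<eta>0 _ that])
      show "cmod (u j) \<le> 1" "cmod (perm_op d \<zeta> (\<lambda>l. Hilbert_Choice.inv (ps l)) u j) \<le> \<epsilon>" if "j < n" for j
        using u that unfolding near_null_def by blast+
      show "\<eta> T < cmod (u 0 - u i)" using i by (simp add: norm_minus_commute)
    qed
    ultimately show "i \<in> {i\<in>{1..<n}. row_pair_event i ps}" unfolding row_pair_event_def using i0 by auto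
  qed
  then have "card (?U - ?B) \<le> card {i\<in>{1..<n}. row_pair_event i ps}" by (intro card_mono) auto
  moreover have "card ?U - card ?B \<le> card (?U - ?B)" by (rule diff_card_le_card_Diff) simp
  ultimately show ?thesis using KU disc unfolding b_def by linarith
qed

lemma unif_prob_row_pair_event:
  assumes "i < n" shows "unif_prob (perm_tuples n d) (row_pair_event i) \<le> sqrt (2 / (\<theta> * d / 4))"
proof -
  have "0 < \<theta> * d / 4" using \<theta>_ge \<delta>0 d64 by simp
  then show ?thesis unfolding row_pair_event_def
    by (intro unif_prob_row_pair_le assms \<epsilon>_small) (use \<eta>0 in auto)
qed

text \<open>Markov's inequality: the expected number of events is of order n
  \<open>\<Lambda>\<close> / sqrt m, and division by K/2, of order n /
  \<open>\<Lambda>\<^sup>2\<close>, leaves the third power of \<open>\<Lambda>\<close>.\<close>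

lemma unif_prob_many_row_pair_events:
  "unif_prob (perm_tuples n d) (\<lambda>ps. K \<le> 2 * card {i\<in>{1..<n}. row_pair_event i ps})
    \<le> 10 ^ 10 * \<Lambda> ^ 4 / sqrt m"
proof -
  let ?\<Omega> = "perm_tuples n d" and ?s = "sqrt (2 / (\<theta> * d / 4))"
  have K0: "0 < real K" using K_bounds(3) by simp
  have "real K * unif_prob ?\<Omega> (\<lambda>ps. K \<le> 2 * card {i\<in>{1..<n}. row_pair_event i ps})
      = avg ?\<Omega> (\<lambda>ps. real K * of_bool (K \<le> 2 * card {i\<in>{1..<n}. row_pair_event i ps}))"
    unfolding unif_prob_eq_avg[OF finite_perm_tuples] avg_cmult ..
  also have "\<dots> \<le> avg ?\<Omega> (\<lambda>ps. 2 * (\<Sum>i\<in>{1..<n}. of_bool (row_pair_event i ps)))"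
  proof (rule avg_mono)
    fix ps
    have "(\<Sum>i\<in>{1..<n}. of_bool (row_pair_event i ps) :: real) = card {i\<in>{1..<n}. row_pair_event i ps}"
      by (simp add: Int_def)
    then show "real K * of_bool (K \<le> 2 * card {i\<in>{1..<n}. row_pair_event i ps})
        \<le> 2 * (\<Sum>i\<in>{1..<n}. of_bool (row_pair_event i ps) :: real)" by auto
  qed
  also have "\<dots> = 2 * (\<Sum>i\<in>{1..<n}. unif_prob ?\<Omega> (row_pair_event i))"
    unfolding avg_cmult avg_sum unif_prob_eq_avg[OF finite_perm_tuples] ..
  also have "\<dots> \<le> 2 * (\<Sum>i\<in>{1..<n}. ?s)"
    by (intro mult_left_mono sum_mono unif_prob_row_pair_event) auto
  also have "\<dots> \<le> 2 * (n * ?s)"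
    using \<theta>_ge \<delta>0 by (simp add: mult_right_mono)
  finally have "unif_prob ?\<Omega> (\<lambda>ps. K \<le> 2 * card {i\<in>{1..<n}. row_pair_event i ps}) \<le> 2 * (n * ?s) / K"
    using K0 by (simp add: pos_le_divide_eq mult.commute)
  also have "\<dots> = (2 * n / K) * ?s" by simp
  also have "\<dots> \<le> (4 / \<delta>) * ?s"
  proof (rule mult_right_mono)
    show "2 * n / K \<le> 4 / \<delta>" using K_bounds(2) K0 \<delta>0 by (simp add: field_simps)
    show "0 \<le> ?s" using \<theta>_ge \<delta>0 by simp
  qed
  also have "\<dots> \<le> (4 / \<delta>) * (6000 * \<Lambda> / sqrt m)"
  proof (rule mult_left_mono)
    have "\<delta> / 4 * m / 4 \<le> \<theta> * d / 4" using \<theta>_ge m_le_d \<delta>0 m64 by (intro divide_right_mono mult_mono) auto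
    then have "2 / (\<theta> * d / 4) \<le> 2 / (\<delta> / 4 * m / 4)"
      using \<delta>0 m64 \<theta>_ge d64 by (intro divide_left_mono) auto
    also have "\<dots> = 9600000 * \<Lambda>\<^sup>2 / m" unfolding \<delta>_def by simp
    also have "\<dots> \<le> (6000 * \<Lambda>)\<^sup>2 / m" using m64 by (intro divide_right_mono) (auto simp: power_mult_distrib)
    finally have "?s \<le> sqrt ((6000 * \<Lambda>)\<^sup>2 / m)" by (rule real_sqrt_le_mono)
    also have "\<dots> = 6000 * \<Lambda> / sqrt m" unfolding real_sqrt_divide real_sqrt_abs using \<Lambda>1 by simp
    finally show "?s \<le> 6000 * \<Lambda> / sqrt m" .
  qed (use \<delta>0 in auto)
  also have "\<dots> = 7200000000 * \<Lambda> ^ 3 / sqrt m"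
    unfolding \<delta>_def by (simp add: power3_eq_cube power2_eq_square)
  also have "\<dots> \<le> 10 ^ 10 * \<Lambda> ^ 4 / sqrt m"
    using \<Lambda>_power_mono[of 3 4] \<Lambda>1 m64 by (intro divide_right_mono mult_mono) auto
  finally show ?thesis .
qed

text \<open>The residual is a factor n smaller than in \<open>near_null\<close> because passing to
  the left vector loses n.\<close>

lemma unif_prob_near_null:
  "unif_prob (perm_tuples n d) (\<lambda>ps. \<exists>x. (\<forall>i<n. cmod (x i) \<le> 1) \<and> (\<exists>i<n. cmod (x i) = 1)
      \<and> (\<forall>i<n. cmod (perm_op d \<zeta> ps x i) \<le> \<epsilon> / n)) \<le> 10 ^ 11 * \<Lambda> ^ 4 / sqrt m"
proof -
  let ?\<Omega> = "perm_tuples n d"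
  define E1 where "E1 = (\<lambda>ps. \<exists>x. near_null ps x \<and> \<not> spread n (\<eta> T) (\<kappa> T) x)"
  define E2 where "E2 = (\<lambda>ps. E1 (\<lambda>l. Hilbert_Choice.inv (ps l)))"
  define E3 where "E3 = (\<lambda>ps. \<exists>x. (\<forall>i<n. cmod (x i) \<le> 1) \<and> spread n (\<eta> T) (\<kappa> T) x
      \<and> b \<le> card {i. 0 < i \<and> i < n \<and> real (sep_count d (\<eta> T / 2) ps x i) \<le> \<theta> * d / 4})"
  define E4 where "E4 = (\<lambda>ps. K \<le> 2 * card {i\<in>{1..<n}. row_pair_event i ps})"
  have "unif_prob ?\<Omega> (\<lambda>ps. \<exists>x. (\<forall>i<n. cmod (x i) \<le> 1) \<and> (\<exists>i<n. cmod (x i) = 1)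
      \<and> (\<forall>i<n. cmod (perm_op d \<zeta> ps x i) \<le> \<epsilon> / n)) \<le> unif_prob ?\<Omega> (\<lambda>ps. (E1 ps \<or> E2 ps) \<or> (E3 ps \<or> E4 ps))"
  proof (rule unif_prob_mono)
    fix ps assume ps: "ps \<in> ?\<Omega>"
    assume "\<exists>x. (\<forall>i<n. cmod (x i) \<le> 1) \<and> (\<exists>i<n. cmod (x i) = 1) \<and> (\<forall>i<n. cmod (perm_op d \<zeta> ps x i) \<le> \<epsilon> / n)"
    then obtain x where x: "\<forall>i<n. cmod (x i) \<le> 1" "\<exists>i<n. cmod (x i) = 1"
      and px: "\<And>i. i < n \<Longrightarrow> cmod (perm_op d \<zeta> ps x i) \<le> \<epsilon> / n" by blast
    have "\<epsilon> / n \<le> \<epsilon>" using \<epsilon>0 n64 by (simp add: field_simps)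
    then have nx: "near_null ps x" unfolding near_null_def using x px order_trans by blast
    have "0 < \<epsilon> / n" using \<epsilon>0 n64 by simp
    from ex_left_near_null[OF ps this x(2) px]
    obtain u where nu: "near_null (\<lambda>l. Hilbert_Choice.inv (ps l)) u" unfolding near_null_def using n64 by auto
    show "(E1 ps \<or> E2 ps) \<or> (E3 ps \<or> E4 ps)"
    proof (rule ccontr)
      assume no: "\<not> ?thesis"
      have sx: "spread n (\<eta> T) (\<kappa> T) x" using no nx unfolding E1_def by blast
      have su: "spread n (\<eta> T) (\<kappa> T) u" using no nu unfolding E1_def E2_def by blast
      have "card {i. 0 < i \<and> i < n \<and> real (sep_count d (\<eta> T / 2) ps x i) \<le> \<theta> * d / 4} < b"
      proof (rule ccontr)
        assume "\<not> ?thesis"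
        then have "E3 ps" unfolding E3_def not_less using sx x(1) by blast
        then show False using no by blast
      qed
      from many_row_pair_events[OF ps nx nu su this] show False using no unfolding E4_def by blast
    qed
  qed simp
  also have "\<dots> \<le> (unif_prob ?\<Omega> E1 + unif_prob ?\<Omega> E2) + (unif_prob ?\<Omega> E3 + unif_prob ?\<Omega> E4)"
    using unif_prob_disj[of ?\<Omega> E1 E2] unif_prob_disj[of ?\<Omega> E3 E4]
      unif_prob_disj[of ?\<Omega> "\<lambda>ps. E1 ps \<or> E2 ps" "\<lambda>ps. E3 ps \<or> E4 ps"] by simp
  also have "unif_prob ?\<Omega> E2 = unif_prob ?\<Omega> E1"
    unfolding E2_def by (rule unif_prob_reindex) (auto intro: bij_betw_perm_tuples_inv)
  also have "unif_prob ?\<Omega> E3 \<le> 1 / sqrt m" unfolding E3_def by (rule unif_prob_discrepancy_le)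
  also have "unif_prob ?\<Omega> E4 \<le> 10 ^ 10 * \<Lambda> ^ 4 / sqrt m"
    unfolding E4_def by (rule unif_prob_many_row_pair_events)
  \<comment> \<open>77280 = 3 * 161 * 160, the last factor from exp(-m/160) \<le> 160 / sqrt
    m.\<close>
  also have "unif_prob ?\<Omega> E1 \<le> 77280 * \<Lambda> ^ 4 / sqrt m"
  proof -
    have "unif_prob ?\<Omega> E1 \<le> T * (161 * exp (- m / 160))"
      unfolding E1_def by (rule unif_prob_not_spread) simp
    also have "\<dots> \<le> (3 * \<Lambda> ^ 4) * (161 * (160 / sqrt m))"
    proof (intro mult_mono)
      show "real T \<le> 3 * \<Lambda> ^ 4" using T_le L_le \<Lambda>_power_mono[of 1 4] by simp
      have "sqrt m \<le> sqrt (m * m)" using m64 by (intro real_sqrt_le_mono) simp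
      then have "sqrt m \<le> m" using m64 by simp
      also have "\<dots> \<le> 160 * exp (m / 160)" using exp_ge_add_one_self[of "m / 160"] by linarith
      finally show "exp (- m / 160) \<le> 160 / sqrt m" using m64 by (simp add: exp_minus field_simps)
    qed (use \<Lambda>1 in auto)
    finally show ?thesis by simp
  qed
  also have "77280 * \<Lambda> ^ 4 / sqrt m + 77280 * \<Lambda> ^ 4 / sqrt m + (1 / sqrt m + 10 ^ 10 * \<Lambda> ^ 4 / sqrt m)
      \<le> 10 ^ 11 * \<Lambda> ^ 4 / sqrt m"
  proof -
    have "1 \<le> \<Lambda> ^ 4" using \<Lambda>1 by (rule one_le_power)
    then have "77280 * \<Lambda> ^ 4 + 77280 * \<Lambda> ^ 4 + (1 + 10 ^ 10 * \<Lambda> ^ 4) \<le> 10 ^ 11 * \<Lambda> ^ 4" by simp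
    then have "(77280 * \<Lambda> ^ 4 + 77280 * \<Lambda> ^ 4 + (1 + 10 ^ 10 * \<Lambda> ^ 4)) / sqrt m \<le> 10 ^ 11 * \<Lambda> ^ 4 / sqrt m"
      using m64 by (intro divide_right_mono) auto
    then show ?thesis by (simp add: add_divide_distrib)
  qed
  finally show ?thesis by simp
qed

text \<open>The losses are n ^ 50 for sqrt d, n for scaling a coordinate of size at least 1/n up to
  sup norm 1, and n for the factor 2. With the exponent 204 T + 6 of \<open>\<epsilon> / n\<close>
  this totals 204 T + 58 \<le> 670 L.\<close>

lemma ex_near_null_of_small_sv:
  fixes A :: "nat \<Rightarrow> nat \<Rightarrow> complex"
  assumes A: "\<And>x i. i < n \<Longrightarrow> mat_vec n A x i = perm_op d \<zeta> ps x i / of_real (sqrt d)"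
    and sv: "smallest_sv n A \<le> real n powr (- 700 * L)"
  shows "\<exists>x. (\<forall>i<n. cmod (x i) \<le> 1) \<and> (\<exists>i<n. cmod (x i) = 1)
      \<and> (\<forall>i<n. cmod (perm_op d \<zeta> ps x i) \<le> \<epsilon> / n)"
proof -
  define r where "r = real n powr (- 700 * L)"
  have n0: "0 < n" using n64 by simp
  have r0: "0 < r" unfolding r_def using n64 by simp
  let ?X = "{vnorm n (mat_vec n A x) | x. vnorm n x = 1}"
  have "(\<Sum>i<n. (cmod (of_bool (i = 0)))\<^sup>2) = (\<Sum>i\<in>{0::nat}. (cmod (of_bool (i = 0)))\<^sup>2)"
    using n0 by (intro sum.mono_neutral_right) auto
  then have "vnorm n (\<lambda>i. of_bool (i = 0)) = 1" unfolding vnorm_def by simp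
  then have "?X \<noteq> {}" by blast
  \<comment> \<open>The factor 2 gives a vector without attainment of the infimum.\<close>
  moreover have "Inf ?X < 2 * r" using sv r0 unfolding smallest_sv_def r_def[symmetric] by linarith
  ultimately obtain x where x: "vnorm n x = 1" "vnorm n (mat_vec n A x) < 2 * r"
    using cInf_lessD[of ?X "2 * r"] by blast
  have comp: "cmod (y i) \<le> vnorm n y" if "i < n" for y i
    unfolding vnorm_def using that by (intro real_le_rsqrt member_le_sum) auto
  have small: "cmod (perm_op d \<zeta> ps x i) \<le> 2 * r * real n ^ 50" if i: "i < n" for i
  proof -
    have d: "sqrt d \<le> real n ^ 50"
    proof (rule real_le_lsqrt)
      have "real d \<le> real n ^ 100" using d_le by (metis of_nat_le_iff of_nat_power)
      then show "real d \<le> (real n ^ 50)\<^sup>2" by (simp add: power_mult[symmetric])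
    qed auto
    have "cmod (perm_op d \<zeta> ps x i) = cmod (mat_vec n A x i) * sqrt d"
      unfolding A[OF i] using d64 by (simp add: norm_divide)
    also have "\<dots> \<le> 2 * r * real n ^ 50"
      using comp[OF i, of "mat_vec n A x"] x d r0 by (intro mult_mono) auto
    finally show ?thesis .
  qed
  have "\<exists>i<n. 1 / n \<le> cmod (x i)"
  proof (rule ccontr)
    assume "\<not> ?thesis"
    then have lt: "cmod (x i) < 1 / n" if "i < n" for i using that by (auto simp: not_le)
    have "(\<Sum>i<n. (cmod (x i))\<^sup>2) < (\<Sum>i<n. 1 / real n)"
    proof (rule sum_strict_mono)
      fix i assume i: "i \<in> {..<n}"
      have "1 / real n \<le> 1" using n64 by simp
      moreover have "cmod (x i) < 1 / real n" using lt i by simp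
      ultimately have "cmod (x i) \<le> 1" by linarith
      then have "(cmod (x i))\<^sup>2 \<le> cmod (x i) * 1"
        unfolding power2_eq_square by (intro mult_left_mono) auto
      then show "(cmod (x i))\<^sup>2 < 1 / real n" using lt[of i] i by simp
    qed (use n0 in auto)
    also have "\<dots> = 1" using n0 by simp
    finally show False using x(1) unfolding vnorm_def by simp
  qed
  then obtain i0 where i0: "i0 < n" "1 / n \<le> cmod (x i0)" by blast
  have "0 < 1 / real n" using n0 by simp
  then have "x i0 \<noteq> 0" using i0 by auto
  then obtain c where c: "0 < c" "cmod (x i0) \<le> c" "\<And>i. i < n \<Longrightarrow> cmod (x i / of_real c) \<le> 1"
    "\<exists>i<n. cmod (x i / of_real c) = 1" using ex_sup_normalised[of i0 n x] i0 by blast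
  have "cmod (perm_op d \<zeta> ps (\<lambda>i. x i / of_real c) i) \<le> \<epsilon> / n" if i: "i < n" for i
  proof -
    have "perm_op d \<zeta> ps (\<lambda>i. x i / of_real c) i = perm_op d \<zeta> ps x i / of_real c"
      unfolding perm_op_def by (simp add: sum_divide_distrib diff_divide_distrib)
    then have "cmod (perm_op d \<zeta> ps (\<lambda>i. x i / of_real c) i) = cmod (perm_op d \<zeta> ps x i) / c"
      using c by (simp add: norm_divide)
    also have "\<dots> \<le> (2 * r * real n ^ 50) / (1 / n)"
      using small[OF i] c i0 n0 r0 by (intro frac_le) auto
    also have "\<dots> = (2 * real n ^ 51) * r" using power_Suc[of "real n" 50] by simp
    also have "\<dots> \<le> real n ^ 52 * r"
    proof (rule mult_right_mono)
      have "2 * real n ^ 51 \<le> real n * real n ^ 51" using n64 by (intro mult_right_mono) auto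
      then show "2 * real n ^ 51 \<le> real n ^ 52" using power_Suc[of "real n" 51] by simp
    qed (use r0 in simp)
    also have "\<dots> \<le> \<epsilon> / n"
    proof -
      have "real n ^ (204 * T + 58) = real n powr (204 * T + 58)"
        using n64 by (subst powr_realpow[symmetric]) auto
      also have "\<dots> \<le> real n powr (700 * L)"
        using T_le L1 n64 by (intro powr_mono) auto
      finally have "real n ^ (204 * T + 58) * r \<le> real n powr (700 * L) * r"
        using r0 by (intro mult_right_mono) auto
      also have "\<dots> = 1" unfolding r_def using n64 by (simp add: powr_add[symmetric])
      finally have "real n ^ (204 * T + 58) * r \<le> 1" .
      moreover have "real n ^ (204 * T + 58) = real n ^ 52 * (real n ^ (204 * T + 5) * real n ^ 1)"
        unfolding power_add[symmetric] by (rule arg_cong[where f = "(^) (real n)"]) simp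
      ultimately have "real n ^ 52 * r * (real n ^ (204 * T + 5) * n) \<le> 1"
        by (simp only: power_one_right mult_ac)
      moreover have "\<epsilon> / n = 1 / (real n ^ (204 * T + 5) * n)" unfolding \<epsilon>_def by simp
      ultimately show ?thesis using n0 by (simp add: pos_le_divide_eq)
    qed
    finally show ?thesis .
  qed
  then show ?thesis using c(3,4) by (intro exI[of _ "\<lambda>i. x i / of_real c"]) blast
qed

end

lemma mat_vec_perm_sum_matrix:
  assumes ps: "ps \<in> perm_tuples n d" and i: "i < n" and d: "0 < d"
  shows "mat_vec n (\<lambda>i j. perm_sum_matrix d ps i j / of_real (sqrt d) - (if i = j then z else 0)) x i
    = perm_op d (z * of_real (sqrt d)) ps x i / of_real (sqrt d)"
proof -
  have "perm_sum_matrix d ps i j / of_real (sqrt d) - (if i = j then z else 0)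
      = perm_op d (z * of_real (sqrt d)) ps (\<lambda>k. of_bool (k = j)) i / of_real (sqrt d)" for j
  proof -
    have "perm_sum_matrix d ps i j = (\<Sum>l<d. of_bool (ps l i = j))"
      unfolding perm_sum_matrix_def of_nat_sum by (intro sum.cong) auto
    then show ?thesis unfolding perm_op_def using d by (simp add: diff_divide_distrib)
  qed
  then have "mat_vec n (\<lambda>i j. perm_sum_matrix d ps i j / of_real (sqrt d) - (if i = j then z else 0)) x i
    = (\<Sum>j<n. perm_op d (z * of_real (sqrt d)) ps (\<lambda>k. of_bool (k = j)) i * x j) / of_real (sqrt d)"
    unfolding mat_vec_def sum_divide_distrib by simp
  then show ?thesis unfolding perm_op_of_bool_sum[OF ps i] .
qed

section \<open>Choice of constants and the trivial ranges\<close>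

theorem theorem2p1:
  "\<exists>Cbar>0. \<forall>R>0. \<exists>C. \<forall>(n::nat) (d::nat) (z::complex).
     2 \<le> n \<longrightarrow> 1 \<le> d \<longrightarrow> d \<le> n ^ 100 \<longrightarrow> cmod z \<le> R \<longrightarrow>
     unif_prob (perm_tuples n d)
       (\<lambda>ps. smallest_sv n (\<lambda>i j. perm_sum_matrix d ps i j / complex_of_real (sqrt (real d))
                                 - (if i = j then z else 0))
             \<le> real n powr (- Cbar * log (real (min d n)) (real n)))
     \<le> C * (ln (real n)) ^ 4 / sqrt (real (min d n))"
proof (rule exI[of _ 700], intro conjI allI impI)
  fix R :: real assume R: "0 < R"
  \<comment> \<open>4 R^2 \<le> d yields 2 |z| sqrt d \<le> d, as the dense regime requires.\<close>
  define M where "M = 64 + 4 * R\<^sup>2"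
  \<comment> \<open>The second summand serves the range of m below \<open>M\<close>, where only ln n
    \<ge> ln 2 is available.\<close>
  define C where "C = 10 ^ 11 + sqrt M / (ln 2) ^ 4"
  have M0: "0 < M" unfolding M_def by (simp add: add_pos_nonneg)
  have C11: "10 ^ 11 \<le> C" and CM: "sqrt M / (ln 2) ^ 4 \<le> C" unfolding C_def using M0 by auto
  show "\<exists>C. \<forall>(n::nat) (d::nat) (z::complex). 2 \<le> n \<longrightarrow> 1 \<le> d \<longrightarrow> d \<le> n ^ 100 \<longrightarrow> cmod z \<le> R \<longrightarrow>
     unif_prob (perm_tuples n d)
       (\<lambda>ps. smallest_sv n (\<lambda>i j. perm_sum_matrix d ps i j / complex_of_real (sqrt (real d))
                                 - (if i = j then z else 0))
             \<le> real n powr (- 700 * log (real (min d n)) (real n)))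
     \<le> C * (ln (real n)) ^ 4 / sqrt (real (min d n))"
  proof (rule exI[of _ C], intro allI impI)
    fix n d :: nat and z :: complex
    assume n: "2 \<le> n" and d: "1 \<le> d" "d \<le> n ^ 100" and z: "cmod z \<le> R"
    let ?m = "real (min d n)"
    let ?E = "\<lambda>ps. smallest_sv n (\<lambda>i j. perm_sum_matrix d ps i j / complex_of_real (sqrt (real d))
                                 - (if i = j then z else 0)) \<le> real n powr (- 700 * log ?m (real n))"
    have m1: "1 \<le> ?m" using n d by simp
    have ln2: "ln 2 \<le> ln (real n)" using n by simp
    have l0: "0 < ln (2::real)" by simp
    have trivial: "unif_prob (perm_tuples n d) ?E \<le> C * ln n ^ 4 / sqrt ?m" if "sqrt ?m \<le> C * ln n ^ 4"
    proof -
      have "1 \<le> C * ln n ^ 4 / sqrt ?m" using that m1 by (simp add: pos_le_divide_eq)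
      then show ?thesis using unif_prob_le_1[OF finite_perm_tuples, of n d ?E] by linarith
    qed
    show "unif_prob (perm_tuples n d) ?E \<le> C * ln n ^ 4 / sqrt ?m"
    proof (cases "M \<le> ?m \<and> 10 ^ 17 * ln n ^ 8 \<le> ?m")
      case False
      then consider "?m < M" | "?m < 10 ^ 17 * ln n ^ 8" by linarith
      then show ?thesis
      proof cases
        \<comment> \<open>This includes min d n = 1, where the logarithm has base 1: the trivial
          bound holds whatever the event says.\<close>
        case 1
        have "sqrt ?m \<le> sqrt M" using 1 by simp
        also have "\<dots> = sqrt M / ln 2 ^ 4 * ln 2 ^ 4" by simp
        also have "\<dots> \<le> C * ln n ^ 4"
          using CM C11 ln2 l0 by (intro mult_mono power_mono) auto
        finally show ?thesis by (rule trivial)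
      next
        case 2
        have "sqrt ?m \<le> 10 ^ 9 * ln n ^ 4"
        proof (rule real_le_lsqrt)
          have "10 ^ 17 * ln n ^ 8 \<le> 10 ^ 18 * ln n ^ 8" by (intro mult_right_mono) auto
          also have "\<dots> = (10 ^ 9 * ln n ^ 4)\<^sup>2" by (simp add: power_mult_distrib power_mult[symmetric])
          finally show "?m \<le> (10 ^ 9 * ln n ^ 4)\<^sup>2" using 2 by linarith
        qed (use n in auto)
        also have "\<dots> \<le> C * ln n ^ 4" using C11 by (intro mult_right_mono) auto
        finally show ?thesis by (rule trivial)
      qed
    next
      case True
      define \<zeta> where "\<zeta> = z * of_real (sqrt d)"
      interpret dense_regime n d \<zeta>
      proof
        show "d \<le> n ^ 100" by (rule d)
        have "64 + 4 * R\<^sup>2 \<le> ?m" using True unfolding M_def by simp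
        then show "64 \<le> min d n" using zero_le_power2[of R] by linarith
        have "(2 * R)\<^sup>2 \<le> d" using \<open>64 + 4 * R\<^sup>2 \<le> ?m\<close> by (simp add: power_mult_distrib)
        then have "2 * R \<le> sqrt d" by (rule real_le_rsqrt)
        then have "2 * cmod z \<le> sqrt d" using z by linarith
        then have "(2 * cmod z) * sqrt d \<le> sqrt d * sqrt d" by (intro mult_right_mono) auto
        then show "2 * cmod \<zeta> \<le> d" unfolding \<zeta>_def by (simp add: norm_mult)
        show "10 ^ 17 * ln n ^ 8 \<le> ?m" using True by simp
      qed
      have "unif_prob (perm_tuples n d) ?E
          \<le> unif_prob (perm_tuples n d) (\<lambda>ps. \<exists>x. (\<forall>i<n. cmod (x i) \<le> 1) \<and> (\<exists>i<n. cmod (x i) = 1)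
             \<and> (\<forall>i<n. cmod (perm_op d \<zeta> ps x i) \<le> \<epsilon> / n))"
      proof (rule unif_prob_mono)
        fix ps assume ps: "ps \<in> perm_tuples n d" and E: "?E ps"
        show "\<exists>x. (\<forall>i<n. cmod (x i) \<le> 1) \<and> (\<exists>i<n. cmod (x i) = 1)
             \<and> (\<forall>i<n. cmod (perm_op d \<zeta> ps x i) \<le> \<epsilon> / n)"
        proof (rule ex_near_null_of_small_sv)
          show "smallest_sv n (\<lambda>i j. perm_sum_matrix d ps i j / complex_of_real (sqrt (real d))
                                 - (if i = j then z else 0)) \<le> real n powr (- 700 * L)"
            using E unfolding L_def m_def .
          show "mat_vec n (\<lambda>i j. perm_sum_matrix d ps i j / complex_of_real (sqrt (real d))
                                 - (if i = j then z else 0)) x i = perm_op d \<zeta> ps x i / of_real (sqrt d)"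
            if "i < n" for x i
            unfolding \<zeta>_def using ps that d by (intro mat_vec_perm_sum_matrix) auto
        qed
      qed simp
      also have "\<dots> \<le> 10 ^ 11 * ln n ^ 4 / sqrt ?m"
        using unif_prob_near_null unfolding \<Lambda>_def m_def .
      also have "\<dots> \<le> C * ln n ^ 4 / sqrt ?m"
        using C11 by (intro divide_right_mono mult_right_mono) auto
      finally show ?thesis .
    qed
  qed
qed simp

end
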